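(* For each $\ell \geqslant 2$, there exists a constant $C = C(\ell)$ such that the following holds for all sufficiently large $n, k \in \mathbb{N}$ with $k \leqslant n^{(\ell-1)^2/\ell(2\ell-1)}/(\log n)^{\ell-1}$. There exists a collection $\mathcal{G}_\ell(k)$ of at most $\exp\big( C k^{-1/(\ell-1)} n^{1+1/\ell} \log k \big)$ graphs on vertex set $[n]$ such that $e(G) \leqslant k n^{1+1/\ell}$ for every $G \in \mathcal{G}_\ell(k)$, and every $C_{2\ell}$-free graph on vertex set $[n]$ is a subgraph of some $G \in \mathcal{G}_\ell(k)$.
   Context: $C_{2\ell}$ is the cycle of length $2\ell$; $e(G)$ is the number of edges of $G$. *)

theory Defs
  imports Complex_Main
begin

type_synonym 'a graph = "'a set \<times> 'a set set"

abbreviation verts :: "'a graph \<Rightarrow> 'a set" where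
  "verts G \<equiv> fst G"

abbreviation edges :: "'a graph \<Rightarrow> 'a set set" where
  "edges G \<equiv> snd G"

definition simple_graph :: "'a graph \<Rightarrow> bool" where
  "simple_graph G \<longleftrightarrow> finite (verts G) \<and> (\<forall>e\<in>edges G. e \<subseteq> verts G \<and> card e = 2)"

definition graphs_on :: "'a set \<Rightarrow> 'a graph set" where
  "graphs_on V = {G. simple_graph G \<and> verts G = V}"

definition subgraph :: "'a graph \<Rightarrow> 'a graph \<Rightarrow> bool" where
  "subgraph H G \<longleftrightarrow>
     simple_graph H \<and> simple_graph G \<and> verts H \<subseteq> verts G \<and> edges H \<subseteq> edges G"

definition isomorphic :: "'a graph \<Rightarrow> 'b graph \<Rightarrow> bool" where
  "isomorphic G H \<longleftrightarrow>
     (\<exists>f. bij_betw f (verts G) (verts H) \<and> edges H = (\<lambda>e. f ` e) ` edges G)"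

text \<open>Subgraphs are not required to be induced.\<close>

definition free_of :: "'b graph \<Rightarrow> 'a graph \<Rightarrow> bool" where
  "free_of H G \<longleftrightarrow> \<not> (\<exists>S. subgraph S G \<and> isomorphic H S)"

text \<open>The cycle of length \<open>m\<close> on the vertices \<open>0, \<dots>, m - 1\<close>; a simple graph only for \<open>m \<ge> 3\<close>.\<close>

definition cycle_graph :: "nat \<Rightarrow> nat graph" where
  "cycle_graph m = ({0..<m}, {{i, Suc i mod m} | i. i < m})"

end

theory Submission
  imports Defs "HOL-Analysis.Analysis"
begin

text \<open>Containers arise by repeatedly shrinking a graph with \<open>e = \<kappa> n\<^bsup>1 + 1/l\<^esup>\<close> edges, \<open>\<kappa> \<ge> k\<close>, by a
  constant factor. One shrinking step applies the hypergraph container method to a family \<open>H\<close> of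
  \<open>2l\<close>-cycles in which every set of \<open>t\<close> edges lies in \<open>O(|H| / (e s\<^bsup>t-1\<^esup>))\<close> members, where
  \<open>s = min (\<kappa>\<^bsup>l/(l-1)\<^esup>) (\<kappa> n\<^bsup>\<beta>\<^esup>)\<close> and \<open>\<beta> = (l-1)/(l(2l-1))\<close>. The fingerprints have \<open>O(e/s)\<close> elements,
  and their total cost is a geometric sum in \<open>\<kappa>\<close>.

  As \<open>H\<close> one takes a maximal family subject to the degree bounds: if it were too small, one could add
  a further cycle that avoids all saturated edge sets. This cycle is found by counting closed walks,
  after high-degree vertices have been split so that all degrees are \<open>O(d)\<close>, where \<open>d = e/n\<close>. The number
  \<open>M j\<close> of closed walks of length \<open>2j\<close> is log-convex in \<open>j\<close>; together with \<open>M 1 = O(nd)\<close>, \<open>M l = \<Omega>(d\<^bsup>2l\<^esup>)\<close>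
  and \<open>n s\<^bsup>l-1\<^esup> \<le> d\<^sup>l\<close> this gives \<open>M (l - h) = O(M l / (d s)\<^sup>h)\<close>. By Cauchy-Schwarz, the closed walks of
  length \<open>2l\<close> with a saturated set at \<open>t\<close> given positions number \<open>O(\<epsilon> d s\<^bsup>t-1\<^esup> M (l - t/2))\<close> for even
  \<open>t\<close>, and similarly for odd \<open>t\<close>, which is \<open>O(\<epsilon> M l)\<close>. Walks through two copies of one
  vertex are rare because shortening them by two steps costs a factor of only \<open>O(d)\<close>, whereas
  \<open>M l = \<Omega>(d s M (l - 1))\<close>.\<close>

section \<open>Hypergraph containers\<close>

text \<open>The two terms in the minimum defining \<open>s\<close> have different origins. With d =
  \<kappa> n^(1/l), the condition n s^(l-1) \<le> d^l reads s \<le> \<kappa>^(l/(l-1)). The other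
  term is due to sets of 2l edges: the degree |H| / (e s^(t-1)) allowed to a set of t edges, with
  |H| of order d^(2l) and e = n d, must not fall below a constant at t = 2l, because a member of H
  is such a set itself. This gives s \<le> d n^(-1/(2l-1)) = \<kappa> n^\<beta>. Its price is a cost
  term n^(-\<beta>) that does not decay along the O(log n) shrinking steps; with the logarithm in
  each step it adds up to n^(-\<beta>) (log n)^2, and the upper bound assumed for k is what absorbs
  it into k^(-1/(l-1)) log k. A graph may have far more closed walks than d^(2l). Bad walks are
  therefore measured against \<open>M l\<close> itself, while H only has to reach a small multiple
  of d^(2l) members.\<close>

lemma sum_UN_le:
  fixes f :: "'b \<Rightarrow> real"
  assumes "finite I" "\<And>i. i \<in> I \<Longrightarrow> finite (A i)" "\<And>x. f x \<ge> 0"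
  shows "sum f (\<Union>i\<in>I. A i) \<le> (\<Sum>i\<in>I. sum f (A i))"
  using assms
proof (induction I rule: finite_induct)
  case (insert i I)
  have "sum f (A i \<union> (\<Union>i\<in>I. A i)) \<le> sum f (A i) + sum f (\<Union>i\<in>I. A i)"
    using insert by (subst sum_Un) (auto intro!: sum_nonneg)
  then show ?case using insert by force
qed simp

definition set_deg :: "'a set \<Rightarrow> ('a set \<Rightarrow> real) \<Rightarrow> 'a set \<Rightarrow> real" where
  "set_deg V w T = (\<Sum>D\<in>{D\<in>Pow V. T \<subseteq> D}. w D)"

definition uniform_weight :: "'a set \<Rightarrow> nat \<Rightarrow> ('a set \<Rightarrow> real) \<Rightarrow> bool" where
  "uniform_weight V r w \<longleftrightarrow> (\<forall>D. w D \<ge> 0) \<and> (\<forall>D. w D \<noteq> 0 \<longrightarrow> D \<subseteq> V \<and> card D = r)"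

text \<open>Weights replace hypergraphs because the hypergraph of the next round is a sum of links,
  with multiplicities, and is rescaled afterwards. As the total weight is at least the number of
  vertices, the bound \<open>K\<close> for singletons keeps every degree within a constant factor of
  the average; each further element of \<open>T\<close> costs a factor \<open>p\<close>.\<close>

definition spread_weight :: "'a set \<Rightarrow> nat \<Rightarrow> real \<Rightarrow> real \<Rightarrow> ('a set \<Rightarrow> real) \<Rightarrow> bool" where
  "spread_weight V r K p w \<longleftrightarrow> uniform_weight V r w \<and> real (card V) \<le> sum w (Pow V) \<and>
     (\<forall>T. T \<subseteq> V \<longrightarrow> T \<noteq> {} \<longrightarrow> set_deg V w T \<le> K * p ^ (card T - 1))"

definition indep :: "('a set \<Rightarrow> real) \<Rightarrow> 'a set \<Rightarrow> bool" where
  "indep w I \<longleftrightarrow> (\<forall>D\<subseteq>I. w D = 0)"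

section \<open>One round of the container algorithm, from uniformity \<open>j + 1\<close> to
  \<open>j\<close>\<close>

locale container_step =
  fixes V :: "'a set" and w :: "'a set \<Rightarrow> real" and j :: nat and K p c :: real
    and idx :: "'a \<Rightarrow> nat"
  assumes finV: "finite V" and inj_idx: "inj_on idx V"
    and spread: "spread_weight V (Suc j) K p w" and j_pos: "j \<ge> 1"
    and p_pos: "p > 0" and K_pos: "K > 0"
    and c_def: "c = 1 / (real (Suc j) * 2 ^ (j + 1))"
begin

text \<open>The exponent is \<open>card T\<close> and not \<open>card T - 1\<close> because the
  accumulated weight is divided by \<open>c * p\<close> at the end of the round, which restores the
  exponent of a spread weight.\<close>

definition sat :: "('a set \<Rightarrow> real) \<Rightarrow> 'a set \<Rightarrow> bool" where
  "sat u T \<longleftrightarrow> T \<subseteq> V \<and> T \<noteq> {} \<and> set_deg V u T \<ge> K * p ^ card T"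

text \<open>Skipping edges whose remainder contains a saturated set ensures that a saturated set
  never gains weight again.\<close>

definition usable :: "('a set \<Rightarrow> real) \<Rightarrow> 'a \<Rightarrow> 'a set \<Rightarrow> bool" where
  "usable u v D \<longleftrightarrow> v \<in> D \<and> (\<forall>T. T \<subseteq> D - {v} \<longrightarrow> \<not> sat u T)"

definition gdeg :: "('a set \<Rightarrow> real) \<Rightarrow> 'a \<Rightarrow> real" where
  "gdeg u v = (\<Sum>D\<in>{D\<in>Pow V. usable u v D}. w D)"

definition link :: "('a set \<Rightarrow> real) \<Rightarrow> 'a \<Rightarrow> 'a set \<Rightarrow> real" where
  "link u v D = (if v \<in> V \<and> v \<notin> D \<and> usable u v (insert v D) then w (insert v D) else 0)"

definition cand :: "'a set \<Rightarrow> 'a set \<times> ('a set \<Rightarrow> real) \<Rightarrow> 'a set" where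
  "cand I st = {v \<in> I - fst st. gdeg (snd st) v \<ge> c}"

text \<open>Each chosen vertex adds at least \<open>c\<close> to the mass of the new weight, so
  stopping at mass \<open>c * p * card V\<close> keeps the fingerprint at about
  \<open>p * card V\<close> vertices.\<close>

definition active :: "'a set \<Rightarrow> 'a set \<times> ('a set \<Rightarrow> real) \<Rightarrow> bool" where
  "active I st \<longleftrightarrow> sum (snd st) (Pow V) < c * p * card V \<and> cand I st \<noteq> {}"

definition pick :: "'a set \<Rightarrow> 'a set \<times> ('a set \<Rightarrow> real) \<Rightarrow> 'a" where
  "pick I st = arg_min idx (\<lambda>v. v \<in> cand I st)"

definition step :: "'a set \<Rightarrow> 'a set \<times> ('a set \<Rightarrow> real) \<Rightarrow> 'a set \<times> ('a set \<Rightarrow> real)" where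
  "step I st = (if active I st then
     (insert (pick I st) (fst st), \<lambda>D. snd st D + link (snd st) (pick I st) D) else st)"

definition run :: "nat \<Rightarrow> 'a set \<Rightarrow> 'a set \<times> ('a set \<Rightarrow> real)" where
  "run n I = (step I ^^ n) ({}, \<lambda>_. 0)"

lemma run_0 [simp]: "run 0 I = ({}, \<lambda>_. 0)"
  by (simp add: run_def)

lemma run_Suc [simp]: "run (Suc n) I = step I (run n I)"
  by (simp add: run_def)

lemma pick_mem: "cand I st \<noteq> {} \<Longrightarrow> pick I st \<in> cand I st"
  unfolding pick_def by (metis arg_min_natI ex_in_conv)

lemma pick_least: "v \<in> cand I st \<Longrightarrow> idx (pick I st) \<le> idx v"
  unfolding pick_def by (rule arg_min_nat_le)

lemma fst_step: "fst st \<subseteq> fst (step I st)"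
  by (auto simp: step_def)

lemma fst_run_mono: "m \<le> n \<Longrightarrow> fst (run m I) \<subseteq> fst (run n I)"
  by (rule lift_Suc_mono_le[of "\<lambda>n. fst (run n I)"]) (use fst_step in auto)

lemma fst_run_sub: "fst (run n I) \<subseteq> I"
proof (induction n)
  case (Suc n)
  show ?case
  proof (cases "active I (run n I)")
    case True
    then have "pick I (run n I) \<in> cand I (run n I)" by (intro pick_mem) (auto simp: active_def)
    with Suc True show ?thesis by (auto simp: step_def cand_def)
  next
    case False with Suc show ?thesis by (simp add: step_def)
  qed
qed simp

lemma finite_fst_run: "I \<subseteq> V \<Longrightarrow> finite (fst (run n I))"
  by (rule finite_subset[OF _ finV]) (use fst_run_sub in blast)

text \<open>A run is determined by its fingerprint, because the next vertex is the first candidate in a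
  fixed order and that vertex belongs to the fingerprint.\<close>

lemma run_fingerprint:
  assumes "I \<subseteq> V" "n \<le> M"
  shows "run n (fst (run M I)) = run n I"
  using assms(2)
proof (induction n)
  case (Suc n)
  define S where "S = fst (run M I)"
  define st where "st = run n I"
  have eq: "run n S = st" using Suc by (simp add: S_def st_def)
  have SI: "S \<subseteq> I" unfolding S_def by (rule fst_run_sub)
  have candS: "cand S st \<subseteq> cand I st" using SI by (auto simp: cand_def)
  show ?case
  proof (cases "active I st")
    case True
    then have pm: "pick I st \<in> cand I st" by (intro pick_mem) (auto simp: active_def)
    have "pick I st \<in> fst (run (Suc n) I)" using True by (simp add: st_def[symmetric] step_def)
    also have "\<dots> \<subseteq> S" unfolding S_def using Suc.prems by (rule fst_run_mono)
    finally have pS: "pick I st \<in> cand S st" using pm by (auto simp: cand_def)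
    then have act: "active S st" using True by (auto simp: active_def)
    have "pick S st \<in> cand S st" using pS by (intro pick_mem) auto
    then have "idx (pick I st) = idx (pick S st)"
      using pick_least[of "pick S st" I st] pick_least[OF pS] candS by force
    moreover have "pick S st \<in> V" "pick I st \<in> V"
      using \<open>pick S st \<in> cand S st\<close> candS pm assms(1) by (auto simp: cand_def)
    ultimately have "pick S st = pick I st" using inj_idx by (auto dest: inj_onD)
    then have "step S st = step I st" using True act by (simp add: step_def)
    then show ?thesis using eq by (simp add: st_def S_def)
  next
    case False
    then have "\<not> active S st" using candS by (auto simp: active_def)
    then have "step S st = step I st" using False by (simp add: step_def)
    then show ?thesis using eq by (simp add: st_def S_def)
  qed
qed simp

lemma w_nonneg: "w D \<ge> 0" and w_supp: "w D \<noteq> 0 \<Longrightarrow> D \<subseteq> V \<and> card D = Suc j"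
  using spread by (auto simp: spread_weight_def uniform_weight_def)

lemma w_deg: "T \<subseteq> V \<Longrightarrow> T \<noteq> {} \<Longrightarrow> set_deg V w T \<le> K * p ^ (card T - 1)"
  using spread by (auto simp: spread_weight_def)

lemma c_pos: "c > 0" by (simp add: c_def)

lemma link_nonneg: "link u v D \<ge> 0" by (simp add: link_def w_nonneg)

lemma link_supp: "link u v D \<noteq> 0 \<Longrightarrow> D \<subseteq> V \<and> card D = j"
proof -
  assume "link u v D \<noteq> 0"
  then have v: "v \<notin> D" "w (insert v D) \<noteq> 0" by (auto simp: link_def split: if_splits)
  with w_supp[OF v(2)] finV show ?thesis
    by (metis card_insert_disjoint finite_subset insert_subset old.nat.inject)
qed

lemma sum_link:
  assumes "v \<in> V"
  shows "(\<Sum>D\<in>{D\<in>Pow V. Q D}. link u v D) = (\<Sum>D\<in>{D\<in>Pow V. usable u v D \<and> Q (D - {v})}. w D)"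
proof -
  have "(\<Sum>D\<in>{D\<in>Pow V. Q D}. link u v D) =
      (\<Sum>D\<in>{D\<in>Pow V. Q D \<and> v \<notin> D \<and> usable u v (insert v D)}. w (insert v D))"
    by (rule sum.mono_neutral_cong_right) (use finV assms in \<open>auto simp: link_def\<close>)
  also have "\<dots> = (\<Sum>D\<in>{D\<in>Pow V. usable u v D \<and> Q (D - {v})}. w D)"
    by (rule sum.reindex_bij_witness[of _ "\<lambda>D. D - {v}" "insert v"])
      (use assms in \<open>auto simp: usable_def insert_absorb\<close>)
  finally show ?thesis .
qed

lemma sum_link_total: "v \<in> V \<Longrightarrow> sum (link u v) (Pow V) = gdeg u v"
  using sum_link[of v u "\<lambda>_. True"] by (simp add: gdeg_def Pow_def)

text \<open>The link degree of \<open>T\<close> at \<open>v\<close> is at most the old degree of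
  \<open>insert v T\<close>; the additional element accounts for the exponent
  \<open>card T\<close>.\<close>

lemma set_deg_link:
  assumes "v \<in> V" "T \<subseteq> V" "T \<noteq> {}"
  shows "set_deg V (link u v) T \<le> (if sat u T then 0 else K * p ^ card T)"
proof (cases "sat u T \<or> v \<in> T")
  case True
  then have "{D \<in> Pow V. usable u v D \<and> T \<subseteq> D - {v}} = {}" by (auto simp: usable_def)
  then have "set_deg V (link u v) T = 0"
    unfolding set_deg_def sum_link[OF assms(1)] by (simp only: sum.empty)
  then show ?thesis using K_pos p_pos by simp
next
  case False
  have "set_deg V (link u v) T \<le> set_deg V w (insert v T)"
    unfolding set_deg_def sum_link[OF assms(1)]
    by (rule sum_mono2) (use finV w_nonneg in \<open>auto simp: usable_def\<close>)
  also have "\<dots> \<le> K * p ^ (card (insert v T) - 1)"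
    by (rule w_deg) (use assms in auto)
  also have "card (insert v T) - 1 = card T"
    using False finite_subset[OF assms(2) finV] by simp
  finally show ?thesis using False by simp
qed

text \<open>The factor 2 is the overshoot of a single step: a set is below the threshold before its
  last gain, and one link adds at most the threshold once more. The \<open>+ 1\<close> is the last
  vertex chosen before the mass reached its limit.\<close>

definition invar :: "'a set \<Rightarrow> 'a set \<times> ('a set \<Rightarrow> real) \<Rightarrow> bool" where
  "invar I st \<longleftrightarrow> uniform_weight V j (snd st) \<and> 
     (\<forall>T. T \<subseteq> V \<longrightarrow> T \<noteq> {} \<longrightarrow> set_deg V (snd st) T \<le> 2 * K * p ^ card T) \<and>
     (indep w I \<longrightarrow> indep (snd st) I) \<and>
     c * card (fst st) \<le> sum (snd st) (Pow V) \<and> card (fst st) \<le> p * card V + 1"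

lemma invar_run:
  assumes "I \<subseteq> V"
  shows "invar I (run n I)"
proof (induction n)
  case 0
  show ?case using K_pos p_pos by (auto simp: invar_def uniform_weight_def set_deg_def indep_def)
next
  case (Suc n)
  define st where "st = run n I"
  define v where "v = pick I st"
  have IH: "invar I st" using Suc by (simp add: st_def)
  show ?case
  proof (cases "active I st")
    case False
    then show ?thesis using IH by (simp add: step_def st_def)
  next
    case True
    have vc: "v \<in> cand I st" unfolding v_def by (rule pick_mem) (use True in \<open>auto simp: active_def\<close>)
    have vI: "v \<in> I" "v \<in> V" "v \<notin> fst st" "gdeg (snd st) v \<ge> c"
      using vc assms by (auto simp: cand_def)
    have finS: "finite (fst st)"
      using finite_fst_run[OF assms] by (simp add: st_def)
    let ?u = "\<lambda>D. snd st D + link (snd st) v D"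
    have eq: "run (Suc n) I = (insert v (fst st), ?u)"
      using True by (simp add: step_def st_def[symmetric] v_def)
    have 1: "uniform_weight V j ?u"
    proof -
      have u: "snd st D \<ge> 0" "snd st D \<noteq> 0 \<Longrightarrow> D \<subseteq> V \<and> card D = j" for D
        using IH by (auto simp: invar_def uniform_weight_def)
      have "D \<subseteq> V \<and> card D = j" if "snd st D + link (snd st) v D \<noteq> 0" for D
      proof -
        have "snd st D \<noteq> 0 \<or> link (snd st) v D \<noteq> 0" using that by auto
        then show ?thesis using u(2) link_supp by blast
      qed
      then show ?thesis using u(1) link_nonneg by (simp add: uniform_weight_def)
    qed
    have 2: "set_deg V ?u T \<le> 2 * K * p ^ card T" if "T \<subseteq> V" "T \<noteq> {}" for T
    proof -
      have "set_deg V ?u T = set_deg V (snd st) T + set_deg V (link (snd st) v) T"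
        by (simp add: set_deg_def sum.distrib)
      moreover have "set_deg V (snd st) T \<le> 2 * K * p ^ card T" using IH that by (auto simp: invar_def)
      moreover have "\<not> sat (snd st) T \<Longrightarrow> set_deg V (snd st) T \<le> K * p ^ card T"
        using that by (auto simp: sat_def)
      ultimately show ?thesis using set_deg_link[OF vI(2) that, of "snd st"]
        by (auto split: if_splits)
    qed
    have 3: "indep ?u I" if "indep w I"
    proof -
      have "indep (snd st) I" using IH that by (auto simp: invar_def)
      moreover have "link (snd st) v D = 0" if D: "D \<subseteq> I" for D
        using D vI(1) \<open>indep w I\<close> by (auto simp: link_def indep_def)
      ultimately show ?thesis by (auto simp: indep_def)
    qed
    have "sum ?u (Pow V) = sum (snd st) (Pow V) + gdeg (snd st) v"
      by (simp add: sum.distrib sum_link_total vI)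
    then have 4: "c * card (insert v (fst st)) \<le> sum ?u (Pow V)"
      using IH vI finS by (simp add: invar_def algebra_simps)
    have "c * card (fst st) < c * (p * card V)"
      using IH True by (auto simp: invar_def active_def mult.assoc)
    then have "card (fst st) < p * card V" using c_pos by simp
    then have 5: "card (insert v (fst st)) \<le> p * card V + 1" using finS vI by simp
    show ?thesis unfolding eq invar_def using 1 2 3 4 5 by auto
  qed
qed

text \<open>An inactive state never changes and an active step adds a new vertex, so activity after
  \<open>card V\<close> steps would yield \<open>card V + 1\<close> vertices.\<close>

lemma not_active_final:
  assumes "I \<subseteq> V"
  shows "\<not> active I (run (card V) I)"
proof
  assume act: "active I (run (card V) I)"
  have *: "active I (run n I)" if "n \<le> card V" for n
  proof (rule ccontr)
    assume na: "\<not> active I (run n I)"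
    have "run (n + m) I = run n I" for m
      by (induction m) (use na in \<open>auto simp: step_def\<close>)
    from this[of "card V - n"] that act na show False by simp
  qed
  have "card (fst (run n I)) = n" if "n \<le> Suc (card V)" for n
    using that
  proof (induction n)
    case (Suc n)
    then have a: "active I (run n I)" using * by simp
    then have "pick I (run n I) \<in> cand I (run n I)" by (intro pick_mem) (auto simp: active_def)
    then have "pick I (run n I) \<notin> fst (run n I)" by (auto simp: cand_def)
    moreover have "finite (fst (run n I))" by (rule finite_fst_run[OF assms])
    ultimately show ?case using a Suc by (simp add: step_def)
  qed simp
  from this[of "Suc (card V)"] have "card (fst (run (Suc (card V)) I)) = Suc (card V)" by simp
  moreover have "card (fst (run (Suc (card V)) I)) \<le> card V"
    by (rule card_mono[OF finV]) (use fst_run_sub assms in blast)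
  ultimately show False by simp
qed

text \<open>Every pair \<open>v \<in> D\<close> that is not usable is charged to a saturated subset of \<open>D - {v}\<close>;
  saturated sets are rare because the new weight has small total mass.\<close>

lemma sum_gdeg_ge:
  assumes u: "uniform_weight V j u" and small: "sum u (Pow V) \<le> c * p * card V"
  shows "(\<Sum>v\<in>V. gdeg u v) \<ge> card V / 2"
proof -
  define Sat where "Sat = {T. sat u T}"
  have Sat_sub: "Sat \<subseteq> Pow V - {{}}" by (auto simp: Sat_def sat_def)
  have finSat: "finite Sat" using finite_subset[OF Sat_sub] finV by simp
  have un: "u D \<ge> 0" for D using u by (simp add: uniform_weight_def)
  have card_supp: "real (card D) * w D = real (Suc j) * w D" for D
    using w_supp[of D] by (cases "w D = 0") auto
  have total: "(\<Sum>v\<in>V. \<Sum>D\<in>{D\<in>Pow V. v \<in> D}. w D) = Suc j * sum w (Pow V)"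
  proof -
    have "(\<Sum>v\<in>V. \<Sum>D\<in>{D\<in>Pow V. v \<in> D}. w D) = (\<Sum>D\<in>Pow V. \<Sum>v\<in>{v\<in>V. v \<in> D}. w D)"
      by (rule sum.swap_restrict) (use finV in auto)
    also have "\<dots> = (\<Sum>D\<in>Pow V. real (card D) * w D)"
      by (rule sum.cong) (auto intro!: arg_cong[of _ _ card])
    also have "\<dots> = Suc j * sum w (Pow V)" unfolding card_supp by (simp add: sum_distrib_left)
    finally show ?thesis .
  qed
  have bad: "(\<Sum>D\<in>{D\<in>Pow V. v \<in> D}. w D) - gdeg u v \<le> (\<Sum>T\<in>Sat. \<Sum>D\<in>{D\<in>Pow V. v \<in> D \<and> T \<subseteq> D}. w D)"
    if "v \<in> V" for v
  proof -
    have "(\<Sum>D\<in>{D\<in>Pow V. v \<in> D}. w D) - gdeg u v = (\<Sum>D\<in>{D\<in>Pow V. v \<in> D} - {D\<in>Pow V. usable u v D}. w D)"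
      unfolding gdeg_def by (rule sum_diff[symmetric]) (use finV in \<open>auto simp: usable_def\<close>)
    also have "\<dots> \<le> (\<Sum>D\<in>(\<Union>T\<in>Sat. {D\<in>Pow V. v \<in> D \<and> T \<subseteq> D}). w D)"
      by (rule sum_mono2) (use finV finSat w_nonneg in \<open>auto simp: usable_def Sat_def\<close>)
    also have "\<dots> \<le> (\<Sum>T\<in>Sat. \<Sum>D\<in>{D\<in>Pow V. v \<in> D \<and> T \<subseteq> D}. w D)"
      by (rule sum_UN_le) (use finV finSat w_nonneg in auto)
    finally show ?thesis .
  qed
  have "Suc j * sum w (Pow V) - (\<Sum>v\<in>V. gdeg u v) \<le>
      (\<Sum>v\<in>V. \<Sum>T\<in>Sat. \<Sum>D\<in>{D\<in>Pow V. v \<in> D \<and> T \<subseteq> D}. w D)"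
    unfolding total[symmetric] sum_subtractf[symmetric] by (rule sum_mono) (use bad in auto)
  also have "\<dots> = (\<Sum>T\<in>Sat. \<Sum>v\<in>V. \<Sum>D\<in>{D\<in>{D\<in>Pow V. T \<subseteq> D}. v \<in> D}. w D)"
    by (subst sum.swap) (auto intro!: sum.cong)
  also have "\<dots> = (\<Sum>T\<in>Sat. \<Sum>D\<in>{D\<in>Pow V. T \<subseteq> D}. \<Sum>v\<in>{v\<in>V. v \<in> D}. w D)"
    by (intro sum.cong refl sum.swap_restrict) (use finV in auto)
  also have "\<dots> = (\<Sum>T\<in>Sat. \<Sum>D\<in>{D\<in>Pow V. T \<subseteq> D}. real (card D) * w D)"
    by (intro sum.cong refl) (auto intro!: arg_cong[of _ _ card])
  also have "\<dots> = (\<Sum>T\<in>Sat. Suc j * set_deg V w T)"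
    unfolding card_supp by (simp add: sum_distrib_left set_deg_def)
  \<comment> \<open>A saturated set has degree at least \<open>K * p ^ card T\<close> in
    \<open>u\<close>, which is \<open>p\<close> times the largest degree it can have in
    \<open>w\<close>.\<close>
  also have "\<dots> \<le> (\<Sum>T\<in>Sat. Suc j * (set_deg V u T / p))"
  proof (intro sum_mono mult_left_mono)
    fix T assume T: "T \<in> Sat"
    then have T': "T \<subseteq> V" "T \<noteq> {}" using Sat_sub by auto
    then have "card T > 0" using finV by (meson card_gt_0_iff finite_subset)
    then have "p ^ card T = p * p ^ (card T - 1)" by (simp add: power_eq_if)
    then have "p * (K * p ^ (card T - 1)) \<le> set_deg V u T" using T by (simp add: Sat_def sat_def algebra_simps)
    then have "K * p ^ (card T - 1) \<le> set_deg V u T / p" using p_pos by (simp add: field_simps)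
    with w_deg[OF T'] show "set_deg V w T \<le> set_deg V u T / p" by linarith
  qed auto
  also have "\<dots> = Suc j / p * (\<Sum>T\<in>Sat. set_deg V u T)" by (simp add: sum_distrib_left)
  also have "\<dots> \<le> Suc j / p * (2 ^ j * sum u (Pow V))"
  proof (rule mult_left_mono)
    \<comment> \<open>Over all subsets, each edge of \<open>u\<close> is counted once for each of
      its \<open>2 ^ j\<close> subsets.\<close>
    have "(\<Sum>T\<in>Sat. set_deg V u T) \<le> (\<Sum>T\<in>Pow V. set_deg V u T)"
      by (rule sum_mono2) (use finV Sat_sub un in \<open>auto simp: set_deg_def intro!: sum_nonneg\<close>)
    also have "\<dots> = (\<Sum>D\<in>Pow V. \<Sum>T\<in>{T\<in>Pow V. T \<subseteq> D}. u D)"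
      unfolding set_deg_def by (rule sum.swap_restrict) (use finV in auto)
    also have "\<dots> = (\<Sum>D\<in>Pow V. 2 ^ j * u D)"
    proof (rule sum.cong[OF refl])
      fix D assume D: "D \<in> Pow V"
      have "{T\<in>Pow V. T \<subseteq> D} = Pow D" using D by auto
      moreover have "card D = j \<or> u D = 0" using u by (auto simp: uniform_weight_def)
      moreover have "finite D" using D finV finite_subset by auto
      ultimately show "(\<Sum>T\<in>{T\<in>Pow V. T \<subseteq> D}. u D) = 2 ^ j * u D" by (auto simp: card_Pow)
    qed
    finally show "(\<Sum>T\<in>Sat. set_deg V u T) \<le> 2 ^ j * sum u (Pow V)" by (simp add: sum_distrib_left)
  qed (use p_pos in auto)
  also have "\<dots> \<le> Suc j / p * (2 ^ j * (c * p * card V))"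
    using small p_pos by (intro mult_left_mono) auto
  also have "\<dots> = (real (Suc j) * 2 ^ j * c) * card V" using p_pos by simp
  \<comment> \<open>The value of \<open>c\<close> is chosen for this equation: unusable pairs cost
    at most half of \<open>card V\<close>.\<close>
  also have "real (Suc j) * 2 ^ j * c = 1 / 2" by (simp add: c_def del: of_nat_Suc)
  finally have "Suc j * sum w (Pow V) - (\<Sum>v\<in>V. gdeg u v) \<le> 1 / 2 * card V" .
  then have "Suc j * sum w (Pow V) - (\<Sum>v\<in>V. gdeg u v) \<le> card V / 2" by simp
  moreover have "card V \<le> sum w (Pow V)" using spread by (simp add: spread_weight_def)
  moreover have "sum w (Pow V) \<le> Suc j * sum w (Pow V)"
    using w_nonneg by (simp add: sum_nonneg algebra_simps)
  ultimately show ?thesis by linarith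
qed

lemma gdeg_le: "v \<in> V \<Longrightarrow> gdeg u v \<le> K"
proof -
  assume v: "v \<in> V"
  have "gdeg u v \<le> set_deg V w {v}" unfolding gdeg_def set_deg_def
    by (rule sum_mono2) (use finV w_nonneg in \<open>auto simp: usable_def\<close>)
  also have "\<dots> \<le> K" using w_deg[of "{v}"] v by simp
  finally show ?thesis .
qed

text \<open>Averaging: usable degrees sum to at least \<open>card V / 2\<close>, vertices below
  \<open>c \<le> 1 / 4\<close> account for at most half of that, and any other vertex contributes at
  most \<open>K\<close>.\<close>

lemma low_vertices:
  assumes "uniform_weight V j u" "sum u (Pow V) \<le> c * p * card V"
  shows "card {v\<in>V. gdeg u v < c} \<le> (1 - 1 / (4 * K)) * card V"
proof -
  let ?L = "{v\<in>V. gdeg u v < c}" and ?B = "{v\<in>V. \<not> gdeg u v < c}"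
  have "card (?L \<union> ?B) = card ?L + card ?B"
    by (rule card_Un_disjoint) (use finV in auto)
  moreover have "?L \<union> ?B = V" by auto
  ultimately have split: "card V = card ?L + card ?B" by simp
  have c4: "c \<le> 1/4"
  proof -
    have "2 ^ (j+1) \<ge> (2::real) ^ 2" using j_pos by (intro power_increasing) auto
    then have "real (Suc j) * 2 ^ (j + 1) \<ge> 1 * 4" by (intro mult_mono) auto
    then show ?thesis by (simp add: c_def field_simps)
  qed
  have "card V / 2 \<le> (\<Sum>v\<in>V. gdeg u v)" by (rule sum_gdeg_ge[OF assms])
  also have "\<dots> \<le> (\<Sum>v\<in>V. if gdeg u v < c then c else K)"
    by (rule sum_mono) (auto intro: gdeg_le)
  also have "\<dots> = card ?L * c + card ?B * K"
    using finV by (simp add: sum.If_cases Int_def)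
  also have "\<dots> \<le> card V * (1/4) + card ?B * K"
    using split c4 c_pos K_pos by (intro add_mono mult_mono) auto
  finally have "card ?B \<ge> card V / (4 * K)" using K_pos by (simp add: field_simps)
  then have "real (card ?L) \<le> card V - card V / (4 * K)" using split by linarith
  then show ?thesis by (simp add: algebra_simps)
qed

definition fingerprint :: "'a set \<Rightarrow> 'a set" where
  "fingerprint I = fst (run (card V) I)"

text \<open>Obtained by running on the fingerprint itself, so that it depends on \<open>S\<close>
  alone; \<open>run_fingerprint\<close> identifies it with the outcome of the run on
  \<open>I\<close>.\<close>

definition next_weight :: "'a set \<Rightarrow> 'a set \<Rightarrow> real" where
  "next_weight S = snd (run (card V) S)"

text \<open>Separates the two ways of stopping: with little mass the candidates have run out and a
  container can be read off; otherwise the mass suffices for a round at lower uniformity.\<close>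

definition closed_off :: "'a set \<Rightarrow> bool" where
  "closed_off S \<longleftrightarrow> sum (next_weight S) (Pow V) < c * p * card V"

lemma fingerprint:
  assumes I: "I \<subseteq> V" and ind: "indep w I"
  defines "S \<equiv> fingerprint I"
  shows "S \<subseteq> I" "card S \<le> p * card V + 1" "indep (next_weight S) I"
    "closed_off S \<Longrightarrow> I \<subseteq> S \<union> {v\<in>V. gdeg (next_weight S) v < c}"
proof -
  have eq: "run (card V) S = run (card V) I"
    unfolding S_def fingerprint_def by (rule run_fingerprint) (use I in auto)
  have iv: "invar I (run (card V) I)" by (rule invar_run[OF I])
  show "S \<subseteq> I" unfolding S_def fingerprint_def by (rule fst_run_sub)
  show "card S \<le> p * card V + 1" using iv by (simp add: invar_def S_def fingerprint_def)
  show "indep (next_weight S) I" using iv ind by (simp add: invar_def next_weight_def eq)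
  assume "closed_off S"
  then have "cand I (run (card V) I) = {}"
    using not_active_final[OF I] by (auto simp: active_def closed_off_def next_weight_def eq)
  then show "I \<subseteq> S \<union> {v\<in>V. gdeg (next_weight S) v < c}"
    using I by (auto simp: cand_def S_def fingerprint_def next_weight_def eq[unfolded S_def fingerprint_def])
qed

lemma next_weight_props:
  assumes "S \<subseteq> V"
  shows "uniform_weight V j (next_weight S)"
    "\<not> closed_off S \<Longrightarrow> spread_weight V j (2 * K / c) p (\<lambda>D. next_weight S D / (c * p))"
proof -
  have iv: "invar S (run (card V) S)" by (rule invar_run[OF assms])
  show 1: "uniform_weight V j (next_weight S)" using iv by (simp add: invar_def next_weight_def)
  assume "\<not> closed_off S"
  then have tot: "card V \<le> (\<Sum>D\<in>Pow V. next_weight S D / (c * p))"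
    using c_pos p_pos by (simp add: closed_off_def sum_divide_distrib[symmetric] field_simps)
  have deg: "set_deg V (\<lambda>D. next_weight S D / (c * p)) T \<le> 2 * K / c * p ^ (card T - 1)"
    if "T \<subseteq> V" "T \<noteq> {}" for T
  proof -
    have "card T > 0" using that finV by (meson card_gt_0_iff finite_subset)
    then have pT: "p ^ card T = p * p ^ (card T - 1)" by (simp add: power_eq_if)
    have "set_deg V (\<lambda>D. next_weight S D / (c * p)) T = set_deg V (next_weight S) T / (c * p)"
      by (simp add: set_deg_def sum_divide_distrib)
    also have "\<dots> \<le> 2 * K * p ^ card T / (c * p)"
      using iv that c_pos p_pos by (intro divide_right_mono) (auto simp: invar_def next_weight_def)
    also have "\<dots> = 2 * K / c * p ^ (card T - 1)" using p_pos by (simp add: pT)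
    finally show ?thesis .
  qed
  have "uniform_weight V j (\<lambda>D. next_weight S D / (c * p))"
    using 1 c_pos p_pos by (auto simp: uniform_weight_def)
  with tot deg show "spread_weight V j (2 * K / c) p (\<lambda>D. next_weight S D / (c * p))"
    by (auto simp: spread_weight_def)
qed

end

definition container_family :: "'a set \<Rightarrow> ('a set \<Rightarrow> real) \<Rightarrow> real \<Rightarrow> nat \<Rightarrow> 'a set set \<Rightarrow> bool" where
  "container_family V w \<delta> b \<C> \<longleftrightarrow> finite \<C> \<and> card \<C> \<le> b \<and>
    (\<forall>C\<in>\<C>. C \<subseteq> V \<and> real (card C) \<le> (1 - \<delta>) * real (card V)) \<and> (\<forall>I\<subseteq>V. indep w I \<longrightarrow> (\<exists>C\<in>\<C>. I \<subseteq> C))"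

definition small_subsets :: "'a set \<Rightarrow> real \<Rightarrow> 'a set set" where
  "small_subsets V x = {S \<in> Pow V. real (card S) \<le> x}"

text \<open>Induction on the uniformity. For each possible fingerprint, either one container is read
  off, or there remains a spread weight of uniformity one less for which all sets with this
  fingerprint are independent. So each round multiplies the count by the number of fingerprints. The
  bound \<open>p0\<close> keeps a fingerprint small compared with what its container omits.\<close>

theorem containers:
  assumes "r \<ge> 1" "K > 0"
  shows "\<exists>(\<delta> :: real) (p0 :: real). \<delta> > 0 \<and> p0 > 0 \<and> (\<forall>(V :: 'a set) (p :: real) w. finite V \<longrightarrow> 0 < p \<longrightarrow> p \<le> p0 \<longrightarrow>
    p * card V \<ge> 1 \<longrightarrow> spread_weight V r K p w \<longrightarrow>
    (\<exists>\<C>. container_family V w \<delta> (card (small_subsets V (p * card V + 1)) ^ (r - 1)) \<C>))"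
  using assms
proof (induction r arbitrary: K rule: nat_induct_at_least)
  case base
  show ?case
  proof (rule exI[of _ "1 / K"], rule exI[of _ "1 :: real"], intro conjI allI impI)
    fix V :: "'a set" and p :: real and w
    assume fin: "finite V" and sp: "spread_weight V 1 K p w"
    \<comment> \<open>At uniformity 1 an independent set avoids every vertex of nonzero weight, so a
      single container suffices.\<close>
    define C where "C = {v\<in>V. w {v} = 0}"
    have wn: "w D \<ge> 0" and ws: "w D \<noteq> 0 \<Longrightarrow> card D = 1" for D
      using sp by (auto simp: spread_weight_def uniform_weight_def)
    have "real (card V) \<le> sum w (Pow V)" using sp by (simp add: spread_weight_def)
    also have "\<dots> = (\<Sum>v\<in>V - C. w {v})"
    proof -
      have "sum w (Pow V) = sum w ((\<lambda>v. {v}) ` (V - C))"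
        by (rule sum.mono_neutral_right) (use fin ws in \<open>auto simp: C_def card_1_singleton_iff\<close>)
      also have "\<dots> = (\<Sum>v\<in>V - C. w {v})" by (subst sum.reindex) auto
      finally show ?thesis .
    qed
    also have "\<dots> \<le> (\<Sum>v\<in>V - C. K)"
    proof (rule sum_mono)
      fix v assume v: "v \<in> V - C"
      have "w {v} \<le> set_deg V w {v}" unfolding set_deg_def
        by (rule member_le_sum) (use fin v wn in auto)
      also have "\<dots> \<le> K * p ^ (card {v} - 1)" using sp v by (auto simp: spread_weight_def)
      finally show "w {v} \<le> K" by simp
    qed
    also have "\<dots> = (real (card V) - card C) * K"
      using fin by (subst sum_constant) (simp add: card_Diff_subset C_def of_nat_diff card_mono)
    finally have "card C \<le> (1 - 1 / K) * card V" using base.prems by (simp add: field_simps)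
    moreover have "I \<subseteq> C" if "I \<subseteq> V" "indep w I" for I using that by (auto simp: C_def indep_def)
    ultimately show "\<exists>\<C>. container_family V w (1 / K) (card (small_subsets V (p * card V + 1)) ^ (1 - 1)) \<C>"
      by (intro exI[of _ "{C}"]) (auto simp: container_family_def C_def)
  qed (use base.prems in auto)
next
  case (Suc j)
  define c where "c = 1 / (real (Suc j) * 2 ^ (j + 1))"
  have cpos: "c > 0" by (simp add: c_def)
  from Suc.IH[of "2 * K / c"] Suc.prems cpos obtain \<delta> p0 :: real where d0: "\<delta> > 0" "p0 > 0" and
    IH: "\<And>(V :: 'a set) (p :: real) w. finite V \<Longrightarrow> 0 < p \<Longrightarrow> p \<le> p0 \<Longrightarrow>
    p * card V \<ge> 1 \<Longrightarrow> spread_weight V j (2 * K / c) p w \<Longrightarrow>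
    (\<exists>\<C>. container_family V w \<delta> (card (small_subsets V (p * card V + 1)) ^ (j - 1)) \<C>)" by (fastforce simp: divide_pos_pos)
  \<comment> \<open>The container omits a share \<open>1 / (4 * K)\<close> before the fingerprint is
    put back. The fingerprint has at most \<open>2 * p * card V\<close> elements, and
    \<open>p \<le> 1 / (16 * K)\<close> lets it use up only half of this share.\<close>
  define \<delta>' where "\<delta>' = min \<delta> (1 / (8 * K))"
  define p1 where "p1 = min p0 (1 / (16 * K))"
  show ?case
  proof (rule exI[of _ \<delta>'], rule exI[of _ p1], intro conjI allI impI)
    show "\<delta>' > 0" "p1 > 0" using d0 Suc.prems by (auto simp: \<delta>'_def p1_def)
  next
    fix V :: "'a set" and p :: real and w
    assume fin: "finite V" and p: "0 < p" "p \<le> p1" and pN: "1 \<le> p * card V"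
      and sp: "spread_weight V (Suc j) K p w"
    from finite_imp_inj_to_nat_seg[OF fin] obtain idx :: "'a \<Rightarrow> nat" where idx: "inj_on idx V" by auto
    interpret container_step V w j K p c idx
      by unfold_locales (use fin idx sp Suc p c_def in auto)
    define B where "B = small_subsets V (p * card V + 1)"
    have finB: "finite B" using fin by (simp add: B_def small_subsets_def)
    have "B \<noteq> {}" using p by (auto simp: B_def small_subsets_def intro!: exI[of _ "{}"])
    then have cB: "card B \<ge> 1" using finB by (simp add: Suc_leI card_gt_0_iff)
    have ex: "\<exists>\<C>. finite \<C> \<and> card \<C> \<le> card B ^ (j - 1) \<and>
      (\<forall>C\<in>\<C>. C \<subseteq> V \<and> card C \<le> (1 - \<delta>') * card V) \<and>
      (\<forall>I\<subseteq>V. indep w I \<longrightarrow> fingerprint I = S \<longrightarrow> (\<exists>C\<in>\<C>. I \<subseteq> C))" if S: "S \<in> B" for S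
    proof -
      have SV: "S \<subseteq> V" "card S \<le> p * card V + 1" using S by (auto simp: B_def small_subsets_def)
      show ?thesis
      proof (cases "closed_off S")
        case True
        define C where "C = S \<union> {v\<in>V. gdeg (next_weight S) v < c}"
        have "real (card C) \<le> card S + card {v\<in>V. gdeg (next_weight S) v < c}"
          unfolding C_def of_nat_add[symmetric] of_nat_le_iff by (rule card_Un_le)
        also have "\<dots> \<le> (p * card V + 1) + (1 - 1 / (4 * K)) * card V"
          unfolding of_nat_add by (intro add_mono SV low_vertices next_weight_props)
            (use True in \<open>auto simp: closed_off_def\<close>)
        also have "\<dots> \<le> 2 * (p * card V) + (1 - 1 / (4 * K)) * card V" using pN by simp
        also have "\<dots> \<le> 2 * ((1 / (16 * K)) * card V) + (1 - 1 / (4 * K)) * card V"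
          using p by (intro add_mono mult_left_mono mult_right_mono) (auto simp: p1_def)
        also have "\<dots> = (1 - 1 / (8 * K)) * card V" by (simp add: field_simps)
        also have "\<dots> \<le> (1 - \<delta>') * card V" by (intro mult_right_mono) (auto simp: \<delta>'_def)
        finally have "card C \<le> (1 - \<delta>') * card V" .
        moreover have "I \<subseteq> C" if "I \<subseteq> V" "indep w I" "fingerprint I = S" for I
          using fingerprint(4)[OF that(1,2)] that True by (simp add: C_def)
        ultimately show ?thesis using SV cB
          by (intro exI[of _ "{C}"]) (auto simp: C_def)
      next
        case False
        have "p \<le> p0" using p by (simp add: p1_def)
        from IH[OF fin p(1) this pN next_weight_props(2)[OF SV(1) False]]
        obtain \<C> where C0: "container_family V (\<lambda>D. next_weight S D / (c * p)) \<delta> (card B ^ (j - 1)) \<C>"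
          unfolding B_def by (elim exE)
        have C: "finite \<C>" "card \<C> \<le> card B ^ (j - 1)"
          "\<And>C. C \<in> \<C> \<Longrightarrow> C \<subseteq> V" "\<And>C. C \<in> \<C> \<Longrightarrow> card C \<le> (1 - \<delta>) * card V"
          "\<And>I. I \<subseteq> V \<Longrightarrow> indep (\<lambda>D. next_weight S D / (c * p)) I \<Longrightarrow> (\<exists>C\<in>\<C>. I \<subseteq> C)"
          using C0 by (simp_all add: container_family_def)
        have "(1 - \<delta>) * card V \<le> (1 - \<delta>') * card V" by (intro mult_right_mono) (auto simp: \<delta>'_def)
        with C(4) have "card C \<le> (1 - \<delta>') * card V" if "C \<in> \<C>" for C
          using that by (meson order_trans)
        moreover have "\<exists>C\<in>\<C>. I \<subseteq> C" if "I \<subseteq> V" "indep w I" "fingerprint I = S" for I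
          using C(5)[OF that(1)] fingerprint(3)[OF that(1,2)] that by (simp add: indep_def)
        ultimately show ?thesis using C(1-3) by (intro exI[of _ \<C>]) simp
      qed
    qed
    then obtain f where f: "\<And>S. S \<in> B \<Longrightarrow> finite (f S) \<and> card (f S) \<le> card B ^ (j - 1) \<and>
      (\<forall>C\<in>f S. C \<subseteq> V \<and> card C \<le> (1 - \<delta>') * card V) \<and>
      (\<forall>I\<subseteq>V. indep w I \<longrightarrow> fingerprint I = S \<longrightarrow> (\<exists>C\<in>f S. I \<subseteq> C))" by metis
    have "card (\<Union>S\<in>B. f S) \<le> (\<Sum>S\<in>B. card (f S))" by (rule card_UN_le[OF finB])
    also have "\<dots> \<le> (\<Sum>S\<in>B. card B ^ (j - 1))" by (rule sum_mono) (use f in auto)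
    also have "\<dots> = card B ^ (Suc j - 1)" using Suc.hyps by (cases j) auto
    finally have "card (\<Union>S\<in>B. f S) \<le> card B ^ (Suc j - 1)" .
    moreover have "\<exists>C\<in>(\<Union>S\<in>B. f S). I \<subseteq> C" if I: "I \<subseteq> V" "indep w I" for I
    proof -
      have "fingerprint I \<in> B" using fingerprint(1,2)[OF I] I by (auto simp: B_def small_subsets_def)
      moreover from f[OF this] I obtain C where "C \<in> f (fingerprint I)" "I \<subseteq> C" by auto
      ultimately show ?thesis by (meson UN_I)
    qed
    ultimately show "\<exists>\<C>. container_family V w \<delta>' (card (small_subsets V (p * card V + 1)) ^ (Suc j - 1)) \<C>"
      using f finB unfolding B_def[symmetric] container_family_def by (intro exI[of _ "\<Union>S\<in>B. f S"]) simp
  qed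
qed

section \<open>Closed walks\<close>

text \<open>Log-convexity says that ratios of consecutive values increase. The ratio at
  \<open>i + a\<close> bounds all earlier growth from above and all later growth from below;
  eliminating it gives the inequality.\<close>

lemma log_convex_interpolate:
  fixes f :: "nat \<Rightarrow> real"
  assumes pos: "\<And>i. f i > 0" and lc: "\<And>i. (f (Suc i))\<^sup>2 \<le> f i * f (Suc (Suc i))"
  shows "f (i + a) ^ (a + b) \<le> f i ^ b * f (i + a + b) ^ a"
proof -
  define r where "r j = f (Suc j) / f j" for j
  have r_pos: "r j > 0" for j using pos by (simp add: r_def)
  have fS: "f (Suc j) = r j * f j" for j using pos[of j] by (simp add: r_def)
  have "r j \<le> r (Suc j)" for j
    using lc[of j] pos[of j] pos[of "Suc j"] by (simp add: r_def field_simps power2_eq_square)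
  then have r_mono: "j \<le> k \<Longrightarrow> r j \<le> r k" for j k by (rule lift_Suc_mono_le)
  define \<rho> where "\<rho> = r (i + a)"
  have up: "f (i + a') \<le> f i * \<rho> ^ a'" if "a' \<le> a" for a'
    using that
  proof (induction a')
    case (Suc a')
    have "f (i + Suc a') = r (i + a') * f (i + a')" using fS[of "i + a'"] by simp
    also have "\<dots> \<le> \<rho> * (f i * \<rho> ^ a')"
      using Suc r_pos pos less_imp_le by (intro mult_mono) (auto simp: \<rho>_def intro!: r_mono)
    finally show ?case by (simp add: algebra_simps)
  qed simp
  have dn: "f (i + a) * \<rho> ^ b' \<le> f (i + a + b')" for b'
  proof (induction b')
    case (Suc b')
    have "\<rho> * (f (i + a) * \<rho> ^ b') \<le> r (i + a + b') * f (i + a + b')"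
      using Suc r_pos pos by (intro mult_mono) (auto simp: \<rho>_def less_imp_le intro!: r_mono)
    then show ?case using fS[of "i + a + b'"] by (simp add: algebra_simps)
  qed simp
  have \<rho>: "\<rho> > 0" by (simp add: \<rho>_def r_pos)
  have "f (i + a) ^ (a + b) = f (i + a) ^ b * f (i + a) ^ a" by (simp add: power_add)
  also have "\<dots> \<le> (f i * \<rho> ^ a) ^ b * f (i + a) ^ a"
    using up[of a] pos by (intro mult_right_mono power_mono) (auto simp: less_imp_le)
  also have "\<dots> = f i ^ b * (f (i + a) * \<rho> ^ b) ^ a"
    by (simp add: power_mult_distrib power_mult[symmetric] mult.commute)
  also have "\<dots> \<le> f i ^ b * f (i + a + b) ^ a"
    using dn[of b] pos \<rho> by (intro mult_left_mono power_mono) (auto simp: less_imp_le)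
  finally show ?thesis .
qed

lemma log_convex_pos:
  fixes f :: "nat \<Rightarrow> real"
  assumes "\<And>i. f i \<ge> 0" "\<And>i. (f (Suc i))\<^sup>2 \<le> f i * f (Suc (Suc i))" "f 0 > 0" "f 1 > 0"
  shows "f i > 0"
proof -
  have "f i > 0 \<and> f (Suc i) > 0"
  proof (induction i)
    case (Suc i)
    have "0 < (f (Suc i))\<^sup>2" using Suc by simp
    then have "0 < f i * f (Suc (Suc i))" using assms(2)[of i] by linarith
    then show ?case using Suc by (simp add: zero_less_mult_iff)
  qed (use assms in auto)
  then show ?thesis ..
qed

section \<open>Cauchy-Schwarz estimates for closed walks of a symmetric kernel\<close>

locale walk_kernel =
  fixes U :: "'v set" and a :: "'v \<Rightarrow> 'v \<Rightarrow> real" and \<Delta> :: real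
  assumes finU: "finite U" and a_sym: "a u v = a v u" and a_nn: "a u v \<ge> 0" and a_le1: "a u v \<le> 1"
    and a_deg: "u \<in> U \<Longrightarrow> (\<Sum>v\<in>U. a u v) \<le> \<Delta>"
    and a_out: "u \<in> U \<Longrightarrow> \<exists>v\<in>U. a u v > 0" and U_ne: "U \<noteq> {}"
begin

primrec Wk :: "nat \<Rightarrow> 'v \<Rightarrow> 'v \<Rightarrow> real" where
  "Wk 0 u v = of_bool (u = v)"
| "Wk (Suc n) u v = (\<Sum>w\<in>U. Wk n u w * a w v)"

text \<open>Only even lengths occur: by symmetry \<open>m h v\<close> is a sum of squares over walks
  of half the length, which is what the Cauchy-Schwarz estimates use.\<close>

definition m :: "nat \<Rightarrow> 'v \<Rightarrow> real" where "m h v = Wk (2 * h) v v"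

definition M :: "nat \<Rightarrow> real" where "M h = (\<Sum>v\<in>U. m h v)"

lemma Wk_nn: "Wk n u v \<ge> 0"
  by (induction n arbitrary: v) (auto intro!: sum_nonneg mult_nonneg_nonneg a_nn)

lemma \<Delta>_nn: "\<Delta> \<ge> 0"
proof -
  obtain u where u: "u \<in> U" using U_ne by auto
  have "0 \<le> (\<Sum>v\<in>U. a u v)" by (intro sum_nonneg a_nn)
  with a_deg[OF u] show ?thesis by linarith
qed

lemma Wk_add:
  assumes "v \<in> U"
  shows "Wk (i + j) u v = (\<Sum>w\<in>U. Wk i u w * Wk j w v)"
  using assms
proof (induction j arbitrary: v)
  case 0
  have "(\<Sum>w\<in>U. Wk i u w * Wk 0 w v) = (\<Sum>w\<in>U. if w = v then Wk i u w else 0)"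
    by (intro sum.cong) auto
  then show ?case using 0 finU by simp
next
  case (Suc j)
  have "Wk (i + Suc j) u v = (\<Sum>w\<in>U. (\<Sum>x\<in>U. Wk i u x * Wk j x w) * a w v)"
    using Suc.IH by simp
  also have "\<dots> = (\<Sum>w\<in>U. \<Sum>x\<in>U. Wk i u x * (Wk j x w * a w v))"
    by (simp add: sum_distrib_right mult.assoc)
  also have "\<dots> = (\<Sum>x\<in>U. Wk i u x * Wk (Suc j) x v)"
    by (subst sum.swap) (simp add: sum_distrib_left)
  finally show ?case .
qed

lemma Wk_1: "u \<in> U \<Longrightarrow> Wk (Suc 0) u v = a u v"
proof -
  assume "u \<in> U"
  moreover have "(\<Sum>w\<in>U. of_bool (u = w) * a w v) = (\<Sum>w\<in>U. if u = w then a w v else 0)"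
    by (intro sum.cong) auto
  ultimately show ?thesis using finU by simp
qed

lemma Wk_Suc_left:
  assumes "u \<in> U" "v \<in> U"
  shows "Wk (Suc n) u v = (\<Sum>w\<in>U. a u w * Wk n w v)"
  using Wk_add[of v "Suc 0" n u] assms by (simp add: Wk_1 del: Wk.simps)

lemma Wk_sym: "u \<in> U \<Longrightarrow> v \<in> U \<Longrightarrow> Wk n u v = Wk n v u"
proof (induction n arbitrary: u v)
  case (Suc n)
  have "Wk (Suc n) u v = (\<Sum>w\<in>U. a v w * Wk n w u)"
    using Suc by (auto simp: a_sym intro!: sum.cong)
  also have "\<dots> = Wk (Suc n) v u" using Wk_Suc_left[of v u n] Suc.prems by simp
  finally show ?case .
qed auto

lemma m_0 [simp]: "m 0 v = 1" by (simp add: m_def)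

lemma m_nn: "m h v \<ge> 0" by (simp add: m_def Wk_nn)

lemma M_nn: "M h \<ge> 0" unfolding M_def by (intro sum_nonneg m_nn)

lemma m_eq_sum: "v \<in> U \<Longrightarrow> m h v = (\<Sum>w\<in>U. (Wk h v w)\<^sup>2)"
  unfolding m_def mult_2 by (subst Wk_add) (auto simp: power2_eq_square Wk_sym intro!: sum.cong)

text \<open>Cut the walk after \<open>i\<close> steps and apply Cauchy-Schwarz over the vertex at
  the cut.\<close>

lemma Wk_CS:
  assumes "u \<in> U" "v \<in> U"
  shows "(Wk (i + j) u v)\<^sup>2 \<le> m i u * m j v"
proof -
  have "(Wk (i + j) u v)\<^sup>2 = (\<Sum>w\<in>U. Wk i u w * Wk j v w)\<^sup>2"
    using assms by (auto simp: Wk_add Wk_sym intro!: sum.cong arg_cong[of _ _ "\<lambda>x. x\<^sup>2"])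
  also have "\<dots> \<le> (\<Sum>w\<in>U. (Wk i u w)\<^sup>2) * (\<Sum>w\<in>U. (Wk j v w)\<^sup>2)"
    by (rule Cauchy_Schwarz_ineq_sum)
  finally show ?thesis using assms by (simp add: m_eq_sum)
qed

lemma m_log_convex: "v \<in> U \<Longrightarrow> (m (Suc h) v)\<^sup>2 \<le> m h v * m (Suc (Suc h)) v"
  using Wk_CS[of v v h "Suc (Suc h)"] by (simp add: m_def mult_2 del: Wk.simps)

lemma m_pos:
  assumes v: "v \<in> U"
  shows "m h v > 0"
proof (rule log_convex_pos[of "\<lambda>h. m h v"])
  from a_out[OF v] obtain w where w: "w \<in> U" "a v w > 0" by auto
  have "0 < (Wk (Suc 0) v w)\<^sup>2" using v w by (simp add: Wk_1 del: Wk.simps)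
  also have "\<dots> \<le> m 1 v" unfolding m_eq_sum[OF v] One_nat_def
    by (rule member_le_sum) (use w finU in auto)
  finally show "m 1 v > 0" .
qed (use m_log_convex[OF v] m_nn in auto)

text \<open>Interpolation between \<open>m 0 v = 1\<close> and \<open>m H v\<close>; in other words,
  the \<open>h\<close>-th root of \<open>m h v\<close> increases with \<open>h\<close>.\<close>

lemma m_power_le:
  assumes v: "v \<in> U" and "h \<le> H"
  shows "m h v ^ H \<le> m H v ^ h"
proof -
  have "m (0 + h) v ^ (h + (H - h)) \<le> m 0 v ^ (H - h) * m (0 + h + (H - h)) v ^ h"
    by (rule log_convex_interpolate[of "\<lambda>h. m h v"]) (use m_pos m_log_convex v in auto)
  then show ?thesis using assms by simp
qed

lemma M_log_convex: "(M (Suc h))\<^sup>2 \<le> M h * M (Suc (Suc h))"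
proof -
  have "M (Suc h) \<le> (\<Sum>v\<in>U. sqrt (m h v) * sqrt (m (Suc (Suc h)) v))"
    unfolding M_def
  proof (rule sum_mono)
    fix v assume v: "v \<in> U"
    have "m (Suc h) v = sqrt ((m (Suc h) v)\<^sup>2)" using m_nn by simp
    also have "\<dots> \<le> sqrt (m h v * m (Suc (Suc h)) v)"
      by (rule real_sqrt_le_mono[OF m_log_convex[OF v]])
    finally show "m (Suc h) v \<le> sqrt (m h v) * sqrt (m (Suc (Suc h)) v)" by (simp add: real_sqrt_mult)
  qed
  then have "(M (Suc h))\<^sup>2 \<le> (\<Sum>v\<in>U. sqrt (m h v) * sqrt (m (Suc (Suc h)) v))\<^sup>2"
    using M_nn by (intro power_mono)
  also have "\<dots> \<le> (\<Sum>v\<in>U. (sqrt (m h v))\<^sup>2) * (\<Sum>v\<in>U. (sqrt (m (Suc (Suc h)) v))\<^sup>2)"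
    by (rule Cauchy_Schwarz_ineq_sum)
  also have "\<dots> = M h * M (Suc (Suc h))" by (simp add: M_def m_nn)
  finally show ?thesis .
qed

lemma M_pos: "M h > 0"
  unfolding M_def using finU U_ne m_pos by (intro sum_pos) auto

lemma M_interpolate: "1 \<le> j \<Longrightarrow> j \<le> l \<Longrightarrow> M j ^ (l - 1) \<le> M 1 ^ (l - j) * M l ^ (j - 1)"
  using log_convex_interpolate[of M 1 "j - 1" "l - j"] M_pos M_log_convex by simp

text \<open>The Schur test: a symmetric kernel with row sums at most \<open>\<Delta>\<close> has
  operator norm at most \<open>\<Delta>\<close> in the Euclidean norm. It is applied to the vector
  \<open>Wk h v\<close>.\<close>

lemma m_Suc_le:
  assumes v: "v \<in> U"
  shows "m (Suc h) v \<le> \<Delta>\<^sup>2 * m h v"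
proof -
  have "m (Suc h) v = (\<Sum>u\<in>U. (\<Sum>w\<in>U. (Wk h v w * sqrt (a w u)) * sqrt (a w u))\<^sup>2)"
    unfolding m_eq_sum[OF v] using a_nn by (simp add: mult.assoc)
  also have "\<dots> \<le> (\<Sum>u\<in>U. (\<Sum>w\<in>U. (Wk h v w * sqrt (a w u))\<^sup>2) * (\<Sum>w\<in>U. (sqrt (a w u))\<^sup>2))"
    by (intro sum_mono Cauchy_Schwarz_ineq_sum)
  also have "\<dots> \<le> (\<Sum>u\<in>U. (\<Sum>w\<in>U. (Wk h v w)\<^sup>2 * a w u) * \<Delta>)"
  proof (rule sum_mono, rule mult_mono)
    fix u assume u: "u \<in> U"
    show "(\<Sum>w\<in>U. (Wk h v w * sqrt (a w u))\<^sup>2) \<le> (\<Sum>w\<in>U. (Wk h v w)\<^sup>2 * a w u)"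
      using a_nn by (simp add: power_mult_distrib)
    show "(\<Sum>w\<in>U. (sqrt (a w u))\<^sup>2) \<le> \<Delta>" using a_deg[OF u] a_nn a_sym by simp
  qed (auto intro!: sum_nonneg mult_nonneg_nonneg a_nn)
  also have "\<dots> = \<Delta> * (\<Sum>u\<in>U. \<Sum>w\<in>U. (Wk h v w)\<^sup>2 * a w u)"
    by (simp add: sum_distrib_left mult.commute)
  also have "(\<Sum>u\<in>U. \<Sum>w\<in>U. (Wk h v w)\<^sup>2 * a w u) = (\<Sum>w\<in>U. (Wk h v w)\<^sup>2 * (\<Sum>u\<in>U. a w u))"
    by (subst sum.swap) (simp add: sum_distrib_left)
  also have "\<Delta> * \<dots> \<le> \<Delta> * (\<Sum>w\<in>U. (Wk h v w)\<^sup>2 * \<Delta>)"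
    using a_deg \<Delta>_nn by (intro mult_left_mono sum_mono) auto
  also have "\<dots> = \<Delta>\<^sup>2 * m h v"
    unfolding m_eq_sum[OF v] by (simp add: sum_distrib_left power2_eq_square ac_simps)
  finally show ?thesis .
qed

lemma m_le: "v \<in> U \<Longrightarrow> m h v \<le> \<Delta> ^ (2 * h)"
proof (induction h)
  case (Suc h)
  have "m (Suc h) v \<le> \<Delta>\<^sup>2 * m h v" using Suc by (intro m_Suc_le)
  also have "\<dots> \<le> \<Delta>\<^sup>2 * \<Delta> ^ (2 * h)" using Suc by (intro mult_left_mono) auto
  finally show ?case by (simp add: power2_eq_square)
qed simp

text \<open>\<open>\<mu>\<close> acts as a growth rate per step: the bound at length
  \<open>2 * H\<close> passes down to every shorter even length by \<open>m_power_le\<close>, and a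
  walk of length \<open>g\<close> is cut into two pieces of length at most \<open>H\<close>.\<close>

lemma Wk_le_power:
  assumes u: "u \<in> U" and v: "v \<in> U" and H: "H \<ge> 1" and \<mu>: "\<mu> \<ge> 0"
    and mu: "m H u \<le> \<mu> ^ (2 * H)" and mv: "m H v \<le> \<mu> ^ (2 * H)" and g: "g \<le> 2 * H"
  shows "Wk g u v \<le> \<mu> ^ g"
proof -
  have *: "m h x \<le> \<mu> ^ (2 * h)" if x: "x \<in> U" "m H x \<le> \<mu> ^ (2 * H)" "h \<le> H" for h x
  proof -
    have "m h x ^ H \<le> m H x ^ h" by (rule m_power_le) (use x in auto)
    also have "\<dots> \<le> (\<mu> ^ (2 * H)) ^ h" by (rule power_mono) (use x m_nn in auto)
    also have "\<dots> = (\<mu> ^ (2 * h)) ^ H" by (simp add: power_mult[symmetric] ac_simps)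
    finally show ?thesis using H \<mu> m_nn by (subst (asm) power_mono_iff) auto
  qed
  define h where "h = min g H"
  have h: "h \<le> H" "g - h \<le> H" "h + (g - h) = g" using g by (auto simp: h_def)
  have "(Wk g u v)\<^sup>2 \<le> m h u * m (g - h) v" using Wk_CS[OF u v, of h "g - h"] h by simp
  also have "\<dots> \<le> \<mu> ^ (2 * h) * \<mu> ^ (2 * (g - h))"
    using * h u v mu mv \<mu> m_nn by (intro mult_mono) auto
  also have "\<dots> = (\<mu> ^ g)\<^sup>2" using h(3)
    by (metis distrib_left_numeral mult.commute power_add power_mult)
  finally show ?thesis using \<mu> by (simp add: power2_le_iff_abs_le)
qed

text \<open>The one step beyond the range of \<open>Wk_le_power\<close> is paid for with a factor
  \<open>\<Delta>\<close>.\<close>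

lemma Wk_odd_le:
  assumes u: "u \<in> U" and v: "v \<in> U" and mu: "m H u \<le> Y" and mv: "m H v \<le> Y"
  shows "Wk (2 * H + 1) u v \<le> \<Delta> * Y"
proof -
  have Y: "Y \<ge> 0" using mu m_nn[of H u] by linarith
  have "(Wk (H + Suc H) u v)\<^sup>2 \<le> m H u * m (Suc H) v" by (rule Wk_CS[OF u v])
  also have "\<dots> \<le> Y * (\<Delta>\<^sup>2 * Y)"
  proof (rule mult_mono[OF mu _ Y m_nn])
    have "m (Suc H) v \<le> \<Delta>\<^sup>2 * m H v" by (rule m_Suc_le[OF v])
    also have "\<dots> \<le> \<Delta>\<^sup>2 * Y" using mv by (rule mult_left_mono) simp
    finally show "m (Suc H) v \<le> \<Delta>\<^sup>2 * Y" .
  qed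
  also have "\<dots> = (\<Delta> * Y)\<^sup>2" by (simp add: power2_eq_square)
  finally show ?thesis using Y \<Delta>_nn by (simp add: power2_le_iff_abs_le mult_2 del: Wk.simps)
qed

lemma M_eq_sum: "M h = (\<Sum>u\<in>U. \<Sum>v\<in>U. (Wk h u v)\<^sup>2)"
  by (simp add: M_def m_eq_sum)

text \<open>\<open>M h\<close> is the sum of squares of all entries of the \<open>h\<close>-step
  kernel, and these entries sum to at least \<open>card U * \<delta> ^ h\<close>. Cauchy-Schwarz
  over all pairs cancels the size of \<open>U\<close>.\<close>

lemma M_ge:
  assumes \<delta>: "\<delta> \<ge> 0" and min: "\<And>u. u \<in> U \<Longrightarrow> (\<Sum>v\<in>U. a u v) \<ge> \<delta>"
  shows "M h \<ge> \<delta> ^ (2 * h)"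
proof -
  have row: "(\<Sum>v\<in>U. Wk h u v) \<ge> \<delta> ^ h" if u: "u \<in> U" for u
  proof (induction h)
    case 0 then show ?case using u finU by (simp add: of_bool_def)
  next
    case (Suc h)
    have "\<delta> ^ Suc h \<le> (\<Sum>w\<in>U. Wk h u w) * \<delta>" using Suc \<delta> by (simp add: mult.commute mult_left_mono)
    also have "\<dots> \<le> (\<Sum>w\<in>U. Wk h u w * (\<Sum>v\<in>U. a w v))"
      unfolding sum_distrib_right by (intro sum_mono mult_left_mono min Wk_nn)
    also have "\<dots> = (\<Sum>v\<in>U. Wk (Suc h) u v)"
      by (simp add: sum_distrib_left) (rule sum.swap)
    finally show ?case .
  qed
  have "(card U * \<delta> ^ h)\<^sup>2 \<le> (\<Sum>u\<in>U. \<Sum>v\<in>U. Wk h u v)\<^sup>2"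
    using sum_mono[of U "\<lambda>_. \<delta> ^ h" "\<lambda>u. \<Sum>v\<in>U. Wk h u v"] row \<delta> by (intro power_mono) auto
  also have "\<dots> = (\<Sum>z\<in>U\<times>U. 1 * Wk h (fst z) (snd z))\<^sup>2"
    by (simp add: sum.cartesian_product case_prod_beta)
  also have "\<dots> \<le> (\<Sum>z\<in>U\<times>U. 1\<^sup>2) * (\<Sum>z\<in>U\<times>U. (Wk h (fst z) (snd z))\<^sup>2)"
    by (rule Cauchy_Schwarz_ineq_sum)
  also have "\<dots> = (card U)\<^sup>2 * M h"
    by (simp add: M_eq_sum sum.cartesian_product case_prod_beta power2_eq_square card_cartesian_product)
  finally have "(card U)\<^sup>2 * (\<delta> ^ h)\<^sup>2 \<le> (card U)\<^sup>2 * M h" by (simp add: power_mult_distrib)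
  moreover have "card U > 0" using finU U_ne by (simp add: card_gt_0_iff)
  ultimately have "(\<delta> ^ h)\<^sup>2 \<le> M h" by simp
  then show ?thesis by (simp add: power_mult[symmetric] mult.commute)
qed

lemma M_1_le: "M 1 \<le> (\<Sum>u\<in>U. \<Sum>v\<in>U. a u v)"
  unfolding M_eq_sum One_nat_def
  by (intro sum_mono) (auto simp: Wk_1 power2_eq_square a_nn a_le1 mult_left_le simp del: Wk.simps)

text \<open>Two vertices \<open>x\<^sub>0\<close>, \<open>x\<^sub>j\<close> of a closed walk are identified. Each neighbour of \<open>x\<^sub>0\<close> leaves
  at most one choice for \<open>x\<^sub>0\<close> in a given class; the weight of the second half is
  compared with that of the first half shortened by one step.\<close>

lemma collision_bound:
  assumes loc: "\<And>w v. w \<in> U \<Longrightarrow> v \<in> U \<Longrightarrow> (\<Sum>u\<in>{u\<in>U. cl u = cl v}. a w u) \<le> 1"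
    and j: "1 \<le> j" "j \<le> l" and \<theta>: "\<theta> > 0"
  shows "(\<Sum>u\<in>U. \<Sum>v\<in>U. of_bool (cl u = cl v) * (Wk j u v * Wk (2 * l - j) v u))
      \<le> \<theta> * M (l - 1) + \<Delta> / \<theta> * M l"
proof -
  \<comment> \<open>The closed walk is cut at u, x, v, z into pieces of lengths 1, j - 1, l - j and
    l. \<open>Q\<close> merges the two middle pieces by forgetting \<open>v\<close>.\<close>
  define A where "A x v = Wk (j - 1) x v" for x v
  define B where "B v z = Wk (l - j) v z" for v z
  define Q where "Q x z = Wk (l - 1) x z" for x z
  define P where "P z u = Wk l z u" for z u
  have Q_eq: "Q x z = (\<Sum>v\<in>U. A x v * B v z)" if "z \<in> U" for x z
    using Wk_add[OF that, of "j - 1" "l - j" x] j by (simp add: A_def B_def Q_def)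
  define F where "F u v x z = of_bool (cl u = cl v) * a u x * (\<theta> * (A x v * B v z * Q x z))" for u v x z
  define G where "G u v x z = of_bool (cl u = cl v) * a u x * (A x v * B v z / Q x z * ((P z u)\<^sup>2 / \<theta>))" for u v x z
  have nn: "A x v \<ge> 0" "B v z \<ge> 0" "Q x z \<ge> 0" "P z u \<ge> 0" for x v z u
    by (auto simp: A_def B_def Q_def P_def Wk_nn)
  have W1: "Wk j u v = (\<Sum>x\<in>U. a u x * A x v)" if "u \<in> U" "v \<in> U" for u v
    using Wk_Suc_left[OF that, of "j - 1"] j by (simp add: A_def del: Wk.simps)
  have W2: "Wk (2 * l - j) v u = (\<Sum>z\<in>U. B v z * P z u)" if "u \<in> U" for u v
  proof -
    have "2 * l - j = (l - j) + l" using j by simp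
    then show ?thesis using Wk_add[OF that, of "l - j" l v] by (simp add: B_def P_def)
  qed
  \<comment> \<open>An arithmetic-geometric mean comparison of \<open>P z u\<close> with
    \<open>Q x z\<close>. The factor \<open>A x v * B v z / Q x z\<close> is the share of the walks
    from \<open>x\<close> to \<open>z\<close> that pass through \<open>v\<close> after
    \<open>j - 1\<close> steps, so it sums to at most 1 over \<open>v\<close>.\<close>
  have key: "A x v * B v z * P z u \<le> \<theta> * (A x v * B v z * Q x z) + A x v * B v z / Q x z * ((P z u)\<^sup>2 / \<theta>)"
    if "z \<in> U" "v \<in> U" for x v z u
  proof (cases "Q x z = 0")
    case True
    have "A x v * B v z \<le> Q x z" unfolding Q_eq[OF that(1)]
      by (rule member_le_sum) (use that finU nn in auto)
    then have "A x v * B v z = 0" using True nn(1)[of x v] nn(2)[of v z] by (metis antisym mult_nonneg_nonneg)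
    then show ?thesis by auto
  next
    case False
    then have q: "Q x z > 0" using nn(3)[of x z] by simp
    have "P z u \<le> \<theta> * Q x z + (P z u)\<^sup>2 / (\<theta> * Q x z)"
    proof (cases "P z u \<le> \<theta> * Q x z")
      case True then show ?thesis using q \<theta> by (simp add: add_increasing2)
    next
      case False
      then have "P z u * (\<theta> * Q x z) \<le> P z u * P z u" using nn by (intro mult_left_mono) auto
      then have "P z u \<le> (P z u)\<^sup>2 / (\<theta> * Q x z)" using q \<theta> by (simp add: field_simps power2_eq_square)
      then show ?thesis using q \<theta> by (simp add: add_increasing)
    qed
    then have "A x v * B v z * P z u \<le> A x v * B v z * (\<theta> * Q x z + (P z u)\<^sup>2 / (\<theta> * Q x z))"
      using nn by (intro mult_left_mono) auto
    also have "\<dots> = \<theta> * (A x v * B v z * Q x z) + A x v * B v z / Q x z * ((P z u)\<^sup>2 / \<theta>)"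
      by (simp add: algebra_simps)
    finally show ?thesis .
  qed
  have "(\<Sum>u\<in>U. \<Sum>v\<in>U. of_bool (cl u = cl v) * (Wk j u v * Wk (2 * l - j) v u))
      = (\<Sum>u\<in>U. \<Sum>v\<in>U. \<Sum>x\<in>U. \<Sum>z\<in>U. of_bool (cl u = cl v) * a u x * (A x v * B v z * P z u))"
  proof (intro sum.cong refl)
    fix u v assume "u \<in> U" "v \<in> U"
    then have "Wk j u v * Wk (2 * l - j) v u = (\<Sum>x\<in>U. \<Sum>z\<in>U. (a u x * A x v) * (B v z * P z u))"
      by (simp only: W1 W2 sum_product)
    then show "of_bool (cl u = cl v) * (Wk j u v * Wk (2 * l - j) v u)
        = (\<Sum>x\<in>U. \<Sum>z\<in>U. of_bool (cl u = cl v) * a u x * (A x v * B v z * P z u))"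
      by (simp only: sum_distrib_left mult.assoc)
  qed
  also have "\<dots> \<le> (\<Sum>u\<in>U. \<Sum>v\<in>U. \<Sum>x\<in>U. \<Sum>z\<in>U. of_bool (cl u = cl v) * a u x *
      (\<theta> * (A x v * B v z * Q x z) + A x v * B v z / Q x z * ((P z u)\<^sup>2 / \<theta>)))"
    by (intro sum_mono mult_left_mono key) (auto simp: a_nn)
  also have "\<dots> = (\<Sum>u\<in>U. \<Sum>v\<in>U. \<Sum>x\<in>U. \<Sum>z\<in>U. F u v x z)
     + (\<Sum>u\<in>U. \<Sum>v\<in>U. \<Sum>x\<in>U. \<Sum>z\<in>U. G u v x z)"
    by (simp add: F_def G_def distrib_left sum.distrib)
  also have "\<dots> \<le> \<theta> * M (l - 1) + \<Delta> / \<theta> * M l"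
  proof (rule add_mono)
    \<comment> \<open>In this part \<open>u\<close> occurs only in the class condition and in
      \<open>a u x\<close>, so \<open>loc\<close> removes it without any loss; what remains is a
      closed walk two steps shorter.\<close>
    have "(\<Sum>u\<in>U. \<Sum>v\<in>U. \<Sum>x\<in>U. \<Sum>z\<in>U. F u v x z)
      = (\<Sum>v\<in>U. \<Sum>u\<in>U. \<Sum>x\<in>U. \<Sum>z\<in>U. F u v x z)"
      by (rule sum.swap)
    also have "\<dots> = (\<Sum>v\<in>U. \<Sum>x\<in>U. \<Sum>u\<in>U. \<Sum>z\<in>U. F u v x z)"
      by (intro sum.cong refl sum.swap)
    also have "\<dots> = (\<Sum>v\<in>U. \<Sum>x\<in>U. (\<Sum>u\<in>U. of_bool (cl u = cl v) * a u x) * (\<Sum>z\<in>U. \<theta> * (A x v * B v z * Q x z)))"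
      by (simp add: F_def sum_product)
    also have "\<dots> \<le> (\<Sum>v\<in>U. \<Sum>x\<in>U. 1 * (\<Sum>z\<in>U. \<theta> * (A x v * B v z * Q x z)))"
    proof (intro sum_mono mult_right_mono)
      fix v x assume vx: "v \<in> U" "x \<in> U"
      have "(\<Sum>u\<in>U. of_bool (cl u = cl v) * a u x) = (\<Sum>u\<in>{u\<in>U. cl u = cl v}. a x u)"
        by (rule sum.mono_neutral_cong_right) (use finU a_sym in auto)
      then show "(\<Sum>u\<in>U. of_bool (cl u = cl v) * a u x) \<le> 1" using loc[of x v] vx by simp
    qed (use \<theta> nn in \<open>auto intro!: sum_nonneg\<close>)
    also have "\<dots> = (\<Sum>x\<in>U. \<Sum>v\<in>U. \<Sum>z\<in>U. \<theta> * (A x v * B v z * Q x z))" by (subst sum.swap) simp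
    also have "\<dots> = (\<Sum>x\<in>U. \<Sum>z\<in>U. \<Sum>v\<in>U. \<theta> * (A x v * B v z * Q x z))"
      by (intro sum.cong refl sum.swap)
    also have "\<dots> = (\<Sum>x\<in>U. \<Sum>z\<in>U. \<theta> * (Q x z)\<^sup>2)"
    proof (intro sum.cong refl)
      fix x z assume "z \<in> U"
      have "(\<Sum>v\<in>U. \<theta> * (A x v * B v z * Q x z)) = \<theta> * ((\<Sum>v\<in>U. A x v * B v z) * Q x z)"
        by (simp only: sum_distrib_left sum_distrib_right)
      also have "\<dots> = \<theta> * (Q x z)\<^sup>2"
        by (simp only: Q_eq[OF \<open>z \<in> U\<close>, symmetric] power2_eq_square)
      finally show "(\<Sum>v\<in>U. \<theta> * (A x v * B v z * Q x z)) = \<theta> * (Q x z)\<^sup>2" .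
    qed
    also have "\<dots> = \<theta> * M (l - 1)" by (simp add: M_eq_sum Q_def sum_distrib_left)
    finally show "(\<Sum>u\<in>U. \<Sum>v\<in>U. \<Sum>x\<in>U. \<Sum>z\<in>U. F u v x z)
      \<le> \<theta> * M (l - 1)" .
  next
    \<comment> \<open>Here the class condition is dropped, \<open>v\<close> is summed out through
      its share, and the choice of \<open>x\<close> costs a factor \<open>\<Delta>\<close>.\<close>
    have "(\<Sum>u\<in>U. \<Sum>v\<in>U. \<Sum>x\<in>U. \<Sum>z\<in>U. G u v x z)
      \<le> (\<Sum>u\<in>U. \<Sum>v\<in>U. \<Sum>x\<in>U. \<Sum>z\<in>U. 1 * a u x * (A x v * B v z / Q x z * ((P z u)\<^sup>2 / \<theta>)))"
      unfolding G_def by (intro sum_mono mult_right_mono) (use nn a_nn \<theta> in auto)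
    also have "\<dots> = (\<Sum>u\<in>U. \<Sum>x\<in>U. \<Sum>v\<in>U. \<Sum>z\<in>U. a u x * (A x v * B v z / Q x z * ((P z u)\<^sup>2 / \<theta>)))"
      by (simp, intro sum.cong refl sum.swap)
    also have "\<dots> = (\<Sum>u\<in>U. \<Sum>x\<in>U. \<Sum>z\<in>U. \<Sum>v\<in>U. a u x * (A x v * B v z / Q x z * ((P z u)\<^sup>2 / \<theta>)))"
      by (intro sum.cong refl sum.swap)
    also have "\<dots> = (\<Sum>u\<in>U. \<Sum>x\<in>U. \<Sum>z\<in>U. (\<Sum>v\<in>U. A x v * B v z) / Q x z * (a u x * ((P z u)\<^sup>2 / \<theta>)))"
      by (intro sum.cong refl) (simp add: sum_distrib_left sum_distrib_right sum_divide_distrib ac_simps)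
    also have "\<dots> \<le> (\<Sum>u\<in>U. \<Sum>x\<in>U. \<Sum>z\<in>U. 1 * (a u x * ((P z u)\<^sup>2 / \<theta>)))"
      by (intro sum_mono mult_right_mono) (use a_nn \<theta> Q_eq in \<open>auto simp: divide_simps\<close>)
    also have "\<dots> = (\<Sum>u\<in>U. (\<Sum>x\<in>U. a u x) * (\<Sum>z\<in>U. (P z u)\<^sup>2 / \<theta>))"
      by (simp add: sum_product)
    also have "\<dots> \<le> (\<Sum>u\<in>U. \<Delta> * (\<Sum>z\<in>U. (P z u)\<^sup>2 / \<theta>))"
      by (intro sum_mono mult_right_mono a_deg) (use \<theta> in \<open>auto intro!: sum_nonneg\<close>)
    also have "\<dots> = \<Delta> / \<theta> * (\<Sum>u\<in>U. \<Sum>z\<in>U. (P z u)\<^sup>2)"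
      by (simp add: sum_distrib_left sum_divide_distrib[symmetric])
    also have "(\<Sum>u\<in>U. \<Sum>z\<in>U. (P z u)\<^sup>2) = M l"
      unfolding M_eq_sum P_def by (rule sum.swap)
    finally show "(\<Sum>u\<in>U. \<Sum>v\<in>U. \<Sum>x\<in>U. \<Sum>z\<in>U. G u v x z)
      \<le> \<Delta> / \<theta> * M l" .
  qed
  finally show ?thesis .
qed

end

section \<open>Closed walks avoiding conflicts\<close>

text \<open>For \<open>n = 2\<close> both edges coincide; from \<open>n = 3\<close> on, a
  coincidence of two edges with different indices would force \<open>i\<close> and
  \<open>i + 2\<close> to agree modulo \<open>n\<close>.\<close>

lemma inj_on_cycle_edges:
  assumes n: "n \<ge> 3" and inj: "inj_on f {..<n}"
  shows "inj_on (\<lambda>i. {f i, f (Suc i mod n)}) {..<n}"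
proof (rule inj_onI)
  fix i j assume ij: "i \<in> {..<n}" "j \<in> {..<n}" "{f i, f (Suc i mod n)} = {f j, f (Suc j mod n)}"
  have lt: "Suc k mod n < n" for k using n by simp
  have iff: "f a = f b \<longleftrightarrow> a = b" if "a < n" "b < n" for a b
    using inj_onD[OF inj, of a b] that by auto
  have "i = j \<or> i = Suc j mod n \<and> Suc i mod n = j"
    using ij(3) unfolding doubleton_eq_iff using iff lt ij(1,2) by auto
  then show "i = j" using ij(1,2) n by (auto simp: mod_Suc split: if_splits)
qed

text \<open>\<open>pr\<close> sends copies to original vertices. A vertex may have many copies, but
  by \<open>pr_inj\<close> an original edge has at most one lift up to orientation, so conditions on
  sets of original edges translate to arcs of \<open>R\<close>.\<close>

locale cover =
  fixes U :: "'v set" and R :: "'v \<Rightarrow> 'v \<Rightarrow> bool" and pr :: "'v \<Rightarrow> 'b" and \<Delta> :: real and l :: nat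
  assumes fin_U: "finite U" and R_U: "R x y \<Longrightarrow> x \<in> U" and R_sym: "R x y \<Longrightarrow> R y x"
    and R_deg: "u \<in> U \<Longrightarrow> card {v. R u v} \<le> \<Delta>" and R_out: "u \<in> U \<Longrightarrow> \<exists>v. R u v"
    and U_nonempty: "U \<noteq> {}" and pr_neq: "R x y \<Longrightarrow> pr x \<noteq> pr y"
    and pr_inj: "R x y \<Longrightarrow> R x' y' \<Longrightarrow> {pr x, pr y} = {pr x', pr y'} \<Longrightarrow> x = x' \<and> y = y' \<or> x = y' \<and> y = x'"
    and l_ge: "l \<ge> 2"
begin

lemma R_U': "R x y \<Longrightarrow> y \<in> U"
  using R_U R_sym by blast

lemma fin_R: "finite {v. R u v}"
  by (rule finite_subset[OF _ fin_U]) (auto dest: R_U')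

lemma sum_R: "(\<Sum>v\<in>U. of_bool (R u v)) = real (card {v. R u v})"
proof -
  have "(\<Sum>v\<in>U. of_bool (R u v)) = (\<Sum>v\<in>{v. R u v}. (1::real))"
    by (rule sum.mono_neutral_cong_right) (use fin_U R_U' in auto)
  then show ?thesis by simp
qed

sublocale walk_kernel U "\<lambda>u v. of_bool (R u v)" \<Delta>
proof unfold_locales
  fix u assume u: "u \<in> U"
  show "(\<Sum>v\<in>U. of_bool (R u v)) \<le> \<Delta>" using R_deg[OF u] by (simp add: sum_R)
  show "\<exists>v\<in>U. (of_bool (R u v) :: real) > 0" using R_out[OF u] R_U' by auto
qed (use fin_U U_nonempty R_sym in auto)

section \<open>Counting walks with constraints that depend on the position\<close>

primrec Rec :: "(nat \<Rightarrow> 'v \<Rightarrow> 'v \<Rightarrow> bool) \<Rightarrow> nat \<Rightarrow> 'v \<Rightarrow> 'v \<Rightarrow> real" where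
  "Rec Q 0 u v = of_bool (u = v)"
| "Rec Q (Suc n) u v = (\<Sum>w\<in>U. Rec Q n u w * of_bool (Q n w v))"

lemma Rec_nn: "Rec Q n u v \<ge> 0"
  by (induction n arbitrary: v) (auto intro!: sum_nonneg mult_nonneg_nonneg)

lemma Rec_R: "Rec (\<lambda>_. R) n u v = Wk n u v"
  by (induction n arbitrary: v) auto

lemma card_walks:
  assumes "u \<in> U" "v \<in> U"
  shows "real (card {x \<in> {..n} \<rightarrow>\<^sub>E U. x 0 = u \<and> x n = v \<and> (\<forall>i<n. Q i (x i) (x (Suc i)))}) = Rec Q n u v"
  using assms(2)
proof (induction n arbitrary: v)
  case 0
  have "{x \<in> {..0} \<rightarrow>\<^sub>E U. x 0 = u \<and> x 0 = v} = (if u = v then {\<lambda>i\<in>{..0::nat}. u} else {})"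
    using assms(1) by (auto simp: PiE_iff fun_eq_iff extensional_def)
  then show ?case by simp
next
  case (Suc n)
  define S where "S w = {x \<in> {..n} \<rightarrow>\<^sub>E U. x 0 = u \<and> x n = w \<and> (\<forall>i<n. Q i (x i) (x (Suc i)))}" for w
  have finS: "finite (S w)" for w
    unfolding S_def using fin_U by (auto intro!: finite_subset[OF _ finite_PiE[of "{..n}" "\<lambda>_. U"]])
  have eq: "{x \<in> {..Suc n} \<rightarrow>\<^sub>E U. x 0 = u \<and> x (Suc n) = v \<and> (\<forall>i<Suc n. Q i (x i) (x (Suc i)))}
      = (\<Union>w\<in>{w\<in>U. Q n w v}. (\<lambda>x. x(Suc n := v)) ` S w)" (is "?L = ?R")
  proof
    show "?L \<subseteq> ?R"
    proof
      fix x assume x: "x \<in> ?L"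
      have "restrict x {..n} \<in> S (x n)" using x by (auto simp: S_def PiE_iff)
      moreover have "x = (restrict x {..n})(Suc n := v)"
        using x by (auto simp: fun_eq_iff PiE_iff extensional_def)
      moreover have "x n \<in> {w\<in>U. Q n w v}" using x by (auto simp: PiE_iff)
      ultimately show "x \<in> ?R" by blast
    qed
    show "?R \<subseteq> ?L"
      using Suc.prems by (auto simp: S_def atMost_Suc PiE_fun_upd less_Suc_eq)
  qed
  have inj: "inj_on (\<lambda>x. x(Suc n := v)) (S w)" for w
  proof (rule inj_onI)
    fix x y assume xy: "x \<in> S w" "y \<in> S w" "x(Suc n := v) = y(Suc n := v)"
    show "x = y"
    proof
      fix i show "x i = y i"
      proof (cases "i = Suc n")
        case True
        then show ?thesis using xy(1,2) by (simp add: S_def PiE_iff extensional_def)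
      next
        case False
        then show ?thesis using fun_cong[OF xy(3), of i] by simp
      qed
    qed
  qed
  have "card (\<Union>w\<in>{w\<in>U. Q n w v}. (\<lambda>x. x(Suc n := v)) ` S w)
      = (\<Sum>w\<in>{w\<in>U. Q n w v}. card ((\<lambda>x. x(Suc n := v)) ` S w))"
  proof (rule card_UN_disjoint)
    show "\<forall>i\<in>{w\<in>U. Q n w v}. \<forall>j\<in>{w\<in>U. Q n w v}. i \<noteq> j \<longrightarrow>
      (\<lambda>x. x(Suc n := v)) ` S i \<inter> (\<lambda>x. x(Suc n := v)) ` S j = {}"
    proof (intro ballI impI equals0I)
      fix i j y assume ij: "i \<noteq> j" "y \<in> (\<lambda>x. x(Suc n := v)) ` S i \<inter> (\<lambda>x. x(Suc n := v)) ` S j"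
      have "y n = k" if "y \<in> (\<lambda>x. x(Suc n := v)) ` S k" for k using that by (auto simp: S_def)
      with ij show False by auto
    qed
  qed (use fin_U finS in auto)
  also have "\<dots> = (\<Sum>w\<in>{w\<in>U. Q n w v}. card (S w))" by (simp add: card_image[OF inj])
  finally have "real (card ?L) = (\<Sum>w\<in>{w\<in>U. Q n w v}. real (card (S w)))" by (simp add: eq[symmetric])
  also have "\<dots> = (\<Sum>w\<in>{w\<in>U. Q n w v}. Rec Q n u w)"
    by (intro sum.cong refl) (use Suc.IH in \<open>auto simp: S_def\<close>)
  also have "\<dots> = Rec Q (Suc n) u v"
    by (simp, rule sum.mono_neutral_cong_left) (use fin_U in auto)
  finally show ?case by simp
qed

text \<open>The start is repeated at \<open>2 * l\<close>, so the edge at position \<open>i\<close>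
  joins \<open>x i\<close> and \<open>x (Suc i)\<close> without reduction modulo
  \<open>2 * l\<close>.\<close>

definition CW :: "(nat \<Rightarrow> 'v) set" where
  "CW = {x \<in> {..2 * l} \<rightarrow>\<^sub>E U. x (2 * l) = x 0 \<and> (\<forall>i<2 * l. R (x i) (x (Suc i)))}"

definition ed :: "(nat \<Rightarrow> 'v) \<Rightarrow> nat \<Rightarrow> 'b set" where
  "ed x i = {pr (x i), pr (x (Suc i))}"

lemma finite_CW: "finite CW"
  unfolding CW_def using fin_U by (auto intro!: finite_subset[OF _ finite_PiE[of "{..2*l}" "\<lambda>_. U"]])

definition fiber :: "nat set \<Rightarrow> (nat \<Rightarrow> 'v) \<Rightarrow> (nat \<Rightarrow> 'v) set" where
  "fiber P y = {x \<in> CW. \<forall>i\<in>P. x i = y i \<and> x (Suc i) = y (Suc i)}"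

definition conflicts :: "'b set set set \<Rightarrow> nat set \<Rightarrow> (nat \<Rightarrow> 'v) set" where
  "conflicts Sat P = {x \<in> CW. ed x ` P \<in> Sat \<and> card (ed x ` P) = card P}"

lemma card_walks_le:
  assumes "u \<in> U" "\<And>x. x \<in> S \<Longrightarrow> x \<in> CW \<and> x 0 = u \<and> (\<forall>i<2 * l. Q i (x i) (x (Suc i)))"
  shows "real (card S) \<le> Rec Q (2 * l) u u"
proof -
  let ?T = "{x \<in> {..2 * l} \<rightarrow>\<^sub>E U. x 0 = u \<and> x (2 * l) = u \<and> (\<forall>i<2 * l. Q i (x i) (x (Suc i)))}"
  have "finite ?T"
    using fin_U by (auto intro!: finite_subset[OF _ finite_PiE[of "{..2*l}" "\<lambda>_. U"]])
  moreover have "S \<subseteq> ?T"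
  proof
    fix x assume "x \<in> S"
    from assms(2)[OF this] have "x \<in> CW" "x 0 = u" "\<forall>i<2 * l. Q i (x i) (x (Suc i))" by simp_all
    then show "x \<in> ?T" by (simp add: CW_def)
  qed
  ultimately have "card S \<le> card ?T" by (rule card_mono)
  then show ?thesis using card_walks[OF assms(1) assms(1), of "2 * l" Q] by linarith
qed

lemma card_CW: "real (card CW) = M l"
proof -
  define S where "S u = {x \<in> {..2 * l} \<rightarrow>\<^sub>E U. x 0 = u \<and> x (2 * l) = u \<and> (\<forall>i<2 * l. R (x i) (x (Suc i)))}" for u
  have "CW = (\<Union>u\<in>U. S u)" by (auto simp: CW_def S_def PiE_iff)
  moreover have "card (\<Union>u\<in>U. S u) = (\<Sum>u\<in>U. card (S u))"
  proof (rule card_UN_disjoint)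
    show "\<forall>i\<in>U. finite (S i)"
      using fin_U by (auto simp: S_def intro!: finite_subset[OF _ finite_PiE[of "{..2*l}" "\<lambda>_. U"]])
  qed (use fin_U in \<open>auto simp: S_def\<close>)
  moreover have "real (card (S u)) = m l u" if "u \<in> U" for u
    unfolding S_def m_def Rec_R[symmetric] by (rule card_walks[OF that that])
  ultimately show ?thesis by (simp add: M_def)
qed

text \<open>Fixing the vertices at positions 0 and \<open>j\<close> factorises the count. The local
  condition of \<open>collision_bound\<close> holds because two neighbours of one vertex with the
  same projection would be two lifts of one edge.\<close>

lemma card_collision_le:
  assumes j: "1 \<le> j" "j \<le> l" and \<theta>: "\<theta> > 0"
  shows "real (card {x \<in> CW. pr (x 0) = pr (x j)}) \<le> \<theta> * M (l - 1) + \<Delta> / \<theta> * M l"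
proof -
  define S where "S u v = {x \<in> CW. x 0 = u \<and> x j = v}" for u v
  have S: "real (card (S u v)) \<le> Wk j u v * Wk (2 * l - j) v u" if uv: "u \<in> U" "v \<in> U" for u v
  proof -
    define Q where "Q i w w' \<longleftrightarrow> R w w' \<and> (i = j \<longrightarrow> w = v)" for i w w'
    have 1: "Rec Q i u w = Wk i u w" if "i \<le> j" for i w
      using that by (induction i arbitrary: w) (auto simp: Q_def intro!: sum.cong)
    have 2: "Rec Q (j + Suc i) u w = Wk j u v * Wk (Suc i) v w" for i w
    proof (induction i arbitrary: w)
      case 0
      have "Rec Q (j + Suc 0) u w = (\<Sum>x\<in>U. if x = v then Wk j u v * of_bool (R v w) else 0)"
        unfolding add_Suc_right add_0_right Rec.simps by (intro sum.cong refl) (auto simp: 1 Q_def)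
      also have "\<dots> = Wk j u v * of_bool (R v w)" using uv fin_U by simp
      also have "\<dots> = Wk j u v * Wk (Suc 0) v w" using uv by (simp add: Wk_1 del: Wk.simps)
      finally show ?case .
    next
      case (Suc i)
      have "Rec Q (j + Suc (Suc i)) u w = (\<Sum>x\<in>U. Rec Q (j + Suc i) u x * of_bool (Q (j + Suc i) x w))"
        by (simp only: add_Suc_right Rec.simps)
      also have "\<dots> = (\<Sum>x\<in>U. Wk j u v * Wk (Suc i) v x * of_bool (R x w))"
        by (intro sum.cong refl) (simp only: Suc.IH, simp add: Q_def)
      finally show ?case by (simp only: Wk.simps(2)[of "Suc i"] sum_distrib_left mult.assoc)
    qed
    have "real (card (S u v)) \<le> Rec Q (2 * l) u u"
      by (rule card_walks_le) (use uv in \<open>auto simp: S_def CW_def Q_def\<close>)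
    also have "2 * l = j + Suc (2 * l - j - 1)" using j l_ge by simp
    also have "Rec Q \<dots> u u = Wk j u v * Wk (Suc (2 * l - j - 1)) v u" by (rule 2)
    also have "Suc (2 * l - j - 1) = 2 * l - j" using j l_ge by simp
    finally show ?thesis .
  qed
  have "{x \<in> CW. pr (x 0) = pr (x j)} \<subseteq> (\<Union>z\<in>{z\<in>U\<times>U. pr (fst z) = pr (snd z)}. S (fst z) (snd z))"
    using j by (auto simp: CW_def S_def PiE_iff)
  moreover have "finite (S u v)" for u v using finite_CW by (simp add: S_def)
  ultimately have "card {x \<in> CW. pr (x 0) = pr (x j)} \<le> (\<Sum>z\<in>{z\<in>U\<times>U. pr (fst z) = pr (snd z)}. card (S (fst z) (snd z)))"
    using fin_U by (intro order_trans[OF card_mono card_UN_le]) auto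
  then have "real (card {x \<in> CW. pr (x 0) = pr (x j)}) \<le>
      (\<Sum>z\<in>{z\<in>U\<times>U. pr (fst z) = pr (snd z)}. real (card (S (fst z) (snd z))))"
    unfolding of_nat_sum[symmetric] by (rule of_nat_mono)
  also have "\<dots> \<le> (\<Sum>z\<in>{z\<in>U\<times>U. pr (fst z) = pr (snd z)}. Wk j (fst z) (snd z) * Wk (2 * l - j) (snd z) (fst z))"
    by (intro sum_mono S) auto
  also have "\<dots> = (\<Sum>z\<in>U\<times>U. of_bool (pr (fst z) = pr (snd z)) * (Wk j (fst z) (snd z) * Wk (2 * l - j) (snd z) (fst z)))"
    by (rule sum.mono_neutral_cong_left) (use fin_U in auto)
  also have "\<dots> = (\<Sum>u\<in>U. \<Sum>v\<in>U. of_bool (pr u = pr v) * (Wk j u v * Wk (2 * l - j) v u))"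
    by (simp add: sum.cartesian_product case_prod_beta)
  also have "\<dots> \<le> \<theta> * M (l - 1) + \<Delta> / \<theta> * M l"
  proof (rule collision_bound)
    fix w v assume "w \<in> U" "v \<in> U"
    have "card {u\<in>U. pr u = pr v \<and> R w u} \<le> Suc 0"
    proof (subst card_le_Suc0_iff_eq)
      show "\<forall>a1\<in>{u\<in>U. pr u = pr v \<and> R w u}. \<forall>a2\<in>{u\<in>U. pr u = pr v \<and> R w u}. a1 = a2"
      proof (intro ballI)
        fix p q assume "p \<in> {u\<in>U. pr u = pr v \<and> R w u}" "q \<in> {u\<in>U. pr u = pr v \<and> R w u}"
        then have "R w p" "R w q" "{pr w, pr p} = {pr w, pr q}" by auto
        from pr_inj[OF this] show "p = q" using pr_neq \<open>R w p\<close> by auto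
      qed
    qed (use fin_U in auto)
    moreover have "(\<Sum>u\<in>{u\<in>U. pr u = pr v}. (of_bool (R w u) :: real)) = (\<Sum>u\<in>{u\<in>U. pr u = pr v \<and> R w u}. 1)"
      by (rule sum.mono_neutral_cong_right) (use fin_U in auto)
    ultimately show "(\<Sum>u\<in>{u\<in>U. pr u = pr v}. (of_bool (R w u) :: real)) \<le> 1" by simp
  qed (use j \<theta> in auto)
  finally show ?thesis .
qed

text \<open>Gaps between consecutive prescribed arcs contribute independently, and the bound \<open>b\<close>
  on them is supermultiplicative.\<close>

lemma card_prescribed_le:
  fixes b :: "nat \<Rightarrow> real"
  assumes P: "P \<subseteq> {..<2 * l}" "0 \<in> P" and y: "y \<in> CW"
    and b0: "b 0 = 1" and b_nn: "\<And>g. b g \<ge> 0"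
    and b_mult: "\<And>g h. g + h \<le> 2 * l - card P \<Longrightarrow> b g * b h \<le> b (g + h)"
    and b_Wk: "\<And>g i j. g \<le> 2 * l - card P \<Longrightarrow> i \<in> P \<Longrightarrow> j \<in> P \<Longrightarrow> Wk g (y (Suc i)) (y j) \<le> b g"
  shows "real (card (fiber P y)) \<le> b (2 * l - card P)"
proof -
  define Q where "Q i w w' \<longleftrightarrow> R w w' \<and> (i \<in> P \<longrightarrow> w = y i \<and> w' = y (Suc i))" for i w w'
  \<comment> \<open>The number of free steps before position \<open>i\<close>.\<close>
  define z where "z i = card ({..<i} - P)" for i
  have yU: "y i \<in> U" if "i \<le> 2 * l" for i using y that by (auto simp: CW_def PiE_iff)
  have z_end: "z (2 * l) = 2 * l - card P"
    unfolding z_def using P(1) by (subst card_Diff_subset) (auto intro: finite_subset)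
  have z_mono: "i \<le> j \<Longrightarrow> z i \<le> z j" for i j
    unfolding z_def by (rule card_mono) auto
  have z_gap: "z i = z i0 + (i - i0)" if "i0 \<le> i" "\<forall>k. i0 \<le> k \<and> k < i \<longrightarrow> k \<notin> P" for i0 i
  proof -
    have "{..<i} - P = ({..<i0} - P) \<union> {i0..<i}" using that by auto
    moreover have "card (({..<i0} - P) \<union> {i0..<i}) = card ({..<i0} - P) + card {i0..<i}"
      by (rule card_Un_disjoint) auto
    ultimately show ?thesis by (simp add: z_def)
  qed
  have R01: "Rec Q (Suc i) (y 0) v \<le> of_bool (v = y (Suc i)) * Rec Q i (y 0) (y i)" if "i \<in> P" for i v
  proof -
    have "Rec Q (Suc i) (y 0) v \<le> (\<Sum>w\<in>U. if w = y i then of_bool (v = y (Suc i)) * Rec Q i (y 0) (y i) else 0)"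
      unfolding Rec.simps by (rule sum_mono) (use that Rec_nn in \<open>auto simp: Q_def\<close>)
    also have "\<dots> \<le> of_bool (v = y (Suc i)) * Rec Q i (y 0) (y i)"
      using fin_U Rec_nn by simp
    finally show ?thesis .
  qed
  \<comment> \<open>\<open>i0\<close> is the position just after the last prescribed arc before
    \<open>i\<close>. Completed gaps are already absorbed into \<open>b (z i0)\<close>, and only the
    current gap is kept as an exact walk count. Since \<open>0 \<in> P\<close>, such a position
    exists from the start.\<close>
  have claim: "\<exists>i0. 1 \<le> i0 \<and> i0 \<le> i \<and> i0 - 1 \<in> P \<and> (\<forall>k. i0 \<le> k \<and> k < i \<longrightarrow> k \<notin> P) \<and>
      (\<forall>v\<in>U. Rec Q i (y 0) v \<le> b (z i0) * Wk (i - i0) (y i0) v)"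
    if "1 \<le> i" "i \<le> 2 * l" for i
    using that
  proof (induction i rule: nat_induct_at_least)
    case base
    have "z 1 = 0" using P(2) by (simp add: z_def lessThan_Suc)
    moreover have "Rec Q 1 (y 0) v \<le> b 0 * Wk 0 (y 1) v" for v
      using R01[OF P(2), of v] by (cases "v = y 1") (simp_all add: b0 del: Rec.simps(2))
    ultimately show ?case using P(2) by (intro exI[of _ 1]) auto
  next
    case (Suc i)
    then obtain i0 where i0: "1 \<le> i0" "i0 \<le> i" "i0 - 1 \<in> P" "\<forall>k. i0 \<le> k \<and> k < i \<longrightarrow> k \<notin> P"
      and IH: "\<And>v. v \<in> U \<Longrightarrow> Rec Q i (y 0) v \<le> b (z i0) * Wk (i - i0) (y i0) v" by auto
    show ?case
    proof (cases "i \<in> P")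
      case True
      have zi: "z i = z i0 + (i - i0)" by (rule z_gap) (use i0 in auto)
      have zle: "z i \<le> 2 * l - card P" using z_mono[of i "2 * l"] z_end Suc.prems by simp
      have W: "Wk (i - i0) (y i0) (y i) \<le> b (i - i0)"
        using b_Wk[of "i - i0" "i0 - 1" i] i0 True zi zle by simp
      have "Rec Q i (y 0) (y i) \<le> b (z i0) * Wk (i - i0) (y i0) (y i)"
        using IH yU Suc.prems by simp
      also have "\<dots> \<le> b (z i0) * b (i - i0)" using W b_nn by (intro mult_left_mono)
      also have "\<dots> \<le> b (z i)" using b_mult[of "z i0" "i - i0"] zi zle by simp
      also have "z i = z (Suc i)" using True by (simp add: z_def lessThan_Suc)
      finally have "Rec Q (Suc i) (y 0) v \<le> b (z (Suc i)) * Wk 0 (y (Suc i)) v" for v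
        using R01[OF True, of v] by (cases "v = y (Suc i)") (simp_all del: Rec.simps(2))
      then show ?thesis using True by (intro exI[of _ "Suc i"]) auto
    next
      case False
      have "Rec Q (Suc i) (y 0) v \<le> b (z i0) * Wk (Suc i - i0) (y i0) v" if v: "v \<in> U" for v
      proof -
        have "Rec Q (Suc i) (y 0) v = (\<Sum>w\<in>U. Rec Q i (y 0) w * of_bool (R w v))"
          using False by (simp add: Q_def)
        also have "\<dots> \<le> (\<Sum>w\<in>U. b (z i0) * Wk (i - i0) (y i0) w * of_bool (R w v))"
          by (intro sum_mono mult_right_mono IH) auto
        also have "\<dots> = b (z i0) * Wk (Suc (i - i0)) (y i0) v"
          by (simp add: sum_distrib_left mult.assoc)
        also have "Suc (i - i0) = Suc i - i0" using i0 by simp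
        finally show ?thesis .
      qed
      then show ?thesis using i0 False by (intro exI[of _ i0]) (auto simp: less_Suc_eq)
    qed
  qed
  have "real (card (fiber P y)) \<le> Rec Q (2 * l) (y 0) (y 0)"
    by (rule card_walks_le) (use yU P in \<open>auto simp: fiber_def CW_def Q_def\<close>)
  also obtain i0 where i0: "1 \<le> i0" "i0 \<le> 2 * l" "i0 - 1 \<in> P" "\<forall>k. i0 \<le> k \<and> k < 2 * l \<longrightarrow> k \<notin> P"
      and le: "\<And>v. v \<in> U \<Longrightarrow> Rec Q (2 * l) (y 0) v \<le> b (z i0) * Wk (2 * l - i0) (y i0) v"
    using claim[of "2 * l"] l_ge by auto
  have zi: "z (2 * l) = z i0 + (2 * l - i0)" by (rule z_gap) (use i0 in auto)
  have W: "Wk (2 * l - i0) (y i0) (y 0) \<le> b (2 * l - i0)"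
    using b_Wk[of "2 * l - i0" "i0 - 1" 0] i0 P(2) zi z_end by simp
  have "Rec Q (2 * l) (y 0) (y 0) \<le> b (z i0) * Wk (2 * l - i0) (y i0) (y 0)"
    using le yU by simp
  also have "\<dots> \<le> b (z i0) * b (2 * l - i0)" using W b_nn by (intro mult_left_mono)
  also have "\<dots> \<le> b (2 * l - card P)" using b_mult[of "z i0" "2 * l - i0"] zi z_end by simp
  finally show ?thesis .
qed

section \<open>Conflicts with saturated edge sets\<close>

definition arcs :: "'b set set \<Rightarrow> ('v \<times> 'v) set" where
  "arcs T = {(u, v). R u v \<and> {pr u, pr v} \<in> T}"

lemma finite_arcs: "finite (arcs T)"
  by (rule finite_subset[of _ "U \<times> U"]) (use fin_U R_U R_U' in \<open>auto simp: arcs_def\<close>)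

lemma card_arcs_le:
  assumes "finite T"
  shows "card (arcs T) \<le> 2 * card T"
proof -
  have 1: "card {(u, v). R u v \<and> {pr u, pr v} = f} \<le> 2" for f
  proof (cases "\<exists>u v. R u v \<and> {pr u, pr v} = f")
    case True
    then obtain u v where uv: "R u v" "{pr u, pr v} = f" by auto
    have "{(u, v). R u v \<and> {pr u, pr v} = f} \<subseteq> {(u, v), (v, u)}"
    proof
      fix e assume "e \<in> {(u, v). R u v \<and> {pr u, pr v} = f}"
      then obtain u' v' where e: "e = (u', v')" "R u' v'" "{pr u', pr v'} = f" by auto
      have "{pr u', pr v'} = {pr u, pr v}" using e uv by simp
      from pr_inj[OF e(2) uv(1) this] e show "e \<in> {(u, v), (v, u)}" by auto
    qed
    then have "card {(u, v). R u v \<and> {pr u, pr v} = f} \<le> card {(u, v), (v, u)}"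
      by (intro card_mono) auto
    also have "\<dots> \<le> 2" using card_length[of "[(u, v), (v, u)]"] by simp
    finally show ?thesis .
  next
    case False
    then have "{(u, v). R u v \<and> {pr u, pr v} = f} = {}" by blast
    then show ?thesis by (simp only: card.empty)
  qed
  have "arcs T = (\<Union>f\<in>T. {(u, v). R u v \<and> {pr u, pr v} = f})" by (auto simp: arcs_def)
  then have "card (arcs T) \<le> (\<Sum>f\<in>T. card {(u, v). R u v \<and> {pr u, pr v} = f})"
    using card_UN_le[OF assms] by simp
  also have "\<dots> \<le> (\<Sum>f\<in>T. 2)" by (rule sum_mono) (rule 1)
  finally show ?thesis by simp
qed

definition trace :: "nat set \<Rightarrow> (nat \<Rightarrow> 'v) \<Rightarrow> nat \<Rightarrow> 'v \<times> 'v" where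
  "trace P x = (\<lambda>i\<in>P. (x i, x (Suc i)))"

lemma trace_arcs:
  assumes "x \<in> CW" "P \<subseteq> {..<2 * l}" "ed x ` P \<subseteq> T"
  shows "trace P x \<in> P \<rightarrow>\<^sub>E arcs T"
  using assms by (auto simp: trace_def arcs_def ed_def CW_def)

lemma sum_arcs:
  assumes g: "\<And>v. g v \<ge> (0::real)"
  shows "(\<Sum>e\<in>arcs UNIV. g (fst e) + g (snd e)) \<le> 2 * \<Delta> * (\<Sum>v\<in>U. g v)"
proof -
  have arcs: "arcs UNIV = (SIGMA u:U. {v. R u v})" using R_U by (auto simp: arcs_def)
  have fst: "(\<Sum>e\<in>arcs UNIV. g (fst e)) \<le> \<Delta> * (\<Sum>v\<in>U. g v)"
  proof -
    have "(\<Sum>e\<in>arcs UNIV. g (fst e)) = (\<Sum>u\<in>U. \<Sum>v\<in>{v. R u v}. g u)"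
      unfolding arcs by (subst sum.Sigma) (use fin_U fin_R in \<open>auto intro!: sum.cong\<close>)
    also have "\<dots> = (\<Sum>u\<in>U. card {v. R u v} * g u)" by simp
    also have "\<dots> \<le> (\<Sum>u\<in>U. \<Delta> * g u)" by (intro sum_mono mult_right_mono R_deg g)
    finally show ?thesis by (simp add: sum_distrib_left)
  qed
  have "(\<Sum>e\<in>arcs UNIV. g (snd e)) = (\<Sum>e\<in>arcs UNIV. g (fst e))"
    by (rule sum.reindex_bij_witness[of _ prod.swap prod.swap]) (auto simp: arcs_def R_sym insert_commute)
  then show ?thesis using fst by (simp add: sum.distrib)
qed

text \<open>Group the conflicting walks by their arcs at the positions \<open>P\<close>. The bound
  on a fiber is a sum over positions, so one position and the arc there may be fixed: at most
  \<open>\<sigma>\<close> saturated sets of size \<open>t\<close> contain its edge, and each can be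
  placed on \<open>P\<close> in at most \<open>(2 * t) ^ t\<close> ways because an edge has two
  orientations. The sum over all arcs then costs \<open>2 * \<Delta>\<close>.\<close>

lemma card_conflict_le:
  fixes \<sigma> :: real
  assumes P: "P \<subseteq> {..<2 * l}" "P \<noteq> {}" and t: "t = card P" and finSat: "finite Sat"
    and \<sigma>: "\<And>f. card {T \<in> Sat. f \<in> T \<and> card T = t} \<le> \<sigma>"
    and g: "\<And>v. g v \<ge> (0::real)" and \<kappa>: "\<kappa> \<ge> 0"
    and fiber: "\<And>y. y \<in> CW \<Longrightarrow> real (card (fiber P y))
        \<le> \<kappa> * (\<Sum>i\<in>P. g (y i) + g (y (Suc i)))"
  shows "real (card (conflicts Sat P)) \<le> \<kappa> * t * real ((2 * t) ^ t) * \<sigma> * (2 * \<Delta> * (\<Sum>v\<in>U. g v))"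
proof -
  have finP: "finite P" using P finite_subset by auto
  define B where "B = conflicts Sat P"
  have finB: "finite B" using finite_CW by (simp add: B_def conflicts_def)
  have B: "B \<subseteq> {x \<in> CW. ed x ` P \<in> Sat \<and> card (ed x ` P) = t}" by (auto simp: B_def conflicts_def t)
  define G where "G e = g (fst e) + g (snd e)" for e
  define \<C> where "\<C> = trace P ` B"
  have fin\<C>: "finite \<C>" using finB by (simp add: \<C>_def)
  have G_nn: "G e \<ge> 0" for e using g by (simp add: G_def)
  have one: "(\<Sum>c\<in>\<C>. G (c i)) \<le> real ((2 * t) ^ t) * \<sigma> * (2 * \<Delta> * (\<Sum>v\<in>U. g v))" if i: "i \<in> P" for i
  proof -
    have cU: "c i \<in> arcs UNIV" if "c \<in> \<C>" for c
    proof -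
      from that obtain x where x: "x \<in> B" "c = trace P x" by (auto simp: \<C>_def)
      have "x \<in> CW" using subsetD[OF B x(1)] by simp
      from trace_arcs[OF this P(1) subset_UNIV] show ?thesis using i by (auto simp: x(2) PiE_iff)
    qed
    have cnt: "real (card {c \<in> \<C>. c i = e}) \<le> real ((2 * t) ^ t) * \<sigma>" for e
    proof -
      define f where "f = {pr (fst e), pr (snd e)}"
      define \<T> where "\<T> = {T \<in> Sat. f \<in> T \<and> card T = t}"
      have "{c \<in> \<C>. c i = e} \<subseteq> (\<Union>T\<in>\<T>. P \<rightarrow>\<^sub>E arcs T)"
      proof
        fix c assume "c \<in> {c \<in> \<C>. c i = e}"
        then obtain x where x: "x \<in> B" "c = trace P x" "c i = e" by (auto simp: \<C>_def)
        have "ed x i = f" using x i by (auto simp: ed_def f_def trace_def)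
        then have f: "f \<in> ed x ` P" using i by (metis imageI)
        from subsetD[OF B x(1)] have xB: "x \<in> CW" "ed x ` P \<in> Sat" "card (ed x ` P) = t" by simp_all
        have "ed x ` P \<in> \<T>" using xB f by (simp add: \<T>_def)
        moreover have "c \<in> P \<rightarrow>\<^sub>E arcs (ed x ` P)"
          unfolding x(2) by (rule trace_arcs[OF xB(1) P(1) subset_refl])
        ultimately show "c \<in> (\<Union>T\<in>\<T>. P \<rightarrow>\<^sub>E arcs T)" by blast
      qed
      moreover have fin\<T>: "finite \<T>" using finSat by (simp add: \<T>_def)
      ultimately have "card {c \<in> \<C>. c i = e} \<le> (\<Sum>T\<in>\<T>. card (P \<rightarrow>\<^sub>E arcs T))"
        using finP finite_arcs by (intro order_trans[OF card_mono card_UN_le]) (auto intro!: finite_PiE)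
      also have "\<dots> \<le> (\<Sum>T\<in>\<T>. (2 * t) ^ t)"
      proof (rule sum_mono)
        fix T assume T: "T \<in> \<T>"
        then have "card T = t" by (simp add: \<T>_def)
        moreover have "t > 0" using P finP t by (simp add: card_gt_0_iff)
        ultimately have "finite T" using card_gt_0_iff by metis
        from card_arcs_le[OF this] \<open>card T = t\<close> have "card (arcs T) ^ t \<le> (2 * t) ^ t"
          by (intro power_mono) auto
        then show "card (P \<rightarrow>\<^sub>E arcs T) \<le> (2 * t) ^ t" using finP t by (simp add: card_PiE)
      qed
      also have "\<dots> = card \<T> * (2 * t) ^ t" by simp
      finally have "real (card {c \<in> \<C>. c i = e}) \<le> real (card \<T> * (2 * t) ^ t)" by (rule of_nat_mono)
      also have "\<dots> \<le> \<sigma> * real ((2 * t) ^ t)"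
        using \<sigma>[of f] by (simp add: \<T>_def mult_right_mono)
      finally show ?thesis by (simp add: mult.commute)
    qed
    have "(\<Sum>c\<in>\<C>. G (c i)) = (\<Sum>e\<in>arcs UNIV. \<Sum>c\<in>{c \<in> \<C>. c i = e}. G (c i))"
      by (rule sum.group[symmetric]) (use fin\<C> finite_arcs cU in auto)
    also have "\<dots> = (\<Sum>e\<in>arcs UNIV. card {c \<in> \<C>. c i = e} * G e)"
      by (intro sum.cong refl) simp
    also have "\<dots> \<le> (\<Sum>e\<in>arcs UNIV. (real ((2 * t) ^ t) * \<sigma>) * G e)"
      by (intro sum_mono mult_right_mono cnt G_nn)
    also have "\<dots> = (real ((2 * t) ^ t) * \<sigma>) * (\<Sum>e\<in>arcs UNIV. G e)" by (simp add: sum_distrib_left)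
    also have "\<dots> \<le> (real ((2 * t) ^ t) * \<sigma>) * (2 * \<Delta> * (\<Sum>v\<in>U. g v))"
      unfolding G_def using \<sigma>[of undefined] sum_arcs[of g] g
      by (intro mult_left_mono) (auto intro!: mult_nonneg_nonneg order_trans[OF _ \<sigma>[of undefined]])
    finally show ?thesis .
  qed
  have "card B = (\<Sum>c\<in>\<C>. card {x \<in> B. trace P x = c})"
  proof -
    have "card B = (\<Sum>x\<in>B. 1)" by simp
    also have "\<dots> = (\<Sum>c\<in>\<C>. \<Sum>x\<in>{x \<in> B. trace P x = c}. 1)"
      by (rule sum.group[symmetric]) (use finB fin\<C> in \<open>auto simp: \<C>_def\<close>)
    finally show ?thesis by simp
  qed
  then have "real (card B) = (\<Sum>c\<in>\<C>. real (card {x \<in> B. trace P x = c}))" by simp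
  also have "\<dots> \<le> (\<Sum>c\<in>\<C>. \<kappa> * (\<Sum>i\<in>P. G (c i)))"
  proof (rule sum_mono)
    fix c assume "c \<in> \<C>"
    then obtain y where y: "y \<in> B" "c = trace P y" by (auto simp: \<C>_def)
    have "card {x \<in> B. trace P x = c} \<le> card (fiber P y)"
    proof (rule card_mono)
      show "{x \<in> B. trace P x = c} \<subseteq> fiber P y"
        unfolding fiber_def
      proof safe
        fix x i assume x: "x \<in> B" "c = trace P x" and i: "i \<in> P"
        have "trace P x i = trace P y i" using x y by simp
        then show "x i = y i" "x (Suc i) = y (Suc i)" using i by (auto simp: trace_def)
      qed (auto simp: B_def conflicts_def)
    qed (use finite_CW in \<open>auto simp: fiber_def\<close>)
    also have "real \<dots> \<le> \<kappa> * (\<Sum>i\<in>P. g (y i) + g (y (Suc i)))"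
      by (rule fiber) (use y(1) B in blast)
    also have "(\<Sum>i\<in>P. g (y i) + g (y (Suc i))) = (\<Sum>i\<in>P. G (c i))"
      by (intro sum.cong refl) (auto simp: G_def y trace_def)
    finally show "real (card {x \<in> B. trace P x = c}) \<le> \<kappa> * (\<Sum>i\<in>P. G (c i))" by simp
  qed
  also have "\<dots> = \<kappa> * (\<Sum>i\<in>P. \<Sum>c\<in>\<C>. G (c i))"
    by (subst sum.swap) (simp add: sum_distrib_left)
  also have "\<dots> \<le> \<kappa> * (\<Sum>i\<in>P. real ((2 * t) ^ t) * \<sigma> * (2 * \<Delta> * (\<Sum>v\<in>U. g v)))"
    by (intro mult_left_mono sum_mono one \<kappa>)
  also have "\<dots> = \<kappa> * t * real ((2 * t) ^ t) * \<sigma> * (2 * \<Delta> * (\<Sum>v\<in>U. g v))"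
    by (simp add: t mult.assoc)
  finally show ?thesis by (simp add: B_def)
qed

text \<open>Every gap has its endpoints on prescribed arcs, where \<open>m H\<close> is at most the
  sum on the right. A gap of length \<open>g\<close> thus contributes at most
  \<open>\<mu> ^ g\<close>, and the exponents add up to the number of free steps, up to one factor
  \<open>\<Delta>\<close> if that number is odd.\<close>

lemma card_prescribed_le_m:
  assumes P: "P \<subseteq> {..<2 * l}" "0 \<in> P" and y: "y \<in> CW" and H: "H \<ge> 1"
    and z: "2 * l - card P = 2 * H \<or> 2 * l - card P = 2 * H + 1"
  shows "real (card (fiber P y))
    \<le> (if 2 * l - card P = 2 * H then 1 else \<Delta>) * (\<Sum>i\<in>P. m H (y i) + m H (y (Suc i)))"
proof -
  define S where "S = (\<Sum>i\<in>P. m H (y i) + m H (y (Suc i)))"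
  \<comment> \<open>By \<open>m_le\<close> the cap loses nothing. It ensures
    \<open>\<mu> \<le> \<Delta>\<close>, which makes \<open>b\<close> supermultiplicative also at
    length \<open>2 * H + 1\<close>.\<close>
  define Y where "Y = min S (\<Delta> ^ (2 * H))"
  define \<mu> where "\<mu> = root (2 * H) Y"
  define b where "b g = (if g = 2 * H + 1 then \<Delta> * \<mu> ^ (2 * H) else \<mu> ^ g)" for g
  have finP: "finite P" using P finite_subset by auto
  have yU: "y i \<in> U" if "i \<le> 2 * l" for i using y that by (auto simp: CW_def PiE_iff)
  have S_nn: "S \<ge> 0" unfolding S_def by (intro sum_nonneg add_nonneg_nonneg m_nn)
  have Y_nn: "Y \<ge> 0" using S_nn \<Delta>_nn by (simp add: Y_def)
  have \<mu>: "\<mu> ^ (2 * H) = Y" "\<mu> \<ge> 0" using H Y_nn by (auto simp: \<mu>_def)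
  have "\<mu> ^ (2 * H) \<le> \<Delta> ^ (2 * H)" unfolding \<mu>(1) by (simp add: Y_def)
  then have \<mu>\<Delta>: "\<mu> \<le> \<Delta>" using \<mu>(2) \<Delta>_nn H by (subst (asm) power_mono_iff) auto
  have mY: "m H (y i) \<le> Y \<and> m H (y (Suc i)) \<le> Y" if i: "i \<in> P" for i
  proof -
    have "m H (y i) + m H (y (Suc i)) \<le> S" unfolding S_def
      by (rule member_le_sum[of i P "\<lambda>i. m H (y i) + m H (y (Suc i))"])
        (use i finP m_nn in \<open>auto intro: add_nonneg_nonneg\<close>)
    moreover have "m H (y i) \<ge> 0" "m H (y (Suc i)) \<ge> 0" by (rule m_nn)+
    moreover have "m H (y i) \<le> \<Delta> ^ (2 * H)" "m H (y (Suc i)) \<le> \<Delta> ^ (2 * H)"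
      using i P yU by (auto intro!: m_le)
    ultimately show ?thesis by (simp add: Y_def)
  qed
  have "real (card (fiber P y)) \<le> b (2 * l - card P)"
  proof (rule card_prescribed_le[OF P y])
    show "b 0 = 1" by (simp add: b_def)
    show "b g \<ge> 0" for g using \<mu> \<Delta>_nn Y_nn by (simp add: b_def)
    show "b g * b h \<le> b (g + h)" if gh: "g + h \<le> 2 * l - card P" for g h
    proof -
      consider "g = 0" | "h = 0" | "g + h \<le> 2 * H" | "g \<le> 2 * H" "h \<le> 2 * H" "g + h = 2 * H + 1"
        using gh z by linarith
      then show ?thesis
      proof cases
        case 4
        have "\<mu> ^ g * \<mu> ^ h = \<mu> * \<mu> ^ (2 * H)" using 4 by (simp add: power_add[symmetric])
        also have "\<dots> \<le> \<Delta> * \<mu> ^ (2 * H)" using \<mu>\<Delta> \<mu> by (intro mult_right_mono) auto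
        finally show ?thesis using 4 by (simp add: b_def)
      qed (auto simp: b_def power_add)
    qed
    show "Wk g (y (Suc i)) (y j) \<le> b g" if g: "g \<le> 2 * l - card P" and ij: "i \<in> P" "j \<in> P" for g i j
    proof -
      have U: "y (Suc i) \<in> U" "y j \<in> U" using ij P yU by force+
      show ?thesis
      proof (cases "g = 2 * H + 1")
        case True
        then show ?thesis using Wk_odd_le[OF U, of H Y] mY ij \<mu> by (simp add: b_def del: Wk.simps)
      next
        case False
        then have "g \<le> 2 * H" using g z by linarith
        then show ?thesis using Wk_le_power[OF U H \<mu>(2), of g] mY ij \<mu> False by (simp add: b_def)
      qed
    qed
  qed
  also have "\<dots> = (if 2 * l - card P = 2 * H then 1 else \<Delta>) * Y" using z \<mu> by (auto simp: b_def)
  also have "\<dots> \<le> (if 2 * l - card P = 2 * H then 1 else \<Delta>) * S"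
    using \<Delta>_nn by (intro mult_left_mono) (auto simp: Y_def)
  finally show ?thesis by (simp add: S_def)
qed

text \<open>With a single free step between prescribed endpoints nothing is left to choose.\<close>

lemma card_prescribed_le_1:
  assumes P: "P \<subseteq> {..<2 * l}" "0 \<in> P" and y: "y \<in> CW" and z: "card P = 2 * l - 1"
  shows "real (card (fiber P y)) \<le> 1"
proof -
  have yU: "y i \<in> U" if "i \<le> 2 * l" for i using y that by (auto simp: CW_def PiE_iff)
  show ?thesis
  proof (rule card_prescribed_le[OF P y, of "\<lambda>_. 1"])
    fix g i j assume g: "g \<le> 2 * l - card P" and ij: "i \<in> P" "j \<in> P"
    have "g = 0 \<or> g = Suc 0" using g z l_ge by auto
    moreover have "y (Suc i) \<in> U" using ij P yU by force
    ultimately show "Wk g (y (Suc i)) (y j) \<le> 1" using Wk_1 by (auto simp del: Wk.simps(2))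
  qed auto
qed

text \<open>The cases are an even, an odd, and a single free step. The last is treated apart, with
  \<open>m 0 = 1\<close>, because the odd bound at \<open>H = 0\<close> would lose a factor
  \<open>\<Delta>\<close>.\<close>

lemma card_conflict_le_M:
  fixes \<sigma> :: real
  assumes P: "P \<subseteq> {..<2 * l}" "0 \<in> P" and t: "t = card P" and finSat: "finite Sat"
    and \<sigma>: "\<And>f. card {T \<in> Sat. f \<in> T \<and> card T = t} \<le> \<sigma>"
  defines "N \<equiv> real (card (conflicts Sat P))"
  shows "t = 2 * l - 2 * H \<Longrightarrow> 1 \<le> H \<Longrightarrow> H < l \<Longrightarrow> N \<le> t * real ((2 * t) ^ t) * \<sigma> * (2 * \<Delta> * M H)"
    and "t = 2 * l - 2 * H - 1 \<Longrightarrow> 1 \<le> H \<Longrightarrow> H < l \<Longrightarrow> N \<le> \<Delta> * t * real ((2 * t) ^ t) * \<sigma> * (2 * \<Delta> * M H)"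
    and "t = 2 * l - 1 \<Longrightarrow> N \<le> t * real ((2 * t) ^ t) * \<sigma> * (2 * \<Delta> * M 0)"
proof -
  have P': "P \<noteq> {}" using P by auto
  have gen: "N \<le> \<kappa> * t * real ((2 * t) ^ t) * \<sigma> * (2 * \<Delta> * M H)"
    if "\<kappa> \<ge> 0" "\<And>y. y \<in> CW \<Longrightarrow> real (card (fiber P y)) \<le> \<kappa> * (\<Sum>i\<in>P. m H (y i) + m H (y (Suc i)))" for \<kappa> H
    unfolding N_def M_def by (rule card_conflict_le[OF P(1) P' t finSat \<sigma> m_nn that])
  show "N \<le> t * real ((2 * t) ^ t) * \<sigma> * (2 * \<Delta> * M H)" if "t = 2 * l - 2 * H" "1 \<le> H" "H < l"
    using gen[of 1 H] card_prescribed_le_m[OF P, of _ H] that t by simp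
  show "N \<le> \<Delta> * t * real ((2 * t) ^ t) * \<sigma> * (2 * \<Delta> * M H)"
    if a: "t = 2 * l - 2 * H - 1" "1 \<le> H" "H < l"
  proof (rule gen[OF \<Delta>_nn])
    fix y assume "y \<in> CW"
    moreover have "2 * l - card P = 2 * H + 1" using a t by simp
    ultimately show "real (card (fiber P y)) \<le> \<Delta> * (\<Sum>i\<in>P. m H (y i) + m H (y (Suc i)))"
      using card_prescribed_le_m[OF P, of y H] a by simp
  qed
  show "N \<le> t * real ((2 * t) ^ t) * \<sigma> * (2 * \<Delta> * M 0)" if a: "t = 2 * l - 1"
  proof -
    have "real (card (fiber P y)) \<le> 1 * (\<Sum>i\<in>P. m 0 (y i) + m 0 (y (Suc i)))" if "y \<in> CW" for y
    proof -
      have "real (card (fiber P y)) \<le> 1" using card_prescribed_le_1[OF P that] a t by simp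
      moreover have "card P \<ge> 1" using a t l_ge by simp
      ultimately show ?thesis by simp
    qed
    from gen[OF _ this] show ?thesis by simp
  qed
qed

section \<open>Rotations of closed walks and the union bound\<close>

definition rot :: "nat \<Rightarrow> (nat \<Rightarrow> 'v) \<Rightarrow> nat \<Rightarrow> 'v" where
  "rot r x = (\<lambda>i\<in>{..2 * l}. x ((i + r) mod (2 * l)))"

lemma CW_mod_Suc: "x \<in> CW \<Longrightarrow> x (Suc k mod (2 * l)) = x (Suc (k mod (2 * l)))"
  by (auto simp: mod_Suc CW_def)

lemma rot_CW: assumes x: "x \<in> CW" shows "rot r x \<in> CW"
proof -
  have pos: "k mod (2 * l) < 2 * l" for k using l_ge by simp
  have "x (k mod (2 * l)) \<in> U" for k using x less_imp_le[OF pos] by (auto simp: CW_def PiE_iff)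
  moreover have "R (x (k mod (2 * l))) (x (Suc k mod (2 * l)))" for k
    unfolding CW_mod_Suc[OF x] using x pos by (auto simp: CW_def)
  ultimately show ?thesis by (auto simp: CW_def rot_def)
qed

lemma ed_rot: "x \<in> CW \<Longrightarrow> i < 2 * l \<Longrightarrow> ed (rot r x) i = ed x ((i + r) mod (2 * l))"
  using CW_mod_Suc[of x "i + r"] by (simp add: ed_def rot_def)

lemma mod_shift:
  assumes "r < 2 * l" "j < 2 * l"
  shows "\<exists>i<2 * l. (i + r) mod (2 * l) = j"
proof (cases "r \<le> j")
  case True then show ?thesis using assms by (intro exI[of _ "j - r"]) auto
next
  case False
  have "(2 * l + j - r + r) mod (2 * l) = j" using False assms by simp
  then show ?thesis using False assms by (intro exI[of _ "2 * l + j - r"]) auto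
qed

lemma inj_mod_shift: "r < 2 * l \<Longrightarrow> inj_on (\<lambda>i. (i + r) mod (2 * l)) {..<2 * l}"
proof (rule eq_card_imp_inj_on)
  assume r: "r < 2 * l"
  have "(\<lambda>i. (i + r) mod (2 * l)) ` {..<2 * l} = {..<2 * l}"
    using mod_shift[OF r] l_ge by (auto simp: image_iff)
  then show "card ((\<lambda>i. (i + r) mod (2 * l)) ` {..<2 * l}) = card {..<2 * l}" by simp
qed simp

lemma inj_rot: "r < 2 * l \<Longrightarrow> inj_on (rot r) CW"
proof (rule inj_onI)
  fix x y assume r: "r < 2 * l" and xy: "x \<in> CW" "y \<in> CW" "rot r x = rot r y"
  have *: "x j = y j" if j: "j < 2 * l" for j
  proof -
    obtain i where i: "i < 2 * l" "(i + r) mod (2 * l) = j" using mod_shift[OF r j] by auto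
    then show ?thesis using fun_cong[OF xy(3), of i] by (simp add: rot_def)
  qed
  show "x = y"
  proof
    fix j
    consider "j < 2 * l" | "j = 2 * l" | "j > 2 * l" by linarith
    then show "x j = y j"
    proof cases
      case 2
      then show ?thesis using xy(1,2) *[of 0] l_ge by (simp add: CW_def)
    next
      case 3
      then show ?thesis using xy(1,2) by (simp add: CW_def PiE_iff extensional_def)
    qed (rule *)
  qed
qed

lemma card_rot_le:
  assumes "S \<subseteq> CW"
  shows "card {x \<in> CW. \<exists>r<2 * l. rot r x \<in> S} \<le> 2 * l * card S"
proof -
  have "{x \<in> CW. \<exists>r<2 * l. rot r x \<in> S} = (\<Union>r\<in>{..<2 * l}. {x \<in> CW. rot r x \<in> S})" by auto
  then have "card {x \<in> CW. \<exists>r<2 * l. rot r x \<in> S} \<le> (\<Sum>r\<in>{..<2 * l}. card {x \<in> CW. rot r x \<in> S})"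
    using card_UN_le[of "{..<2 * l}"] by simp
  also have "\<dots> \<le> (\<Sum>r\<in>{..<2 * l}. card S)"
  proof (rule sum_mono)
    fix r assume "r \<in> {..<2 * l}"
    then have "inj_on (rot r) {x \<in> CW. rot r x \<in> S}"
      by (intro inj_on_subset[OF inj_rot]) auto
    moreover have "finite S" using assms finite_CW finite_subset by auto
    ultimately show "card {x \<in> CW. rot r x \<in> S} \<le> card S"
      by (intro card_inj_on_le[of "rot r"]) auto
  qed
  finally show ?thesis by simp
qed

lemma inj_ed:
  assumes x: "x \<in> CW" and inj: "inj_on (\<lambda>i. pr (x i)) {..<2 * l}"
  shows "inj_on (ed x) {..<2 * l}"
proof -
  have "inj_on (\<lambda>i. {pr (x i), pr (x (Suc i mod (2 * l)))}) {..<2 * l}"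
    by (rule inj_on_cycle_edges[OF _ inj]) (use l_ge in simp)
  then show ?thesis by (rule inj_on_cong[THEN iffD1, rotated]) (use CW_mod_Suc[OF x] in \<open>simp add: ed_def\<close>)
qed

text \<open>Union bound over three kinds of bad walks. Rotation brings a repeated vertex to position
  0 with its partner at distance at most \<open>l\<close>, and a saturated set to positions that
  include 0; each reduction costs a factor \<open>2 * l\<close>.\<close>

lemma good_walk:
  fixes \<alpha> \<beta> \<gamma> \<theta> :: real
  assumes \<theta>: "\<theta> > 0" and finHH: "finite HH"
    and col: "\<theta> * M (l - 1) + \<Delta> / \<theta> * M l \<le> \<alpha> * M l"
    and conf: "\<And>P. P \<subseteq> {..<2 * l} \<Longrightarrow> 0 \<in> P \<Longrightarrow> 2 \<le> card P \<Longrightarrow> card P \<le> 2 * l - 1 \<Longrightarrow>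
      real (card (conflicts Sat P)) \<le> \<beta> * M l"
    and HH: "\<And>D. D \<in> HH \<Longrightarrow> card D = 2 * l" and HH_le: "real (card HH) * (4 * l) ^ (2 * l) \<le> \<gamma> * M l"
    and small: "2 * l * (l * \<alpha>) + 2 * l * (2 ^ (2 * l) * \<beta>) + \<gamma> < 1" and \<beta>: "\<beta> \<ge> 0"
  shows "\<exists>x\<in>CW. inj_on (\<lambda>i. pr (x i)) {..<2 * l} \<and> ed x ` {..<2 * l} \<notin> HH \<and>
    (\<forall>T\<in>Sat. T \<subseteq> ed x ` {..<2 * l} \<longrightarrow> \<not> (2 \<le> card T \<and> card T \<le> 2 * l - 1))"
proof (rule ccontr)
  assume none: "\<not> ?thesis"
  define C0 where "C0 = (\<Union>j\<in>{1..l}. {x \<in> CW. pr (x 0) = pr (x j)})"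
  define \<P> where "\<P> = {P. P \<subseteq> {..<2 * l} \<and> 0 \<in> P \<and> 2 \<le> card P \<and> card P \<le> 2 * l - 1}"
  define S0 where "S0 = (\<Union>P\<in>\<P>. conflicts Sat P)"
  define A1 where "A1 = {x \<in> CW. \<exists>r<2 * l. rot r x \<in> C0}"
  define A2 where "A2 = {x \<in> CW. \<exists>r<2 * l. rot r x \<in> S0}"
  define A3 where "A3 = {x \<in> CW. ed x ` {..<2 * l} \<in> HH}"
  have fin\<P>: "finite \<P>" by (rule finite_subset[of _ "Pow {..<2 * l}"]) (auto simp: \<P>_def)
  have card\<P>: "card \<P> \<le> 2 ^ (2 * l)"
    using card_mono[of "Pow {..<2 * l}" \<P>] by (auto simp: \<P>_def card_Pow)
  have "CW \<subseteq> A1 \<union> A2 \<union> A3"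
  proof
    fix x assume x: "x \<in> CW"
    consider "\<not> inj_on (\<lambda>i. pr (x i)) {..<2 * l}" | "ed x ` {..<2 * l} \<in> HH"
      | "inj_on (\<lambda>i. pr (x i)) {..<2 * l}" "\<exists>T\<in>Sat. T \<subseteq> ed x ` {..<2 * l} \<and> 2 \<le> card T \<and> card T \<le> 2 * l - 1"
      using none x by blast
    then show "x \<in> A1 \<union> A2 \<union> A3"
    proof cases
      case 1
      have "\<exists>i j. i < j \<and> j < 2 * l \<and> pr (x i) = pr (x j)"
      proof -
        from 1 obtain i j where "i < 2 * l" "j < 2 * l" "i \<noteq> j" "pr (x i) = pr (x j)"
          by (auto simp: inj_on_def)
        then show ?thesis by (metis linorder_neqE_nat)
      qed
      then obtain i j where ij: "i < j" "j < 2 * l" "pr (x i) = pr (x j)" by auto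
      show ?thesis
      proof (cases "j - i \<le> l")
        case True
        have "rot i x 0 = x i" "rot i x (j - i) = x j" using ij by (auto simp: rot_def)
        then have "rot i x \<in> {x \<in> CW. pr (x 0) = pr (x (j - i))}" using ij rot_CW[OF x] by simp
        moreover have "j - i \<in> {1..l}" using True ij by auto
        ultimately have "rot i x \<in> C0" unfolding C0_def by blast
        then show ?thesis using x ij by (auto simp: A1_def intro!: exI[of _ i])
      next
        \<comment> \<open>The way from \<open>j\<close> round to \<open>i\<close> is then the
          shorter one, so the walk is rotated to start at \<open>j\<close>.\<close>
        case False
        have "(2 * l - (j - i) + j) mod (2 * l) = (2 * l + i) mod (2 * l)" using ij by simp
        also have "\<dots> = i" using ij by simp
        finally have "rot j x 0 = x j" "rot j x (2 * l - (j - i)) = x i" using ij by (auto simp: rot_def)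
        then have "rot j x \<in> {x \<in> CW. pr (x 0) = pr (x (2 * l - (j - i)))}" using ij rot_CW[OF x] by simp
        moreover have "2 * l - (j - i) \<in> {1..l}" using False ij by auto
        ultimately have "rot j x \<in> C0" unfolding C0_def by blast
        then show ?thesis using x ij by (auto simp: A1_def intro!: exI[of _ j])
      qed
    next
      case 2 then show ?thesis using x by (simp add: A3_def)
    next
      case 3
      then obtain T where T: "T \<in> Sat" "T \<subseteq> ed x ` {..<2 * l}" "2 \<le> card T" "card T \<le> 2 * l - 1" by auto
      have "T \<noteq> {}" using T(3) by auto
      then obtain f where "f \<in> T" by auto
      with T(2) obtain r where r: "r < 2 * l" "ed x r \<in> T" by auto
      define P where "P = {i. i < 2 * l \<and> ed (rot r x) i \<in> T}"
      have img: "ed (rot r x) ` P = T"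
      proof
        show "T \<subseteq> ed (rot r x) ` P"
        proof
          fix f assume f: "f \<in> T"
          with T(2) obtain j where j: "j < 2 * l" "f = ed x j" by auto
          obtain i where i: "i < 2 * l" "(i + r) mod (2 * l) = j" using mod_shift[OF r(1) j(1)] by auto
          then have "ed (rot r x) i = f" using ed_rot[OF x i(1), of r] j by simp
          then show "f \<in> ed (rot r x) ` P" using f i by (auto simp: P_def)
        qed
      qed (auto simp: P_def)
      have "inj_on (ed (rot r x)) {..<2 * l}"
      proof (rule inj_onI)
        fix i j assume ij: "i \<in> {..<2 * l}" "j \<in> {..<2 * l}" "ed (rot r x) i = ed (rot r x) j"
        then have "ed x ((i + r) mod (2 * l)) = ed x ((j + r) mod (2 * l))" using ed_rot[OF x] by simp
        then have "(i + r) mod (2 * l) = (j + r) mod (2 * l)"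
          by (rule inj_onD[OF inj_ed[OF x 3(1)]]) (use l_ge in auto)
        then show "i = j" by (rule inj_onD[OF inj_mod_shift[OF r(1)]]) (use ij in auto)
      qed
      then have "inj_on (ed (rot r x)) P" by (rule inj_on_subset) (auto simp: P_def)
      from card_image[OF this] have "card P = card T" by (simp add: img)
      moreover have "0 \<in> P" using r l_ge ed_rot[OF x, of 0 r] by (simp add: P_def)
      ultimately have "P \<in> \<P>" using T by (auto simp: \<P>_def P_def)
      moreover have "rot r x \<in> conflicts Sat P"
        using rot_CW[OF x] img T \<open>card P = card T\<close> by (simp add: conflicts_def)
      ultimately have "rot r x \<in> S0" unfolding S0_def by blast
      then show ?thesis using x r by (auto simp: A2_def)
    qed
  qed
  then have "card CW \<le> card (A1 \<union> A2 \<union> A3)"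
    by (intro card_mono) (auto simp: A1_def A2_def A3_def finite_CW)
  also have "\<dots> \<le> card A1 + card A2 + card A3"
    by (meson card_Un_le add_le_mono1 order_trans)
  finally have le: "M l \<le> real (card A1) + real (card A2) + real (card A3)"
    unfolding card_CW[symmetric] of_nat_add[symmetric] by (rule of_nat_mono)
  have C0: "real (card C0) \<le> l * (\<alpha> * M l)"
  proof -
    have "card C0 \<le> (\<Sum>j\<in>{1..l}. card {x \<in> CW. pr (x 0) = pr (x j)})"
      unfolding C0_def by (rule card_UN_le) simp
    then have "real (card C0) \<le> (\<Sum>j\<in>{1..l}. real (card {x \<in> CW. pr (x 0) = pr (x j)}))"
      unfolding of_nat_sum[symmetric] by (rule of_nat_mono)
    also have "\<dots> \<le> (\<Sum>j\<in>{1..l}. \<alpha> * M l)"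
      by (rule sum_mono, rule order_trans[OF card_collision_le col]) (use \<theta> in auto)
    finally show ?thesis by simp
  qed
  have "card A1 \<le> 2 * l * card C0" unfolding A1_def by (rule card_rot_le) (auto simp: C0_def)
  then have "real (card A1) \<le> real (2 * l * card C0)" by (rule of_nat_mono)
  also have "\<dots> = 2 * l * real (card C0)" by simp
  also have "\<dots> \<le> 2 * l * (l * (\<alpha> * M l))" by (intro mult_left_mono C0) auto
  finally have A1: "real (card A1) \<le> (2 * l * (l * \<alpha>)) * M l" by (simp add: mult.assoc)
  have S0: "real (card S0) \<le> 2 ^ (2 * l) * (\<beta> * M l)"
  proof -
    have "card S0 \<le> (\<Sum>P\<in>\<P>. card (conflicts Sat P))"
      unfolding S0_def by (rule card_UN_le[OF fin\<P>])
    then have "real (card S0) \<le> (\<Sum>P\<in>\<P>. real (card (conflicts Sat P)))"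
      unfolding of_nat_sum[symmetric] by (rule of_nat_mono)
    also have "\<dots> \<le> (\<Sum>P\<in>\<P>. \<beta> * M l)" by (rule sum_mono, rule conf) (auto simp: \<P>_def)
    also have "\<dots> = card \<P> * (\<beta> * M l)" by simp
    also have "\<dots> \<le> real (2 ^ (2 * l)) * (\<beta> * M l)"
      using card\<P> \<beta> M_nn by (intro mult_right_mono of_nat_mono) auto
    finally show ?thesis by simp
  qed
  have "card A2 \<le> 2 * l * card S0" unfolding A2_def by (rule card_rot_le) (auto simp: S0_def conflicts_def)
  then have "real (card A2) \<le> real (2 * l * card S0)" by (rule of_nat_mono)
  also have "\<dots> = 2 * l * real (card S0)" by simp
  also have "\<dots> \<le> 2 * l * (2 ^ (2 * l) * (\<beta> * M l))" by (intro mult_left_mono S0) auto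
  finally have A2: "real (card A2) \<le> (2 * l * (2 ^ (2 * l) * \<beta>)) * M l" by (simp add: mult.assoc)
  \<comment> \<open>A walk is determined by its \<open>2 * l\<close> arcs, and a member of
    \<open>HH\<close> has at most \<open>4 * l\<close> lifted arcs to choose from at each
    position.\<close>
  have A3: "real (card A3) \<le> \<gamma> * M l"
  proof -
    have inj: "inj_on (trace {..<2 * l}) A3"
    proof (rule inj_onI)
      fix x y assume xy: "x \<in> A3" "y \<in> A3" "trace {..<2 * l} x = trace {..<2 * l} y"
      have *: "x j = y j" if "j < 2 * l" for j
        using fun_cong[OF xy(3), of j] that by (simp add: trace_def)
      show "x = y"
      proof
        fix j
        consider "j < 2 * l" | "j = 2 * l" | "j > 2 * l" by linarith
        then show "x j = y j"
        proof cases
          case 2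
          then show ?thesis using xy(1,2) *[of 0] l_ge by (simp add: A3_def CW_def)
        next
          case 3
          then show ?thesis using xy(1,2) by (simp add: A3_def CW_def PiE_iff extensional_def)
        qed (rule *)
      qed
    qed
    have sub: "trace {..<2 * l} ` A3 \<subseteq> (\<Union>D\<in>HH. {..<2 * l} \<rightarrow>\<^sub>E arcs D)"
    proof
      fix c assume "c \<in> trace {..<2 * l} ` A3"
      then obtain x where x: "x \<in> CW" "ed x ` {..<2 * l} \<in> HH" "c = trace {..<2 * l} x" by (auto simp: A3_def)
      have "c \<in> {..<2 * l} \<rightarrow>\<^sub>E arcs (ed x ` {..<2 * l})" unfolding x(3) by (rule trace_arcs[OF x(1)]) auto
      with x(2) show "c \<in> (\<Union>D\<in>HH. {..<2 * l} \<rightarrow>\<^sub>E arcs D)" by blast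
    qed
    have "card A3 = card (trace {..<2 * l} ` A3)" by (rule card_image[OF inj, symmetric])
    also have "\<dots> \<le> card (\<Union>D\<in>HH. {..<2 * l} \<rightarrow>\<^sub>E arcs D)"
      by (rule card_mono[OF _ sub]) (use finHH finite_arcs in \<open>auto intro!: finite_PiE\<close>)
    also have "\<dots> \<le> (\<Sum>D\<in>HH. card ({..<2 * l} \<rightarrow>\<^sub>E arcs D))" by (rule card_UN_le[OF finHH])
    also have "\<dots> \<le> (\<Sum>D\<in>HH. (4 * l) ^ (2 * l))"
    proof (rule sum_mono)
      fix D assume D: "D \<in> HH"
      then have "finite D" using HH l_ge by (intro card_ge_0_finite) simp
      then have "card (arcs D) \<le> 4 * l" using card_arcs_le[of D] HH[OF D] by simp
      then have "card (arcs D) ^ (2 * l) \<le> (4 * l) ^ (2 * l)" by (intro power_mono) auto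
      then show "card ({..<2 * l} \<rightarrow>\<^sub>E arcs D) \<le> (4 * l) ^ (2 * l)" by (simp add: card_PiE)
    qed
    finally have "real (card A3) \<le> real (card HH * (4 * l) ^ (2 * l))" by (intro of_nat_mono) simp
    then show ?thesis using HH_le by simp
  qed
  have "M l \<le> (2 * l * (l * \<alpha>) + 2 * l * (2 ^ (2 * l) * \<beta>) + \<gamma>) * M l"
    using le A1 A2 A3 by (simp add: distrib_right)
  moreover have "\<dots> < 1 * M l" by (intro mult_strict_right_mono small M_pos)
  ultimately show False by simp
qed

end

text \<open>The ratios of consecutive values of \<open>M\<close> increase, so over the last steps their geometric mean
  is at least the one over all steps from \<open>1\<close> to \<open>l\<close>.\<close>

lemma (in walk_kernel) M_decay:
  assumes q: "q > 0" and base: "M 1 * q ^ (l - 1) \<le> M l" and j: "1 \<le> j" "j \<le> l" and l: "l \<ge> 2"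
  shows "M j * q ^ (l - j) \<le> M l"
proof -
  have "(M j * q ^ (l - j)) ^ (l - 1) = M j ^ (l - 1) * (q ^ (l - 1)) ^ (l - j)"
    by (simp add: power_mult_distrib power_mult[symmetric] mult.commute)
  also have "\<dots> \<le> M 1 ^ (l - j) * M l ^ (j - 1) * (q ^ (l - 1)) ^ (l - j)"
    using q by (intro mult_right_mono M_interpolate j) auto
  also have "\<dots> = (M 1 * q ^ (l - 1)) ^ (l - j) * M l ^ (j - 1)" by (simp add: power_mult_distrib)
  also have "\<dots> \<le> M l ^ (l - j) * M l ^ (j - 1)"
    using base q M_nn by (intro mult_right_mono power_mono) auto
  also have "\<dots> = M l ^ (l - 1)" using j by (simp add: power_add[symmetric])
  finally show ?thesis using l q M_nn by (subst (asm) power_mono_iff) auto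
qed

lemma base_le_of_power_le:
  fixes s d n :: real
  assumes "n \<ge> 1" "s \<ge> 0" "d \<ge> 0" "m > 0" "n * s ^ m \<le> d ^ m"
  shows "s \<le> d"
proof -
  have "s ^ m \<le> n * s ^ m" using mult_right_mono[of 1 n "s ^ m"] assms by simp
  then have "s ^ m \<le> d ^ m" using assms by linarith
  then show ?thesis using assms by (subst (asm) power_mono_iff) auto
qed

text \<open>Chosen so that \<open>2 * decay_const l * d ^ (2 * l)\<close> equals
  \<open>(d / 8) ^ (2 * l)\<close>: the 2 comes from the upper bound on \<open>M 1\<close>, the 8
  from the minimum degree \<open>d / 8\<close> in the lower bound on \<open>M l\<close>.\<close>

definition decay_const :: "nat \<Rightarrow> real" where
  "decay_const l = (1 / 8) ^ (2 * l) / 2"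

definition trace_const :: "nat \<Rightarrow> nat" where
  "trace_const l = 2 * l * (4 * l) ^ (2 * l)"

text \<open>The first summand serves the sets for which the decay of \<open>M\<close> is used, the
  second the sets of \<open>2 * l - 1\<close> edges, which are compared with
  \<open>d ^ (2 * l) \<le> 8 ^ (2 * l) * M l\<close>. The 12 comes from
  \<open>2 * (2 * d) * (3 * n)\<close> in the latter case and exceeds the constants 4 and 8 of the
  others.\<close>

definition conflict_const :: "nat \<Rightarrow> real" where
  "conflict_const l = 12 * trace_const l * ((1 / decay_const l) ^ l + 8 ^ (2 * l))"

text \<open>With this value the bounds for conflicts and for walks along members of
  \<open>HH\<close> add up to a quarter of all closed walks.\<close>

definition eps :: "nat \<Rightarrow> real" where
  "eps l = 1 / (4 * (2 * l * 2 ^ (2 * l) * conflict_const l + (4 * l) ^ (2 * l) * 8 ^ (2 * l)))"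

text \<open>Keeps collisions, over all distances and rotations, to a quarter of all closed walks;
  512 is 2 * 16 * 16, with the two factors 16 belonging to \<open>\<Lambda>\<close> and to the share
  \<open>1 / (16 * l ^ 2)\<close>.\<close>

definition spread_min :: "nat \<Rightarrow> real" where
  "spread_min l = 512 * l ^ 4 / decay_const l"

lemma decay_const: "decay_const l > 0" "decay_const l \<le> 1"
proof -
  have "(1 / 8 :: real) ^ (2 * l) \<le> 1" by (rule power_le_one) auto
  then show "decay_const l \<le> 1" by (simp add: decay_const_def)
qed (simp add: decay_const_def)

lemma conflict_const_nn: "conflict_const l \<ge> 0"
  using decay_const(1)[of l] by (simp add: conflict_const_def)

lemma eps_pos: "l \<ge> 2 \<Longrightarrow> eps l > 0"
  unfolding eps_def using conflict_const_nn[of l]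
  by (auto intro!: divide_pos_pos mult_pos_pos add_nonneg_pos)

lemma trace_const_ge:
  assumes "t \<le> 2 * l"
  shows "t * (2 * t) ^ t \<le> trace_const l"
proof (cases "t = 0")
  case False
  have "(2 * t) ^ t \<le> (4 * l) ^ t" using assms by (intro power_mono) auto
  also have "\<dots> \<le> (4 * l) ^ (2 * l)" using assms False by (intro power_increasing) auto
  finally show ?thesis unfolding trace_const_def using assms by (intro mult_mono) auto
qed simp

context cover begin

text \<open>Assumption \<open>A\<close> makes \<open>M l\<close> dominate the shorter closed walks, while \<open>B\<close> handles saturated sets
  of \<open>2l - 1\<close> edges, for which no closed walk remains to compare with.\<close>

lemma conflict_free_walk:
  fixes s d n :: real
  assumes n: "n \<ge> 1" and s: "s \<ge> 1" "spread_min l \<le> s"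
    and A: "n * s ^ (l - 1) \<le> d ^ l" and B: "n * s ^ (2 * l - 1) \<le> d ^ (2 * l - 1)" and d: "d \<ge> 1"
    and \<Delta>: "0 < \<Delta>" "\<Delta> \<le> 2 * d" and min: "\<And>u. u \<in> U \<Longrightarrow> card {v. R u v} \<ge> d / 8"
    and cU: "card U \<le> 3 * n" and arcs: "(\<Sum>u\<in>U. card {v. R u v}) \<le> 2 * (n * d)"
    and finSat: "finite Sat" and finHH: "finite HH"
    and \<sigma>: "\<And>f t. 2 \<le> t \<Longrightarrow> t \<le> 2 * l - 1 \<Longrightarrow> card {T \<in> Sat. f \<in> T \<and> card T = t} \<le> eps l * s ^ (t - 1)"
    and HH: "\<And>D. D \<in> HH \<Longrightarrow> card D = 2 * l" and HH_le: "card HH \<le> eps l * d ^ (2 * l)"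
  shows "\<exists>x\<in>CW. inj_on (\<lambda>i. pr (x i)) {..<2 * l} \<and> ed x ` {..<2 * l} \<notin> HH \<and>
    (\<forall>T\<in>Sat. T \<subseteq> ed x ` {..<2 * l} \<longrightarrow> \<not> (2 \<le> card T \<and> card T \<le> 2 * l - 1))"
proof -
  define \<kappa> where "\<kappa> = decay_const l"
  define c where "c = real (trace_const l)"
  have \<kappa>: "\<kappa> > 0" "\<kappa> \<le> 1" using decay_const by (auto simp: \<kappa>_def)
  have \<epsilon>: "eps l > 0" using l_ge by (rule eps_pos)
  have c: "c \<ge> 0" by (simp add: c_def)
  have sd: "s \<le> d" by (rule base_le_of_power_le[OF n _ _ _ B]) (use s d l_ge in auto)
  have Ml: "M l \<ge> (d / 8) ^ (2 * l)" by (rule M_ge) (use d min in \<open>auto simp: sum_R\<close>)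
  then have Ml': "d ^ (2 * l) \<le> 8 ^ (2 * l) * M l" by (simp add: power_divide field_simps)
  define q where "q = \<kappa> * d * s"
  have q: "q > 0" using \<kappa> d s by (simp add: q_def)
  have M1: "M 1 * q ^ (l - 1) \<le> M l"
  proof -
    have "M 1 \<le> (\<Sum>u\<in>U. real (card {v. R u v}))" using M_1_le by (simp add: sum_R)
    then have M1: "M 1 \<le> 2 * (n * d)" using arcs by simp
    \<comment> \<open>One factor \<open>\<kappa>\<close> is enough to compensate the constants in
      \<open>M 1\<close> and \<open>M l\<close>.\<close>
    have "\<kappa> ^ (l - 1) \<le> \<kappa> ^ 1" using \<kappa> l_ge by (intro power_decreasing) auto
    then have "q ^ (l - 1) \<le> \<kappa> * (d ^ (l - 1) * s ^ (l - 1))"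
      unfolding q_def power_mult_distrib mult.assoc using d s by (intro mult_right_mono) auto
    then have "M 1 * q ^ (l - 1) \<le> 2 * (n * d) * (\<kappa> * (d ^ (l - 1) * s ^ (l - 1)))"
      using M1 n d q by (intro mult_mono) auto
    also have "\<dots> = 2 * \<kappa> * (d * d ^ (l - 1)) * (n * s ^ (l - 1))" by simp
    also have "d * d ^ (l - 1) = d ^ l" using l_ge by (simp add: power_eq_if)
    also have "2 * \<kappa> * d ^ l * (n * s ^ (l - 1)) \<le> 2 * \<kappa> * d ^ l * d ^ l"
      using A \<kappa> d by (intro mult_left_mono) auto
    also have "\<dots> = (d / 8) ^ (2 * l)"
      by (simp add: \<kappa>_def decay_const_def power_divide mult_2 power_add)
    finally show ?thesis using Ml by linarith
  qed
  have decay: "M j \<le> M l / q ^ (l - j)" if "1 \<le> j" "j \<le> l" for j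
    using M_decay[OF q M1 that l_ge] q by (simp add: field_simps)
  have qh: "(1 / \<kappa>) ^ h \<le> (1 / \<kappa>) ^ l" if "h \<le> l" for h
    using that \<kappa> by (intro power_increasing) auto
  \<comment> \<open>With \<open>\<theta> = \<Delta> * \<Lambda>\<close> the second term of the
    collision bound is exactly \<open>M l / (16 * l ^ 2)\<close>; the first is then made no larger
    by the lower bound on \<open>s\<close>.\<close>
  define \<Lambda> where "\<Lambda> = 16 * real l ^ 2"
  have \<Lambda>: "\<Lambda> > 0" using l_ge by (simp add: \<Lambda>_def)
  define \<alpha> where "\<alpha> = 1 / (8 * real l ^ 2)"
  define \<beta> where "\<beta> = eps l * conflict_const l"
  define \<gamma> where "\<gamma> = eps l * ((4 * l) ^ (2 * l) * 8 ^ (2 * l))"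
  show ?thesis
  proof (rule good_walk[where \<theta> = "\<Delta> * \<Lambda>" and Sat = Sat and HH = HH and \<alpha> = \<alpha> and \<beta> = \<beta> and \<gamma> = \<gamma>])
    show "\<Delta> * \<Lambda> > 0" using \<Delta> \<Lambda> by simp
    show "\<Delta> * \<Lambda> * M (l - 1) + \<Delta> / (\<Delta> * \<Lambda>) * M l \<le> \<alpha> * M l"
    proof -
      have "M (l - 1) \<le> M l / q" using decay[of "l - 1"] l_ge by simp
      then have "\<Delta> * \<Lambda> * M (l - 1) \<le> (2 * d) * \<Lambda> * (M l / q)"
        using \<Delta> \<Lambda> M_nn d by (intro mult_mono) auto
      also have "\<dots> = 2 * \<Lambda> / (\<kappa> * s) * M l" using d by (simp add: q_def)
      also have "\<dots> \<le> (1 / (16 * real l ^ 2)) * M l"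
      proof (rule mult_right_mono[OF _ M_nn])
        have "512 * real l ^ 4 \<le> \<kappa> * s" using s \<kappa> by (simp add: spread_min_def \<kappa>_def field_simps)
        then have "2 * \<Lambda> * (16 * real l ^ 2) \<le> \<kappa> * s" by (simp add: \<Lambda>_def power2_eq_square power4_eq_xxxx)
        then show "2 * \<Lambda> / (\<kappa> * s) \<le> 1 / (16 * real l ^ 2)" using \<kappa> s l_ge by (simp add: field_simps)
      qed
      finally have 1: "\<Delta> * \<Lambda> * M (l - 1) \<le> (1 / (16 * real l ^ 2)) * M l" .
      have "\<Delta> / (\<Delta> * \<Lambda>) = 1 / (16 * real l ^ 2)" using \<Delta> by (simp add: \<Lambda>_def)
      then have "\<Delta> * \<Lambda> * M (l - 1) + \<Delta> / (\<Delta> * \<Lambda>) * M l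
          \<le> (1 / (16 * real l ^ 2)) * M l + (1 / (16 * real l ^ 2)) * M l" using 1 by simp
      also have "\<dots> = \<alpha> * M l" by (simp add: \<alpha>_def)
      finally show ?thesis .
    qed
    show "real (card HH) * (4 * l) ^ (2 * l) \<le> \<gamma> * M l"
    proof -
      have "real (card HH) * (4 * l) ^ (2 * l) \<le> eps l * (8 ^ (2 * l) * M l) * (4 * l) ^ (2 * l)"
        using HH_le Ml' \<epsilon> by (intro mult_right_mono) (auto intro: order_trans mult_left_mono)
      then show ?thesis by (simp add: \<gamma>_def ac_simps)
    qed
    show "2 * l * (l * \<alpha>) + 2 * l * (2 ^ (2 * l) * \<beta>) + \<gamma> < 1"
    proof -
      have 1: "2 * l * (l * \<alpha>) = 1 / 4" using l_ge by (simp add: \<alpha>_def power2_eq_square)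
      define Z where "Z = 2 * l * 2 ^ (2 * l) * conflict_const l + (4 * l) ^ (2 * l) * 8 ^ (2 * l)"
      have "Z > 0" unfolding Z_def using l_ge conflict_const_nn[of l]
        by (auto intro!: add_nonneg_pos)
      moreover have "2 * l * (2 ^ (2 * l) * \<beta>) + \<gamma> = eps l * Z"
        by (simp add: \<beta>_def \<gamma>_def Z_def algebra_simps)
      moreover have "eps l = 1 / (4 * Z)" by (simp add: eps_def Z_def)
      ultimately have "2 * l * (2 ^ (2 * l) * \<beta>) + \<gamma> = 1 / 4" by simp
      then show ?thesis using 1 by linarith
    qed
    show "\<beta> \<ge> 0" using \<epsilon> conflict_const_nn[of l] by (simp add: \<beta>_def)
  next
    fix P :: "nat set"
    assume P: "P \<subseteq> {..<2 * l}" "0 \<in> P" "2 \<le> card P" "card P \<le> 2 * l - 1"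
    define t where "t = card P"
    define N where "N = real (card (conflicts Sat P))"
    have t: "2 \<le> t" "t \<le> 2 * l - 1" using P by (auto simp: t_def)
    have \<sigma>t: "card {T \<in> Sat. f \<in> T \<and> card T = t} \<le> eps l * s ^ (t - 1)" for f using \<sigma> t by simp
    note conf = card_conflict_le_M[OF P(1,2) t_def finSat \<sigma>t, folded N_def]
    have tt: "real t * real ((2 * t) ^ t) \<le> c"
      using trace_const_ge[of t l] t unfolding c_def of_nat_mult[symmetric] by (intro of_nat_mono) auto
    have Kl: "12 * c * (1 / \<kappa>) ^ l \<le> conflict_const l" "12 * c * 8 ^ (2 * l) \<le> conflict_const l"
      using \<kappa> c by (auto simp: conflict_const_def \<kappa>_def c_def algebra_simps)
    have final: "12 * c * eps l * x * M l \<le> \<beta> * M l" if "12 * c * x \<le> conflict_const l" for x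
      using mult_right_mono[OF mult_left_mono[OF that, of "eps l"] M_nn[of l]] \<epsilon>
      by (simp add: \<beta>_def ac_simps)
    \<comment> \<open>Of the \<open>2 * h - 1\<close> factors \<open>s\<close>, \<open>h\<close>
      cancel against \<open>q ^ h\<close> and the other \<open>h - 1\<close> are replaced by
      \<open>d\<close>, which is where \<open>s \<le> d\<close> enters.\<close>
    have ratio: "s ^ (2 * h - 1) * d / q ^ h \<le> (1 / \<kappa>) ^ l" if h: "1 \<le> h" "h \<le> l" for h
    proof -
      have "s ^ h * s ^ (h - 1) = s ^ (2 * h - 1)" using h by (simp add: power_add[symmetric] mult_2)
      moreover have "s ^ (h - 1) \<le> d ^ (h - 1)" using s sd by (intro power_mono) auto
      ultimately have "s ^ (2 * h - 1) * d \<le> s ^ h * (d ^ (h - 1) * d)"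
        using s d by (metis (no_types, lifting) mult.assoc mult_left_mono mult_right_mono order_trans zero_le_one zero_le_power)
      also have "d ^ (h - 1) * d = d ^ h" using h by (simp add: power_eq_if mult.commute)
      finally have "s ^ (2 * h - 1) * d / q ^ h \<le> s ^ h * d ^ h / q ^ h"
        using q by (intro divide_right_mono) auto
      also have "\<dots> = (1 / \<kappa>) ^ h" using s d by (simp add: q_def power_mult_distrib power_divide)
      also have "\<dots> \<le> (1 / \<kappa>) ^ l" by (rule qh[OF h(2)])
      finally show ?thesis .
    qed
    consider "t = 2 * l - 1" | "even t" | "odd t" "t < 2 * l - 1" using t by linarith
    then have "N \<le> \<beta> * M l"
    proof cases
      \<comment> \<open>\<open>M 0\<close> is just \<open>card U\<close>, so there is no decay to
        exploit; assumption \<open>B\<close> takes over, with one factor \<open>s\<close> to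
        spare.\<close>
      case 1
      have "N \<le> real t * real ((2 * t) ^ t) * (eps l * s ^ (t - 1)) * (2 * \<Delta> * M 0)" by (rule conf(3)[OF 1])
      also have "\<dots> \<le> c * (eps l * s ^ (t - 1)) * (2 * (2 * d) * (3 * n))"
        using tt \<Delta> cU \<epsilon> s d c n by (intro mult_mono) (auto simp: M_def sum_nonneg)
      also have "\<dots> = 12 * c * eps l * (d * (n * s ^ (2 * l - 2)))" using 1 by (simp add: diff_diff_left numeral_2_eq_2)
      also have "\<dots> \<le> 12 * c * eps l * (d * (n * s ^ (2 * l - 1)))"
        using c \<epsilon> d n s by (intro mult_left_mono power_increasing) auto
      also have "\<dots> \<le> 12 * c * eps l * (d * d ^ (2 * l - 1))"
        using c \<epsilon> d by (intro mult_left_mono B) auto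
      also have "d * d ^ (2 * l - 1) = d ^ (2 * l)" using l_ge by (simp add: power_eq_if)
      also have "12 * c * eps l * d ^ (2 * l) \<le> 12 * c * eps l * (8 ^ (2 * l) * M l)"
        using c \<epsilon> by (intro mult_left_mono Ml') auto
      finally show ?thesis using final[OF Kl(2)] by simp
    next
      case 2
      then obtain h where h: "t = 2 * h" by (elim evenE)
      have h': "1 \<le> h" "h \<le> l" "h < l" using h t by auto
      have H: "t = 2 * l - 2 * (l - h)" "1 \<le> l - h" "l - h < l" using h h' by auto
      have "N \<le> real t * real ((2 * t) ^ t) * (eps l * s ^ (t - 1)) * (2 * \<Delta> * M (l - h))" by (rule conf(1)[OF H])
      also have "\<dots> \<le> c * (eps l * s ^ (t - 1)) * (2 * (2 * d) * (M l / q ^ h))"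
        using tt \<Delta> decay[of "l - h"] H h' \<epsilon> s d c M_nn by (intro mult_mono) (auto simp: sum_nonneg)
      also have "\<dots> = 4 * c * eps l * (s ^ (2 * h - 1) * d / q ^ h) * M l" using h by simp
      also have "\<dots> \<le> 12 * c * eps l * (1 / \<kappa>) ^ l * M l"
        using c \<epsilon> M_nn q s d by (intro mult_right_mono mult_mono ratio h') auto
      finally show ?thesis using final[OF Kl(1)] by simp
    next
      case 3
      then obtain h0 where h0: "t = 2 * h0 + 1" by (elim oddE)
      define h where "h = Suc h0"
      have h: "t = 2 * h - 1" "2 \<le> h" "h < l" "h \<le> l" "1 \<le> h" using h0 t 3 by (auto simp: h_def)
      have H: "t = 2 * l - 2 * (l - h) - 1" "1 \<le> l - h" "l - h < l" using h by auto
      have "N \<le> \<Delta> * t * real ((2 * t) ^ t) * (eps l * s ^ (t - 1)) * (2 * \<Delta> * M (l - h))" by (rule conf(2)[OF H])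
      also have "\<dots> = \<Delta> * (real t * real ((2 * t) ^ t)) * (eps l * s ^ (t - 1)) * (2 * \<Delta> * M (l - h))" by simp
      also have "\<dots> \<le> (2 * d) * c * (eps l * s ^ (t - 1)) * (2 * (2 * d) * (M l / q ^ h))"
      proof -
        have a: "\<Delta> * (real t * real ((2 * t) ^ t)) \<le> (2 * d) * c"
          by (intro mult_mono \<Delta> tt) (use d in auto)
        have "M (l - h) \<le> M l / q ^ h" using decay[of "l - h"] H(2) h(4) by simp
        then have b: "2 * \<Delta> * M (l - h) \<le> 2 * (2 * d) * (M l / q ^ h)"
          by (intro mult_mono) (use \<Delta> d M_nn in auto)
        have e: "0 \<le> eps l * s ^ (t - 1)" using \<epsilon> s by simp
        show ?thesis
          by (rule mult_mono[OF mult_right_mono[OF a e] b]) (use d c e \<Delta> M_nn in \<open>auto intro!: mult_nonneg_nonneg\<close>)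
      qed
      also have "t - 1 = 2 * h - 2" using h(1) by simp
      also have "(2 * d) * c * (eps l * s ^ (2 * h - 2)) * (2 * (2 * d) * (M l / q ^ h))
          = 8 * c * eps l * (d * s ^ (2 * h - 2) * d / q ^ h) * M l" by simp
      also have "\<dots> \<le> 12 * c * eps l * (1 / \<kappa>) ^ l * M l"
      proof (intro mult_right_mono mult_mono)
        \<comment> \<open>Compared with the even case, the extra \<open>\<Delta>\<close> takes the
          place of one factor \<open>s\<close>. Two factors \<open>d\<close> fit into
          \<open>d ^ h\<close> because \<open>h \<ge> 2\<close>.\<close>
        have "d * s ^ (2 * h - 2) * d = s ^ h * (d ^ 2 * s ^ (h - 2))"
          using h by (simp add: power2_eq_square power_add[symmetric] mult_2)
        also have "\<dots> \<le> s ^ h * (d ^ 2 * d ^ (h - 2))"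
          using s sd by (intro mult_left_mono power_mono) auto
        also have "d ^ 2 * d ^ (h - 2) = d ^ h" using h(2) by (metis power_add le_add_diff_inverse)
        finally have "d * s ^ (2 * h - 2) * d / q ^ h \<le> s ^ h * d ^ h / q ^ h"
          using q by (intro divide_right_mono) auto
        also have "\<dots> = (1 / \<kappa>) ^ h" using s d by (simp add: q_def power_mult_distrib power_divide)
        also have "\<dots> \<le> (1 / \<kappa>) ^ l" by (rule qh[OF h(4)])
        finally show "d * s ^ (2 * h - 2) * d / q ^ h \<le> (1 / \<kappa>) ^ l" .
      qed (use c \<epsilon> M_nn q s d in auto)
      finally show ?thesis using final[OF Kl(1)] by simp
    qed
    then show "real (card (conflicts Sat P)) \<le> \<beta> * M l"
      by (simp add: N_def)
  qed (use finHH HH in auto)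
qed

end

section \<open>Splitting vertices\<close>

text \<open>Maximise the degree sum minus \<open>2 * \<delta>\<close> per vertex over all subsets.
  The maximum is positive, and a vertex of degree below \<open>\<delta>\<close> could be deleted
  with profit.\<close>

lemma dense_core:
  fixes X :: "'v set" and \<delta> :: real
  assumes fin: "finite X" and sym: "\<And>x y. r x y \<Longrightarrow> r y x"
    and dense: "(\<Sum>x\<in>X. real (card {y\<in>X. r x y})) > 2 * \<delta> * card X"
  shows "\<exists>U\<subseteq>X. U \<noteq> {} \<and> (\<forall>u\<in>U. card {v\<in>U. r u v} \<ge> \<delta>)"
proof -
  define a where "a x y = (of_bool (r x y) :: real)" for x y
  define \<phi> where "\<phi> Y = (\<Sum>x\<in>Y. \<Sum>y\<in>Y. a x y) - 2 * \<delta> * card Y" for Y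
  have deg: "(\<Sum>y\<in>Y. a x y) = card {y\<in>Y. r x y}" if "finite Y" for x Y
  proof -
    have "(\<Sum>y\<in>Y. a x y) = (\<Sum>y\<in>{y\<in>Y. r x y}. 1)"
      by (rule sum.mono_neutral_cong_right) (use that in \<open>auto simp: a_def\<close>)
    then show ?thesis by simp
  qed
  obtain U where U: "U \<subseteq> X" and max: "\<And>Y. Y \<subseteq> X \<Longrightarrow> \<phi> Y \<le> \<phi> U"
  proof -
    have "finite (\<phi> ` Pow X)" "\<phi> ` Pow X \<noteq> {}" using fin by auto
    from Max_in[OF this] obtain U where "U \<subseteq> X" "\<phi> U = Max (\<phi> ` Pow X)" by auto
    moreover have "\<phi> Y \<le> Max (\<phi> ` Pow X)" if "Y \<subseteq> X" for Y using that fin by (intro Max_ge) auto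
    ultimately show thesis using that by metis
  qed
  have finU: "finite U" using U fin finite_subset by auto
  have "\<phi> X > 0" using dense by (simp add: \<phi>_def deg[OF fin])
  then have "\<phi> U > 0" using max[of X] by simp
  then have "U \<noteq> {}" by (auto simp: \<phi>_def)
  moreover have "card {v\<in>U. r u v} \<ge> \<delta>" if u: "u \<in> U" for u
  proof -
    let ?W = "U - {u}"
    have "(\<Sum>x\<in>U. \<Sum>y\<in>U. a x y) = (\<Sum>y\<in>U. a u y) + (\<Sum>x\<in>?W. a x u + (\<Sum>y\<in>?W. a x y))"
      using finU u by (simp add: sum.remove[of U u])
    also have "\<dots> = (\<Sum>y\<in>U. a u y) + (\<Sum>x\<in>?W. a x u) + (\<Sum>x\<in>?W. \<Sum>y\<in>?W. a x y)"
      by (simp add: sum.distrib)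
    also have "(\<Sum>x\<in>?W. a x u) \<le> (\<Sum>x\<in>U. a u x)"
    proof -
      have "a x u = a u x" for x using sym by (auto simp: a_def)
      moreover have "(\<Sum>x\<in>?W. a u x) \<le> (\<Sum>x\<in>U. a u x)"
        by (rule sum_mono2) (use finU in \<open>auto simp: a_def\<close>)
      ultimately show ?thesis by simp
    qed
    finally have "(\<Sum>x\<in>U. \<Sum>y\<in>U. a x y) \<le> 2 * (\<Sum>y\<in>U. a u y) + (\<Sum>x\<in>?W. \<Sum>y\<in>?W. a x y)" by simp
    moreover have "\<phi> ?W \<le> \<phi> U" by (rule max) (use U in auto)
    moreover have "real (card ?W) = real (card U) - 1"
      using finU u by (metis card_Diff_singleton card_gt_0_iff empty_iff of_nat_diff of_nat_1 Suc_leI One_nat_def)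
    ultimately have "2 * \<delta> \<le> 2 * (\<Sum>y\<in>U. a u y)" by (simp add: \<phi>_def algebra_simps)
    then show ?thesis by (simp add: deg[OF finU])
  qed
  ultimately show ?thesis using U by blast
qed

lemma card_arc_pairs:
  assumes fin: "finite E" and two: "\<And>e. e \<in> E \<Longrightarrow> card e = 2"
  shows "finite {(u, v). {u, v} \<in> E}" "card {(u, v). {u, v} \<in> E} = 2 * card E"
proof -
  have eq: "{(u, v). {u, v} \<in> E} = (\<Union>e\<in>E. {(u, v). {u, v} = e})" by auto
  have one: "finite {(u, v). {u, v} = e} \<and> card {(u, v). {u, v} = e} = 2" if e: "e \<in> E" for e
  proof -
    obtain a b where ab: "e = {a, b}" "a \<noteq> b" using two[OF e] by (auto simp: card_2_iff)
    then have "{(u, v). {u, v} = e} = {(a, b), (b, a)}" by (auto simp: doubleton_eq_iff)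
    then show ?thesis using ab by simp
  qed
  show "finite {(u, v). {u, v} \<in> E}" unfolding eq using fin one by blast
  have "card (\<Union>e\<in>E. {(u, v). {u, v} = e}) = (\<Sum>e\<in>E. card {(u, v). {u, v} = e})"
    by (rule card_UN_disjoint) (use fin one in auto)
  also have "\<dots> = 2 * card E" using one by simp
  finally show "card {(u, v). {u, v} \<in> E} = 2 * card E" unfolding eq .
qed

text \<open>Each vertex \<open>u\<close> is replaced by copies \<open>(u, i)\<close>, and its edges are distributed among the
  copies in blocks of size \<open>D\<close>.\<close>

lemma split_graph:
  fixes V :: "'a set"
  assumes finV: "finite V" and simple: "\<forall>e\<in>E. e \<subseteq> V \<and> card e = 2" and D: "D \<ge> 1"
  obtains X and R :: "'a \<times> nat \<Rightarrow> 'a \<times> nat \<Rightarrow> bool"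
  where "finite X" "card X \<le> card V + 2 * card E / D" "symp R"
    "\<forall>x y. R x y \<longrightarrow> x \<in> X \<and> {fst x, fst y} \<in> E \<and> fst x \<noteq> fst y" "\<forall>x. card {y. R x y} \<le> D"
    "\<forall>x y x' y'. R x y \<longrightarrow> R x' y' \<longrightarrow> {fst x, fst y} = {fst x', fst y'} \<longrightarrow>
      x = x' \<and> y = y' \<or> x = y' \<and> y = x'"
    "(\<Sum>x\<in>X. card {y\<in>X. R x y}) = 2 * card E"
proof -
  have E: "e \<subseteq> V \<and> card e = 2" if "e \<in> E" for e using simple that by blast
  define N where "N u = {v. {u, v} \<in> E}" for u
  have finE: "finite E" by (rule finite_subset[of _ "Pow V"]) (use E finV in auto)
  have finN: "finite (N u)" for u by (rule finite_subset[OF _ finV]) (use E in \<open>auto simp: N_def\<close>)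
  have "\<exists>f. bij_betw f (N u) {0..<card (N u)}" for u by (rule ex_bij_betw_finite_nat[OF finN])
  then obtain idx where idx: "\<And>u. bij_betw (idx u) (N u) {0..<card (N u)}" by metis
  \<comment> \<open>The edge \<open>{u, v}\<close> gets a single lift: from the copy of
    \<open>u\<close> whose block contains \<open>v\<close> to the copy of \<open>v\<close> whose
    block contains \<open>u\<close>.\<close>
  define slot where "slot u v = idx u v div D" for u v
  define X where "X = (SIGMA u:V. {..card (N u) div D})"
  define R where "R x y \<longleftrightarrow> {fst x, fst y} \<in> E \<and> snd x = slot (fst x) (fst y) \<and> snd y = slot (fst y) (fst x)" for x y
  have neq: "u \<noteq> v" if "{u, v} \<in> E" for u v using E[OF that] by auto
  have slot_le: "slot u v \<le> card (N u) div D" if "v \<in> N u" for u v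
    unfolding slot_def using bij_betwE[OF idx, of u] that by (intro div_le_mono) auto
  have R_X: "x \<in> X" if "R x y" for x y
    using that E slot_le[of "fst y" "fst x"] by (cases x) (auto simp: R_def X_def N_def)
  have R_sym: "R x y \<Longrightarrow> R y x" for x y by (auto simp: R_def insert_commute)
  have finX: "finite X" using finV by (simp add: X_def)
  have pairs: "{(u, v). {u, v} \<in> E} = (SIGMA u:V. N u)" using E by (auto simp: N_def)
  have sumN: "(\<Sum>u\<in>V. card (N u)) = 2 * card E"
    using card_arc_pairs(2)[of E] E finE finV finN unfolding pairs by simp
  show thesis
  proof (rule that[of X R])
    show "finite X" by (rule finX)
    show "card X \<le> card V + 2 * card E / D"
    proof -
      have "real (card X) = (\<Sum>u\<in>V. real (card (N u) div D) + 1)" using finV by (simp add: X_def add.commute)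
      also have "\<dots> \<le> (\<Sum>u\<in>V. real (card (N u)) / D + 1)"
        by (intro sum_mono add_right_mono) (rule of_nat_div_le_of_nat)
      also have "\<dots> = real (\<Sum>u\<in>V. card (N u)) / D + card V"
        by (simp add: sum.distrib sum_divide_distrib)
      finally show ?thesis by (simp add: sumN)
    qed
    show "symp R" by (rule sympI) (rule R_sym)
    have "R x y \<Longrightarrow> x \<in> X \<and> {fst x, fst y} \<in> E \<and> fst x \<noteq> fst y" for x y
      using R_X[of x y] neq[of "fst x" "fst y"] by (simp add: R_def)
    then show "\<forall>x y. R x y \<longrightarrow> x \<in> X \<and> {fst x, fst y} \<in> E \<and> fst x \<noteq> fst y" by blast
    show "\<forall>x. card {y. R x y} \<le> D"
    proof
      fix x :: "'a \<times> nat"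
      obtain u i where x: "x = (u, i)" by (cases x)
      have "card {y. R x y} \<le> card {D * i..<D * i + D}"
      proof (rule card_inj_on_le[of "\<lambda>y. idx u (fst y)"])
        show "inj_on (\<lambda>y. idx u (fst y)) {y. R x y}"
        proof (rule inj_onI)
          fix y z assume yz: "y \<in> {y. R x y}" "z \<in> {y. R x y}" "idx u (fst y) = idx u (fst z)"
          then have "fst y \<in> N u" "fst z \<in> N u" by (auto simp: R_def x N_def)
          then have "fst y = fst z" using yz(3) idx[of u] by (auto simp: bij_betw_def dest: inj_onD)
          then show "y = z" using yz by (auto simp: R_def prod_eq_iff)
        qed
        show "(\<lambda>y. idx u (fst y)) ` {y. R x y} \<subseteq> {D * i..<D * i + D}"
        proof
          fix k assume "k \<in> (\<lambda>y. idx u (fst y)) ` {y. R x y}"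
          then have i: "i = k div D" by (auto simp: R_def x slot_def)
          have "D * (k div D) + k mod D = k" "k mod D < D" using D by auto
          then show "k \<in> {D * i..<D * i + D}" unfolding atLeastLessThan_iff i by linarith
        qed
      qed simp
      then show "card {y. R x y} \<le> D" by simp
    qed
    show "\<forall>x y x' y'. R x y \<longrightarrow> R x' y' \<longrightarrow> {fst x, fst y} = {fst x', fst y'} \<longrightarrow>
      x = x' \<and> y = y' \<or> x = y' \<and> y = x'"
      by (auto simp: R_def prod_eq_iff doubleton_eq_iff)
    show "(\<Sum>x\<in>X. card {y\<in>X. R x y}) = 2 * card E"
    proof -
      have RX: "y \<in> X" if "R x y" for x y by (rule R_X[OF R_sym[OF that]])
      then have eq: "{y\<in>X. R x y} = {y. R x y}" for x by blast
      have "finite {y. R x y}" for x by (rule finite_subset[OF _ finX]) (use RX in blast)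
      then have "(\<Sum>x\<in>X. card {y\<in>X. R x y}) = card (SIGMA x:X. {y. R x y})"
        unfolding eq using finX by (simp add: card_SigmaI)
      also have "\<dots> = card {(u, v). {u, v} \<in> E}"
      proof (rule bij_betw_same_card[of "\<lambda>(x, y). (fst x, fst y)"], rule bij_betw_byWitness[where f' = "\<lambda>(u, v). ((u, slot u v), (v, slot v u))"])
        show "(\<lambda>(u, v). ((u, slot u v), (v, slot v u))) ` {(u, v). {u, v} \<in> E} \<subseteq> (SIGMA x:X. {y. R x y})"
        proof
          fix z assume "z \<in> (\<lambda>(u, v). ((u, slot u v), (v, slot v u))) ` {(u, v). {u, v} \<in> E}"
          then obtain u v where z: "z = ((u, slot u v), (v, slot v u))" and "{u, v} \<in> E" by auto
          then have R: "R (u, slot u v) (v, slot v u)" by (simp add: R_def)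
          show "z \<in> (SIGMA x:X. {y. R x y})" using R R_X[OF R] by (simp add: z)
        qed
      qed (auto simp: R_def)
      also have "\<dots> = 2 * card E" by (rule card_arc_pairs(2)[OF finE]) (use E in auto)
      finally show ?thesis .
    qed
  qed
qed

definition cycle_edges :: "nat \<Rightarrow> 'a set set \<Rightarrow> bool" where
  "cycle_edges n C \<longleftrightarrow> (\<exists>f. inj_on f {..<n} \<and> C = (\<lambda>i. {f i, f (Suc i mod n)}) ` {..<n})"

text \<open>Splitting into blocks of about \<open>d\<close> edges at most triples the number of
  vertices, so the average degree stays above \<open>d / 4\<close> and there is a core of minimum
  degree \<open>d / 8\<close>. Saturated sets that leave \<open>E\<close> are discarded, which is
  why the bound on them is asked only for \<open>f \<in> E\<close>.\<close>

lemma conflict_free_cycle: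
  fixes V :: "'a set" and d s :: real
  assumes l: "l \<ge> 2" and finV: "finite V" "V \<noteq> {}" and E: "\<And>e. e \<in> E \<Longrightarrow> e \<subseteq> V \<and> card e = 2"
    and E_lo: "card V * d / 2 \<le> card E" and E_hi: "card E \<le> card V * d"
    and s: "s \<ge> 1" "spread_min l \<le> s"
    and A: "card V * s ^ (l - 1) \<le> d ^ l" and B: "card V * s ^ (2 * l - 1) \<le> d ^ (2 * l - 1)"
    and d: "d \<ge> 1" and finSat: "finite Sat" and finHH: "finite HH"
    and \<sigma>: "\<And>f t. f \<in> E \<Longrightarrow> 2 \<le> t \<Longrightarrow> t \<le> 2 * l - 1 \<Longrightarrow> card {T \<in> Sat. f \<in> T \<and> card T = t} \<le> eps l * s ^ (t - 1)"
    and HH: "\<And>D. D \<in> HH \<Longrightarrow> card D = 2 * l" and HH_le: "card HH \<le> eps l * d ^ (2 * l)"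
  shows "\<exists>C. cycle_edges (2 * l) C \<and> C \<subseteq> E \<and> C \<notin> HH \<and>
    (\<forall>T\<in>Sat. T \<subseteq> C \<longrightarrow> \<not> (2 \<le> card T \<and> card T \<le> 2 * l - 1))"
proof -
  define D where "D = nat \<lceil>d\<rceil>"
  have D: "D \<ge> 1" "d \<le> D" "D \<le> 2 * d" using d by (auto simp: D_def) linarith+
  have n1: "real (card V) \<ge> 1" using finV by (simp add: card_gt_0_iff Suc_leI)
  have Eb: "\<forall>e\<in>E. e \<subseteq> V \<and> card e = 2" by (rule ballI) (rule E)
  obtain X and R :: "'a \<times> nat \<Rightarrow> 'a \<times> nat \<Rightarrow> bool"
    where X: "finite X" "card X \<le> card V + 2 * card E / D" and symp: "symp R"
    and R_X': "\<forall>x y. R x y \<longrightarrow> x \<in> X \<and> {fst x, fst y} \<in> E \<and> fst x \<noteq> fst y"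
    and R_deg: "\<forall>x. card {y. R x y} \<le> D"
    and R_inj: "\<forall>x y x' y'. R x y \<longrightarrow> R x' y' \<longrightarrow> {fst x, fst y} = {fst x', fst y'} \<longrightarrow>
      x = x' \<and> y = y' \<or> x = y' \<and> y = x'"
    and R_sum: "(\<Sum>x\<in>X. card {y\<in>X. R x y}) = 2 * card E"
    by (rule split_graph[OF finV(1) Eb D(1)])
  have R_sym: "R x y \<Longrightarrow> R y x" for x y using symp by (rule sympD)
  have R_X: "R x y \<Longrightarrow> x \<in> X \<and> {fst x, fst y} \<in> E \<and> fst x \<noteq> fst y" for x y using R_X' by blast
  have cX: "card X \<le> 3 * real (card V)"
  proof -
    have "2 * card E / D \<le> 2 * (card V * d) / D" using E_hi D by (intro divide_right_mono) auto
    also have "\<dots> \<le> 2 * (card V * real D) / D" using D by (intro divide_right_mono mult_left_mono) auto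
    also have "\<dots> = 2 * real (card V)" using D by simp
    finally show ?thesis using X(2) by linarith
  qed
  have "\<exists>U\<subseteq>X. U \<noteq> {} \<and> (\<forall>u\<in>U. card {v\<in>U. R u v} \<ge> d / 8)"
  proof (rule dense_core[OF X(1) R_sym])
    have "2 * (d / 8) * card X \<le> 2 * (d / 8) * (3 * card V)" using cX d by (intro mult_left_mono) auto
    also have "\<dots> < card V * d" using n1 d by simp
    also have "\<dots> \<le> real (2 * card E)" using E_lo by simp
    also have "\<dots> = (\<Sum>x\<in>X. real (card {y\<in>X. R x y}))" unfolding R_sum[symmetric] by simp
    finally show "2 * (d / 8) * card X < (\<Sum>x\<in>X. real (card {y\<in>X. R x y}))" .
  qed
  then obtain U where U: "U \<subseteq> X" "U \<noteq> {}" and U_deg: "\<And>u. u \<in> U \<Longrightarrow> card {v\<in>U. R u v} \<ge> d / 8" by blast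
  have finU: "finite U" using U X finite_subset by auto
  define R' where "R' x y \<longleftrightarrow> R x y \<and> x \<in> U \<and> y \<in> U" for x y
  have R'_eq: "{v. R' u v} = {v\<in>U. R u v}" if "u \<in> U" for u using that by (auto simp: R'_def)
  have finR: "finite {y. R x y}" for x
    by (rule finite_subset[OF _ X(1)]) (use R_X R_sym in blast)
  interpret cover U R' fst "real D" l
  proof unfold_locales
    show "card {v. R' u v} \<le> real D" for u
    proof -
      have "card {v. R' u v} \<le> card {v. R u v}" by (rule card_mono[OF finR]) (auto simp: R'_def)
      then show ?thesis using R_deg[rule_format, of u] by simp
    qed
    show "\<exists>v. R' u v" if u: "u \<in> U" for u
    proof -
      have "card {v\<in>U. R u v} > 0" using U_deg[OF u] d by linarith
      then have "{v\<in>U. R u v} \<noteq> {}" by (metis card.empty less_irrefl)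
      then show ?thesis using u by (auto simp: R'_def)
    qed
    show "x = x' \<and> y = y' \<or> x = y' \<and> y = x'"
      if "R' x y" "R' x' y'" "{fst x, fst y} = {fst x', fst y'}" for x y x' y'
      using R_inj[rule_format, of x y x' y'] that by (simp add: R'_def)
  qed (use finU U l R_sym R_X in \<open>auto simp: R'_def\<close>)
  define Sat' where "Sat' = {T \<in> Sat. T \<subseteq> E}"
  have "\<exists>x\<in>CW. inj_on (\<lambda>i. fst (x i)) {..<2 * l} \<and> ed x ` {..<2 * l} \<notin> HH \<and>
    (\<forall>T\<in>Sat'. T \<subseteq> ed x ` {..<2 * l} \<longrightarrow> \<not> (2 \<le> card T \<and> card T \<le> 2 * l - 1))"
  proof (rule conflict_free_walk[of "real (card V)" s d])
    show "card {v. R' u v} \<ge> d / 8" if "u \<in> U" for u using U_deg[OF that] by (simp add: R'_eq[OF that])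
    show "card U \<le> 3 * real (card V)" using cX card_mono[OF X(1) U(1)] by linarith
    show "(\<Sum>u\<in>U. card {v. R' u v}) \<le> 2 * (card V * d)"
    proof -
      have "(\<Sum>u\<in>U. card {v. R' u v}) \<le> (\<Sum>u\<in>U. card {y\<in>X. R u y})"
        by (intro sum_mono card_mono) (use X U in \<open>auto simp: R'_def\<close>)
      also have "\<dots> \<le> (\<Sum>u\<in>X. card {y\<in>X. R u y})" by (rule sum_mono2) (use X U in auto)
      also have "\<dots> = 2 * card E" by (rule R_sum)
      finally have "real (\<Sum>u\<in>U. card {v. R' u v}) \<le> real (2 * card E)" by (rule of_nat_mono)
      then show ?thesis using E_hi by simp
    qed
    show "card {T \<in> Sat'. f \<in> T \<and> card T = t} \<le> eps l * s ^ (t - 1)" if "2 \<le> t" "t \<le> 2 * l - 1" for f t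
    proof (cases "f \<in> E")
      case True
      have "card {T \<in> Sat'. f \<in> T \<and> card T = t} \<le> card {T \<in> Sat. f \<in> T \<and> card T = t}"
        by (rule card_mono) (use finSat in \<open>auto simp: Sat'_def\<close>)
      then show ?thesis using \<sigma>[OF True that] by linarith
    next
      case False
      then have "{T \<in> Sat'. f \<in> T \<and> card T = t} = {}" by (auto simp: Sat'_def)
      then show ?thesis using eps_pos[OF l] s by (simp only: card.empty) simp
    qed
  qed (use n1 s A B d D finSat finHH HH HH_le in \<open>auto simp: Sat'_def\<close>)
  then obtain x where x: "x \<in> CW" "inj_on (\<lambda>i. fst (x i)) {..<2 * l}" "ed x ` {..<2 * l} \<notin> HH"
    "\<And>T. T \<in> Sat' \<Longrightarrow> T \<subseteq> ed x ` {..<2 * l} \<Longrightarrow> \<not> (2 \<le> card T \<and> card T \<le> 2 * l - 1)" by blast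
  have sub: "ed x ` {..<2 * l} \<subseteq> E"
  proof
    fix f assume "f \<in> ed x ` {..<2 * l}"
    then obtain i where i: "i < 2 * l" "f = ed x i" by auto
    then have "R (x i) (x (Suc i))" using x(1) by (simp add: CW_def R'_def)
    from R_X[OF this] i show "f \<in> E" by (simp add: ed_def)
  qed
  have "cycle_edges (2 * l) (ed x ` {..<2 * l})"
    unfolding cycle_edges_def
  proof (intro exI[of _ "\<lambda>i. fst (x i)"] conjI x(2) image_cong refl)
    fix i assume "i \<in> {..<2 * l}"
    then show "ed x i = {fst (x i), fst (x (Suc i mod (2 * l)))}"
      using CW_mod_Suc[OF x(1), of i] by (simp add: ed_def)
  qed
  moreover have "\<not> (2 \<le> card T \<and> card T \<le> 2 * l - 1)" if "T \<in> Sat" "T \<subseteq> ed x ` {..<2 * l}" for T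
    using x(4)[of T] that sub by (auto simp: Sat'_def)
  ultimately show ?thesis using sub x(3) by blast
qed

section \<open>Balanced supersaturation\<close>

text \<open>A maximal family of cycles subject to the degree bounds: if it were too small, then
  deleting the saturated edges leaves a graph in which a further cycle could be added.\<close>

lemma card_cycle_edges: "n \<ge> 3 \<Longrightarrow> cycle_edges n C \<Longrightarrow> card C = n"
  unfolding cycle_edges_def using inj_on_cycle_edges card_image by fastforce

lemma balanced_supersaturation:
  fixes V :: "'a set" and d s :: real
  assumes l: "l \<ge> 2" and finV: "finite V" "V \<noteq> {}" and E: "\<And>e. e \<in> E \<Longrightarrow> e \<subseteq> V \<and> card e = 2"
    and cE: "card E = card V * d" and s: "s \<ge> 1" "spread_min l \<le> s"
    and A: "card V * s ^ (l - 1) \<le> d ^ l" and B: "card V * s ^ (2 * l - 1) \<le> d ^ (2 * l - 1)"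
    and d: "d \<ge> 1"
  shows "\<exists>HH. finite HH \<and> HH \<noteq> {} \<and> (\<forall>C\<in>HH. C \<subseteq> E \<and> card C = 2 * l \<and> cycle_edges (2 * l) C) \<and>
    (\<forall>T. T \<noteq> {} \<longrightarrow> card {C\<in>HH. T \<subseteq> C} \<le>
      (1 / eps l + 4 * l + 2 ^ (2 * l) * (4 * l) / eps l) * (card HH / card E) * (1 / s) ^ (card T - 1))"
proof -
  have \<epsilon>: "eps l > 0" by (rule eps_pos[OF l])
  have n1: "real (card V) \<ge> 1" using finV by (simp add: card_gt_0_iff Suc_leI)
  define e where "e = real (card E)"
  have e: "e > 0" using cE n1 d by (simp add: e_def)
  have finE: "finite E" by (rule finite_subset[of _ "Pow V"]) (use E finV in auto)
  define X where "X = eps l * d ^ (2 * l)"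
  have X: "X > 0" using \<epsilon> d by (simp add: X_def)
  define a where "a = 2 ^ (2 * l) * (4 * l) / eps l"
  have a: "a > 0" using \<epsilon> l by (simp add: a_def)
  \<comment> \<open>Saturation thresholds. The first ensures that fewer than \<open>X\<close> cycles
    saturate at most half of the edges. For larger sets, \<open>a\<close> is chosen so that at most
    \<open>eps l * s ^ (t - 1)\<close> saturated sets of size \<open>t\<close> contain a given
    unsaturated edge.\<close>
  define Dt where "Dt t = (if t = 1 then 4 * l * X / e else a * X / (e * s ^ (t - 1)))" for t
  define Cyc where "Cyc = {C. C \<subseteq> E \<and> card C = 2 * l \<and> cycle_edges (2 * l) C}"
  \<comment> \<open>The \<open>1 +\<close> allows for the cycle that takes a set past its threshold.
    Sets of \<open>2 * l\<close> edges are left out, as such a set lies in at most one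
    cycle.\<close>
  define feasible where "feasible HH \<longleftrightarrow> HH \<subseteq> Cyc \<and>
    (\<forall>T. T \<noteq> {} \<longrightarrow> card T \<le> 2 * l - 1 \<longrightarrow> card {C\<in>HH. T \<subseteq> C} \<le> 1 + Dt (card T))" for HH
  have finCyc: "finite Cyc" by (rule finite_subset[of _ "Pow E"]) (use finE in \<open>auto simp: Cyc_def\<close>)
  have fin_feas: "finite {HH. feasible HH}"
    by (rule finite_subset[of _ "Pow Cyc"]) (use finCyc in \<open>auto simp: feasible_def\<close>)
  have Dt_nn: "Dt t \<ge> 0" for t using X e a s by (simp add: Dt_def)
  have "feasible {}" using Dt_nn by (auto simp: feasible_def intro: add_nonneg_nonneg)
  then have "card ` {HH. feasible HH} \<noteq> {}" by blast
  from Max_in[OF finite_imageI[OF fin_feas] this]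
  obtain HH where feas: "feasible HH" and "card HH = Max (card ` {HH. feasible HH})" by auto
  then have max: "card HH' \<le> card HH" if "feasible HH'" for HH'
    using that fin_feas by (auto intro!: Max_ge)
  have HH_Cyc: "HH \<subseteq> Cyc" using feas by (simp add: feasible_def)
  have finHH: "finite HH" using HH_Cyc finCyc finite_subset by auto
  have HHD: "C \<subseteq> E" "card C = 2 * l" "cycle_edges (2 * l) C" "finite C" if "C \<in> HH" for C
    using that HH_Cyc finite_subset[OF _ finE] by (auto simp: Cyc_def)
  have big: "card HH \<ge> X"
  proof (rule ccontr)
    assume "\<not> card HH \<ge> X"
    then have small: "card HH < X" by simp
    define E' where "E' = {f\<in>E. card {C\<in>HH. f \<in> C} \<le> Dt 1}"
    define Sat where "Sat = {T. T \<subseteq> E \<and> 2 \<le> card T \<and> card T \<le> 2 * l - 1 \<and> card {C\<in>HH. T \<subseteq> C} > Dt (card T)}"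
    have E'E: "E' \<subseteq> E" by (auto simp: E'_def)
    have half: "card E / 2 \<le> card E'"
    proof -
      have D1: "Dt 1 = 4 * l * X / e" by (simp add: Dt_def)
      have "card (E - E') * Dt 1 = (\<Sum>f\<in>E - E'. Dt 1)" by simp
      also have "\<dots> \<le> (\<Sum>f\<in>E - E'. real (card {C\<in>HH. f \<in> C}))"
        by (rule sum_mono) (auto simp: E'_def)
      also have "\<dots> \<le> (\<Sum>f\<in>E. real (card {C\<in>HH. f \<in> C}))"
        by (rule sum_mono2) (use finE in auto)
      also have "\<dots> = (\<Sum>f\<in>E. \<Sum>C\<in>{C\<in>HH. f \<in> C}. 1)" by simp
      also have "\<dots> = (\<Sum>C\<in>HH. \<Sum>f\<in>{f\<in>E. f \<in> C}. 1)"
        by (rule sum.swap_restrict) (use finE finHH in auto)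
      also have "\<dots> = (\<Sum>C\<in>HH. real (2 * l))"
      proof (rule sum.cong[OF refl])
        fix C assume C: "C \<in> HH"
        have "{f\<in>E. f \<in> C} = C" using HHD(1)[OF C] by auto
        then show "(\<Sum>f\<in>{f\<in>E. f \<in> C}. 1) = real (2 * l)" using HHD(2)[OF C] by simp
      qed
      also have "\<dots> \<le> X * (2 * l)" using small by (simp add: mult_right_mono)
      finally have "card (E - E') * (4 * l * X / e) \<le> X * (2 * l)" unfolding D1 .
      then have "card (E - E') \<le> e / 2" using X e l by (simp add: field_simps)
      moreover have "real (card (E - E')) = card E - real (card E')"
        using E'E finE by (simp add: card_Diff_subset finite_subset of_nat_diff card_mono)
      ultimately show ?thesis by (simp add: e_def)
    qed
    have finSat: "finite Sat" by (rule finite_subset[of _ "Pow E"]) (use finE in \<open>auto simp: Sat_def\<close>)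
    have "\<exists>C. cycle_edges (2 * l) C \<and> C \<subseteq> E' \<and> C \<notin> HH \<and>
      (\<forall>T\<in>Sat. T \<subseteq> C \<longrightarrow> \<not> (2 \<le> card T \<and> card T \<le> 2 * l - 1))"
    proof (rule conflict_free_cycle[OF l finV _ _ _ s A B d finSat finHH])
      show "e \<subseteq> V \<and> card e = 2" if "e \<in> E'" for e using E E'E that by auto
      show "card V * d / 2 \<le> card E'" using half cE by simp
      show "card E' \<le> card V * d" using card_mono[OF finE E'E] cE by linarith
      show "card D = 2 * l" if "D \<in> HH" for D using HHD that by auto
      show "card HH \<le> eps l * d ^ (2 * l)" using small by (simp add: X_def)
      fix f t assume f: "f \<in> E'" and t: "2 \<le> t" "t \<le> 2 * l - 1"
      define \<T> where "\<T> = {T \<in> Sat. f \<in> T \<and> card T = t}"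
      have fin\<T>: "finite \<T>" using finSat by (simp add: \<T>_def)
      have "card \<T> * Dt t = (\<Sum>T\<in>\<T>. Dt t)" by simp
      also have "\<dots> \<le> (\<Sum>T\<in>\<T>. real (card {C\<in>HH. T \<subseteq> C}))"
        by (rule sum_mono) (auto simp: \<T>_def Sat_def)
      also have "\<dots> = (\<Sum>T\<in>\<T>. \<Sum>C\<in>{C\<in>HH. T \<subseteq> C}. 1)" by simp
      also have "\<dots> = (\<Sum>C\<in>HH. \<Sum>T\<in>{T\<in>\<T>. T \<subseteq> C}. 1)"
        by (rule sum.swap_restrict) (use fin\<T> finHH in auto)
      \<comment> \<open>Only cycles through \<open>f\<close> count, each with at most
        \<open>2 ^ (2 * l)\<close> subsets, and \<open>f\<close>, being unsaturated, lies in at most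
        \<open>Dt 1\<close> of them.\<close>
      also have "\<dots> \<le> (\<Sum>C\<in>HH. if f \<in> C then 2 ^ (2 * l) else 0)"
      proof (rule sum_mono)
        fix C assume C: "C \<in> HH"
        show "(\<Sum>T\<in>{T\<in>\<T>. T \<subseteq> C}. 1) \<le> (if f \<in> C then 2 ^ (2 * l) else (0::real))"
        proof (cases "f \<in> C")
          case True
          have "card {T\<in>\<T>. T \<subseteq> C} \<le> card (Pow C)"
            by (rule card_mono) (use HHD(4)[OF C] in auto)
          also have "\<dots> = 2 ^ (2 * l)" using HHD[OF C] by (simp add: card_Pow)
          finally have "real (card {T\<in>\<T>. T \<subseteq> C}) \<le> real (2 ^ (2 * l))" by (rule of_nat_mono)
          then show ?thesis using True by simp
        next
          case False
          then have "{T\<in>\<T>. T \<subseteq> C} = {}" by (auto simp: \<T>_def)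
          then show ?thesis using False by (simp only: sum.empty) simp
        qed
      qed
      also have "\<dots> = 2 ^ (2 * l) * real (card {C\<in>HH. f \<in> C})"
        using finHH by (simp add: sum.If_cases Int_def)
      also have "\<dots> \<le> 2 ^ (2 * l) * Dt 1" using f by (intro mult_left_mono) (auto simp: E'_def)
      finally have "card \<T> * (a * X / (e * s ^ (t - 1))) \<le> 2 ^ (2 * l) * (4 * l * X / e)"
        using t by (simp add: Dt_def)
      also have "\<dots> = eps l * s ^ (t - 1) * (a * X / (e * s ^ (t - 1)))"
        using \<epsilon> s by (simp add: a_def)
      finally show "card {T \<in> Sat. f \<in> T \<and> card T = t} \<le> eps l * s ^ (t - 1)"
        unfolding \<T>_def by (rule mult_right_le_imp_le) (use a X e s in simp)
    qed
    then obtain C where C: "cycle_edges (2 * l) C" "C \<subseteq> E'" "C \<notin> HH"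
      and free: "\<And>T. T \<in> Sat \<Longrightarrow> T \<subseteq> C \<Longrightarrow> \<not> (2 \<le> card T \<and> card T \<le> 2 * l - 1)" by blast
    have finC: "finite C" by (rule finite_subset[OF order_trans[OF C(2) E'E] finE])
    have "feasible (insert C HH)"
      unfolding feasible_def
    proof (intro conjI allI impI)
      show "insert C HH \<subseteq> Cyc"
        using HH_Cyc C E'E l card_cycle_edges[of "2 * l" C] by (auto simp: Cyc_def)
      fix T :: "'a set set" assume T: "T \<noteq> {}" "card T \<le> 2 * l - 1"
      show "card {D\<in>insert C HH. T \<subseteq> D} \<le> 1 + Dt (card T)"
      proof (cases "T \<subseteq> C")
        case False
        then have "{D\<in>insert C HH. T \<subseteq> D} = {D\<in>HH. T \<subseteq> D}" by auto
        then show ?thesis using feas T by (simp add: feasible_def)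
      next
        case True
        then have "{D\<in>insert C HH. T \<subseteq> D} = insert C {D\<in>HH. T \<subseteq> D}" by auto
        then have "real (card {D\<in>insert C HH. T \<subseteq> D}) = 1 + card {D\<in>HH. T \<subseteq> D}"
          using finHH C by simp
        moreover have "card {D\<in>HH. T \<subseteq> D} \<le> Dt (card T)"
        proof (cases "card T = 1")
          case True1: True
          then obtain f where "T = {f}" by (auto simp: card_1_singleton_iff)
          then show ?thesis using True C(2) by (auto simp: E'_def)
        next
          case False
          have "finite T" using True finC finite_subset by auto
          then have "card T \<noteq> 0" using T by simp
          then have "2 \<le> card T" using False by linarith
          moreover have "T \<subseteq> E" using True C E'E by auto
          ultimately show ?thesis using free[of T] True T by (force simp: Sat_def)
        qed
        ultimately show ?thesis by simp
      qed
    qed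
    from max[OF this] C(3) finHH show False by simp
  qed
  define b where "b t = X / (e * s ^ (t - 1))" for t
  \<comment> \<open>Assumption \<open>B\<close> keeps the allowed degree bounded below up to
    \<open>t = 2 * l\<close>. This absorbs the additive 1 of feasibility and the degree 1 of a whole
    cycle.\<close>
  have b: "1 \<le> 1 / eps l * b t" if "t \<le> 2 * l" for t
  proof -
    have "s ^ (t - 1) \<le> s ^ (2 * l - 1)" using that s by (intro power_increasing) auto
    then have "card V * s ^ (t - 1) \<le> card V * s ^ (2 * l - 1)" by (intro mult_left_mono) auto
    then have "card V * s ^ (t - 1) \<le> d ^ (2 * l - 1)" using B by linarith
    then have "d * (card V * s ^ (t - 1)) \<le> d * d ^ (2 * l - 1)" using d by (intro mult_left_mono) auto
    also have "d * d ^ (2 * l - 1) = d ^ (2 * l)" using l by (simp add: power_eq_if)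
    finally have "e * s ^ (t - 1) \<le> d ^ (2 * l)" using cE by (simp add: e_def ac_simps)
    then show ?thesis using \<epsilon> e s by (simp add: b_def X_def field_simps)
  qed
  have b_nn: "b t \<ge> 0" for t using X e s by (simp add: b_def)
  define K where "K = 1 / eps l + 4 * l + a"
  have K: "K \<ge> 1 / eps l" using a by (simp add: K_def)
  have b_le: "K * b t \<le> K * (card HH / card E) * (1 / s) ^ (t - 1)" for t
  proof -
    have "b t \<le> card HH / (e * s ^ (t - 1))" unfolding b_def using big e s by (intro divide_right_mono) auto
    also have "\<dots> = card HH / card E * (1 / s) ^ (t - 1)" by (simp add: e_def power_divide)
    finally have "K * b t \<le> K * (card HH / card E * (1 / s) ^ (t - 1))"
      by (rule mult_left_mono) (use K \<epsilon> in \<open>auto intro: order_trans[rotated]\<close>)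
    then show ?thesis by (simp only: mult.assoc)
  qed
  have "card {C\<in>HH. T \<subseteq> C} \<le> K * b (card T)" if T: "T \<noteq> {}" for T
  proof -
    consider "{C\<in>HH. T \<subseteq> C} = {}" | C where "C \<in> HH" "T \<subseteq> C" "card T \<le> 2 * l - 1" "finite T"
      | C where "C \<in> HH" "T \<subseteq> C" "card T = 2 * l"
    proof -
      have "finite T" "card T \<le> 2 * l" if "C \<in> HH" "T \<subseteq> C" for C
        using HHD[OF that(1)] that(2) by (auto intro: finite_subset simp: card_mono)
         (metis HHD(2,4) card_mono that)
      then show thesis using that by (cases "{C\<in>HH. T \<subseteq> C} = {}") (auto, fastforce)
    qed
    then show ?thesis
    proof cases
      case 1
      have "K \<ge> 0" using K \<epsilon> by (meson divide_nonneg_pos order_trans zero_le_one)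
      then show ?thesis using b_nn[of "card T"] unfolding 1 by simp
    next
      case 2
      then have "card T \<ge> 1" using T by (simp add: Suc_leI card_gt_0_iff)
      have "card {C\<in>HH. T \<subseteq> C} \<le> 1 + Dt (card T)" using feas T 2 by (simp add: feasible_def)
      also have "Dt (card T) \<le> (4 * l + a) * b (card T)"
        using X e a s by (auto simp: Dt_def b_def distrib_right intro!: divide_right_mono)
      also have "1 + (4 * l + a) * b (card T) \<le> K * b (card T)"
        using b[of "card T"] 2 by (simp add: K_def distrib_right)
      finally show ?thesis by simp
    next
      case 3
      have "{D\<in>HH. T \<subseteq> D} \<subseteq> {C}"
      proof
        fix D assume D: "D \<in> {D\<in>HH. T \<subseteq> D}"
        then have "T = D" using HHD[of D] 3 by (metis (no_types, lifting) card_subset_eq mem_Collect_eq)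
        moreover have "T = C" using HHD[OF 3(1)] 3 by (metis card_subset_eq)
        ultimately show "D \<in> {C}" by simp
      qed
      then have "card {D\<in>HH. T \<subseteq> D} \<le> card {C}" by (rule card_mono[rotated]) simp
      then have "card {D\<in>HH. T \<subseteq> D} \<le> (1::real)" by simp
      also have "1 \<le> 1 / eps l * b (card T)" by (rule b) (use 3 in simp)
      also have "\<dots> \<le> K * b (card T)" by (intro mult_right_mono K b_nn)
      finally show ?thesis .
    qed
  qed
  then have fin: "card {C\<in>HH. T \<subseteq> C} \<le> K * (card HH / card E) * (1 / s) ^ (card T - 1)" if "T \<noteq> {}" for T
    using b_le[of "card T"] that by (meson order_trans)
  have "HH \<noteq> {}" using big X by auto
  then show ?thesis
    using finHH HHD fin by (intro exI[of _ HH]) (auto simp: K_def a_def)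
qed

section \<open>Containers for even-cycle-free graphs\<close>

lemma sum_Pow_power:
  fixes q :: real
  assumes "finite A"
  shows "(\<Sum>S\<in>Pow A. q ^ card S) = (1 + q) ^ card A"
  using assms
proof (induction A rule: finite_induct)
  case (insert a A)
  have "(\<Sum>S\<in>Pow (insert a A). q ^ card S) = (\<Sum>S\<in>Pow A. q ^ card S) + (\<Sum>S\<in>insert a ` Pow A. q ^ card S)"
    unfolding Pow_insert by (rule sum.union_disjoint) (use insert in auto)
  also have "(\<Sum>S\<in>insert a ` Pow A. q ^ card S) = (\<Sum>S\<in>Pow A. q ^ card (insert a S))"
    by (rule sum.reindex_cong[of "insert a"]) (use insert in \<open>auto simp: inj_on_def\<close>)
  also have "\<dots> = (\<Sum>S\<in>Pow A. q * q ^ card S)"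
  proof (rule sum.cong[OF refl])
    fix S assume "S \<in> Pow A"
    then have "finite S" "a \<notin> S" using insert finite_subset by auto
    then show "q ^ card (insert a S) = q * q ^ card S" by simp
  qed
  finally show ?case using insert by (simp add: sum_distrib_left[symmetric] algebra_simps)
qed simp

text \<open>Give each subset \<open>S\<close> the weight \<open>(1 / s) ^ card S\<close>. All
  subsets together weigh \<open>(1 + 1 / s) ^ card A\<close>, and every small one weighs at least
  \<open>(1 / s) powr x\<close>.\<close>

lemma card_small_subsets_le:
  assumes fin: "finite A" and s: "s \<ge> 1" and big: "card A / s \<ge> 1"
  shows "card (small_subsets A (1 / s * card A + 1)) \<le> exp (card A / s * (1 + 2 * ln s))"
proof -
  define x where "x = 1 / s * card A + 1"
  have "x = card A / s + 1" by (simp add: x_def)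
  then have x: "0 \<le> x" "x \<le> 2 * (card A / s)" using big by linarith+
  have "card (small_subsets A x) * (1 / s) powr x = (\<Sum>S\<in>small_subsets A x. (1 / s) powr x)" by simp
  also have "\<dots> \<le> (\<Sum>S\<in>small_subsets A x. (1 / s) ^ card S)"
  proof (rule sum_mono)
    fix S assume "S \<in> small_subsets A x"
    then have "real (card S) \<le> x" by (simp add: small_subsets_def)
    then have "(1 / s) powr x \<le> (1 / s) powr real (card S)" using s by (intro powr_mono') auto
    then show "(1 / s) powr x \<le> (1 / s) ^ card S" using s by (simp add: powr_realpow)
  qed
  also have "\<dots> \<le> (\<Sum>S\<in>Pow A. (1 / s) ^ card S)"
    by (rule sum_mono2) (use fin s in \<open>auto simp: small_subsets_def\<close>)
  also have "\<dots> = (1 + 1 / s) ^ card A" by (rule sum_Pow_power[OF fin])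
  also have "\<dots> \<le> exp (1 / s) ^ card A" using s by (intro power_mono exp_ge_add_one_self) auto
  also have "\<dots> = exp (card A / s)" by (simp add: exp_of_nat_mult[symmetric])
  finally have "card (small_subsets A x) \<le> exp (card A / s) * s powr x"
    using s by (simp add: powr_divide field_simps)
  also have "s powr x = exp (x * ln s)" using s by (simp add: powr_def)
  also have "\<dots> \<le> exp (2 * (card A / s) * ln s)"
    unfolding exp_le_cancel_iff using x(2) s by (intro mult_right_mono) auto
  also have "exp (card A / s) * exp (2 * (card A / s) * ln s) = exp (card A / s * (1 + 2 * ln s))"
    by (simp add: exp_add[symmetric] algebra_simps)
  finally show ?thesis by (simp add: x_def mult_left_mono)
qed

definition cycle_free :: "nat \<Rightarrow> 'a set set \<Rightarrow> bool" where
  "cycle_free n F \<longleftrightarrow> (\<forall>C\<subseteq>F. \<not> cycle_edges n C)"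

definition covers :: "nat \<Rightarrow> 'a set set \<Rightarrow> 'a set set set \<Rightarrow> bool" where
  "covers l E \<C> \<longleftrightarrow> finite \<C> \<and> (\<forall>C\<in>\<C>. C \<subseteq> E) \<and>
    (\<forall>F\<subseteq>E. cycle_free (2 * l) F \<longrightarrow> (\<exists>C\<in>\<C>. F \<subseteq> C))"

text \<open>The container theorem is applied with the edges of the graph as vertices and the
  balanced family of cycles as hyperedges, at \<open>p = 1 / s\<close>.\<close>

lemma container_step_spread:
  fixes l :: nat
  assumes l: "l \<ge> 2"
  shows "\<exists>(\<delta>::real) (s0::real). \<delta> > 0 \<and> s0 \<ge> 1 \<and> (\<forall>(V :: 'a set) E (d::real) (s::real). finite V \<longrightarrow> V \<noteq> {} \<longrightarrow>
    (\<forall>e\<in>E. e \<subseteq> V \<and> card e = 2) \<longrightarrow> card E = card V * d \<longrightarrow> s0 \<le> s \<longrightarrow>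
    card V * s ^ (l - 1) \<le> d ^ l \<longrightarrow> card V * s ^ (2 * l - 1) \<le> d ^ (2 * l - 1) \<longrightarrow> d \<ge> 1 \<longrightarrow>
    (\<exists>\<C>. covers l E \<C> \<and> (\<forall>C\<in>\<C>. card C \<le> (1 - \<delta>) * card E) \<and>
      card \<C> \<le> exp (2 * l * (card E / s * (1 + 2 * ln s)))))"
proof -
  define K where "K = 1 / eps l + 4 * l + 2 ^ (2 * l) * (4 * l) / eps l"
  have \<epsilon>: "eps l > 0" by (rule eps_pos[OF l])
  have K: "K > 0" unfolding K_def using \<epsilon> l by (intro add_pos_pos add_pos_nonneg) auto
  have "2 * l \<ge> 1" using l by simp
  from containers[OF this K] obtain \<delta> p0 :: real where \<delta>: "\<delta> > 0" and p0: "p0 > 0" and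
    cont: "\<forall>(E :: 'a set set) (p :: real) w. finite E \<longrightarrow> 0 < p \<longrightarrow> p \<le> p0 \<longrightarrow>
    p * card E \<ge> 1 \<longrightarrow> spread_weight E (2 * l) K p w \<longrightarrow>
    (\<exists>\<C>. container_family E w \<delta> (card (small_subsets E (p * card E + 1)) ^ (2 * l - 1)) \<C>)"
    by (elim exE conjE)
  define s0 where "s0 = max 1 (max (spread_min l) (1 / p0))"
  show ?thesis
  proof (rule exI[of _ \<delta>], rule exI[of _ s0], intro conjI allI impI)
    show "\<delta> > 0" "s0 \<ge> 1" using \<delta> by (auto simp: s0_def)
  next
    fix V :: "'a set" and E and d s :: real
    assume V: "finite V" "V \<noteq> {}" and E: "\<forall>e\<in>E. e \<subseteq> V \<and> card e = 2" and cE: "card E = card V * d"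
      and s: "s0 \<le> s" and A: "card V * s ^ (l - 1) \<le> d ^ l"
      and B: "card V * s ^ (2 * l - 1) \<le> d ^ (2 * l - 1)" and d: "d \<ge> 1"
    have s': "s \<ge> 1" "spread_min l \<le> s" "1 / p0 \<le> s" using s by (auto simp: s0_def)
    have n1: "real (card V) \<ge> 1" using V by (simp add: card_gt_0_iff Suc_leI)
    have finE: "finite E" by (rule finite_subset[of _ "Pow V"]) (use E V in auto)
    have Epos: "real (card E) > 0" using cE n1 d by simp
    from balanced_supersaturation[OF l V _ cE s'(1,2) A B d] E
    obtain HH where HH: "finite HH" "HH \<noteq> {}" "\<forall>C\<in>HH. C \<subseteq> E \<and> card C = 2 * l \<and> cycle_edges (2 * l) C"
      and deg: "\<forall>T. T \<noteq> {} \<longrightarrow> card {C\<in>HH. T \<subseteq> C} \<le> K * (card HH / card E) * (1 / s) ^ (card T - 1)"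
      unfolding K_def by auto
    have cHH: "real (card HH) > 0" using HH by (simp add: card_gt_0_iff)
    \<comment> \<open>Scaled to total weight \<open>card E\<close>, which turns the balanced degree
      bounds into those of a spread weight.\<close>
    define w where "w D = real (card E) / card HH * of_bool (D \<in> HH)" for D
    have "sum w (Pow E) = (\<Sum>D\<in>HH. real (card E) / card HH)"
      by (rule sum.mono_neutral_cong_right) (use finE HH in \<open>auto simp: w_def\<close>)
    then have tot: "sum w (Pow E) = card E" using cHH by simp
    have wdeg: "set_deg E w T \<le> K * (1 / s) ^ (card T - 1)" if "T \<noteq> {}" for T
    proof -
      have "set_deg E w T = (\<Sum>D\<in>{C\<in>HH. T \<subseteq> C}. real (card E) / card HH)"
        unfolding set_deg_def by (rule sum.mono_neutral_cong_right) (use finE HH in \<open>auto simp: w_def\<close>)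
      also have "\<dots> = card {C\<in>HH. T \<subseteq> C} * (real (card E) / card HH)" by simp
      also have "\<dots> \<le> K * (card HH / card E) * (1 / s) ^ (card T - 1) * (real (card E) / card HH)"
        using deg that by (intro mult_right_mono) auto
      also have "\<dots> = K * (1 / s) ^ (card T - 1)" using cHH Epos by simp
      finally show ?thesis .
    qed
    have spread: "spread_weight E (2 * l) K (1 / s) w"
      using tot wdeg HH(3) by (auto simp: spread_weight_def uniform_weight_def w_def)
    have sd: "s \<le> d" by (rule base_le_of_power_le[OF n1 _ _ _ B]) (use s' d l in auto)
    have "1 * s \<le> card V * d" using n1 sd d s' by (intro mult_mono) auto
    then have pN: "1 \<le> 1 / s * card E" using s' cE by (simp add: field_simps)
    have "0 < 1 / s" "1 / s \<le> p0" using s' p0 by (auto simp: field_simps)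
    from cont[rule_format, OF finE this pN spread] obtain \<C> where
      "container_family E w \<delta> (card (small_subsets E (1 / s * card E + 1)) ^ (2 * l - 1)) \<C>" by (elim exE)
    note C0 = this[unfolded container_family_def]
    define Z where "Z = card E / s * (1 + 2 * ln s)"
    have Z: "Z \<ge> 0" using s' by (simp add: Z_def)
    have "real (card \<C>) \<le> real (card (small_subsets E (1 / s * card E + 1)) ^ (2 * l - 1))"
      using C0 by (intro of_nat_mono) blast
    also have "\<dots> \<le> exp Z ^ (2 * l - 1)"
      unfolding of_nat_power Z_def using pN s' by (intro power_mono card_small_subsets_le finE) auto
    also have "\<dots> \<le> exp Z ^ (2 * l)" using Z by (intro power_increasing) auto
    also have "\<dots> = exp (2 * l * Z)" by (simp add: exp_of_nat_mult[symmetric])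
    finally have card\<C>: "real (card \<C>) \<le> exp (2 * l * Z)" .
    have ind: "indep w F" if "cycle_free (2 * l) F" for F
      unfolding indep_def
    proof (intro allI impI)
      fix D assume "D \<subseteq> F"
      then have "\<not> cycle_edges (2 * l) D" using that by (simp add: cycle_free_def)
      then have "D \<notin> HH" using HH(3) by blast
      then show "w D = 0" by (simp add: w_def)
    qed
    have "covers l E \<C>" unfolding covers_def using C0 ind by simp
    then show "\<exists>\<C>. covers l E \<C> \<and> (\<forall>C\<in>\<C>. card C \<le> (1 - \<delta>) * card E) \<and>
      card \<C> \<le> exp (2 * l * (card E / s * (1 + 2 * ln s)))"
      using C0 card\<C> by (intro exI[of _ \<C>]) (simp add: Z_def)
  qed
qed

section \<open>From the spread parameter to the edge density\<close>

definition loss_exp :: "nat \<Rightarrow> real" where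
  "loss_exp l = (real l - 1) / (real l * (2 * real l - 1))"

definition cycle_scale :: "nat \<Rightarrow> nat \<Rightarrow> real" where
  "cycle_scale l n = real n powr (1 + 1 / real l)"

lemma container_step_density:
  fixes l :: nat
  assumes l: "l \<ge> 2"
  shows "\<exists>(\<delta>::real) (k0::real). 0 < \<delta> \<and> \<delta> < 1 \<and> k0 \<ge> 3 \<and> (\<forall>(V :: 'a set) E (n::nat) (\<kappa>::real). finite V \<longrightarrow> V \<noteq> {} \<longrightarrow> card V = n \<longrightarrow>
    (\<forall>e\<in>E. e \<subseteq> V \<and> card e = 2) \<longrightarrow> card E = \<kappa> * cycle_scale l n \<longrightarrow> k0 \<le> \<kappa> \<longrightarrow>
    (\<exists>\<C>. covers l E \<C> \<and> (\<forall>C\<in>\<C>. card C \<le> (1 - \<delta>) * card E) \<and>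
      card \<C> \<le> exp (10 * l * cycle_scale l n * (\<kappa> powr (- 1 / (real l - 1)) + n powr (- loss_exp l)) * ln \<kappa>)))"
proof -
  from container_step_spread[OF l] obtain \<delta>0 s0 :: real where \<delta>0: "\<delta>0 > 0" and s0: "s0 \<ge> 1" and
   step: "\<forall>(V :: 'a set) E (d::real) (s::real). finite V \<longrightarrow> V \<noteq> {} \<longrightarrow>
    (\<forall>e\<in>E. e \<subseteq> V \<and> card e = 2) \<longrightarrow> card E = card V * d \<longrightarrow> s0 \<le> s \<longrightarrow>
    card V * s ^ (l - 1) \<le> d ^ l \<longrightarrow> card V * s ^ (2 * l - 1) \<le> d ^ (2 * l - 1) \<longrightarrow> d \<ge> 1 \<longrightarrow>
    (\<exists>\<C>. covers l E \<C> \<and> (\<forall>C\<in>\<C>. card C \<le> (1 - \<delta>0) * card E) \<and>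
      card \<C> \<le> exp (2 * l * (card E / s * (1 + 2 * ln s))))" by (elim exE conjE)
  define \<delta> where "\<delta> = min \<delta>0 (1 / 2)"
  define k0 where "k0 = max 3 s0"
  show ?thesis
  proof (rule exI[of _ \<delta>], rule exI[of _ k0], intro conjI allI impI)
    show "0 < \<delta>" "\<delta> < 1" "k0 \<ge> 3" using \<delta>0 by (auto simp: \<delta>_def k0_def)
  next
    fix V :: "'a set" and E n and \<kappa> :: real
    assume V: "finite V" "V \<noteq> {}" "card V = n" and E: "\<forall>e\<in>E. e \<subseteq> V \<and> card e = 2"
      and cE: "card E = \<kappa> * cycle_scale l n" and \<kappa>: "k0 \<le> \<kappa>"
    have \<kappa>': "\<kappa> \<ge> 3" "\<kappa> \<ge> s0" using \<kappa> by (auto simp: k0_def)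
    have "card V > 0" using V(1,2) by (simp add: card_gt_0_iff)
    then have n1: "real n \<ge> 1" using V(3) by linarith
    have l1: "real l \<ge> 2" using l by simp
    define \<beta> where "\<beta> = loss_exp l"
    have \<beta>: "\<beta> > 0" using l1 by (simp add: \<beta>_def loss_exp_def)
    define d where "d = \<kappa> * n powr (1 / l)"
    define s1 where "s1 = \<kappa> powr (l / (real l - 1))"
    \<comment> \<open>the largest values allowed by \<open>n s\<^bsup>l-1\<^esup> \<le> d\<^sup>l\<close> and \<open>n s\<^bsup>2l-1\<^esup> \<le> d\<^bsup>2l-1\<^esup>\<close> are \<open>s1\<close> and \<open>s2\<close>\<close>
    define s2 where "s2 = \<kappa> * n powr \<beta>"
    define s where "s = min s1 s2"
    have s1_ge: "s1 \<ge> \<kappa>"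
    proof -
      have "\<kappa> powr 1 \<le> s1" unfolding s1_def using \<kappa>' l1 by (intro powr_mono) auto
      then show ?thesis using \<kappa>' by simp
    qed
    have s2_ge: "s2 \<ge> \<kappa>" unfolding s2_def
      using \<kappa>' n1 \<beta> ge_one_powr_ge_zero[of "real n" \<beta>] by simp
    have s_ge: "s \<ge> \<kappa>" using s1_ge s2_ge by (simp add: s_def)
    have s_le: "s \<le> s1" "s \<le> s2" by (auto simp: s_def)
    have cE': "card E = card V * d"
      using n1 by (simp add: cE V d_def cycle_scale_def powr_add)
    have d1: "d \<ge> 1" unfolding d_def using \<kappa>' n1 l1 ge_one_powr_ge_zero[of "real n" "1 / l"]
      by (simp add: mult_ge1_I)
    have A: "card V * s ^ (l - 1) \<le> d ^ l"
    proof -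
      have "s ^ (l - 1) \<le> s1 ^ (l - 1)" using s_le s_ge \<kappa>' by (intro power_mono) auto
      also have "\<dots> = s1 powr (real l - 1)" using \<kappa>' l by (simp add: s1_def powr_realpow[symmetric] of_nat_diff)
      also have "\<dots> = \<kappa> powr l" unfolding s1_def powr_powr using l1 by simp
      also have "\<dots> = \<kappa> ^ l" using \<kappa>' by (simp add: powr_realpow)
      finally have "card V * s ^ (l - 1) \<le> n * \<kappa> ^ l" using V by (simp add: mult_left_mono)
      also have "\<dots> = d ^ l"
      proof -
        have "(n powr (1 / l)) ^ l = (n powr (1 / l)) powr l" using n1 by (intro powr_realpow[symmetric]) simp
        also have "\<dots> = n" using n1 l1 by (simp add: powr_powr)
        finally show ?thesis by (simp add: d_def power_mult_distrib)
      qed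
      finally show ?thesis .
    qed
    have B: "card V * s ^ (2 * l - 1) \<le> d ^ (2 * l - 1)"
    proof -
      have r: "real (2 * l - 1) = 2 * real l - 1" using l by (simp add: of_nat_diff)
      have "s ^ (2 * l - 1) \<le> s2 ^ (2 * l - 1)" using s_le s_ge \<kappa>' by (intro power_mono) auto
      also have "\<dots> = \<kappa> ^ (2 * l - 1) * (n powr \<beta>) ^ (2 * l - 1)" by (simp add: s2_def power_mult_distrib)
      also have "(n powr \<beta>) ^ (2 * l - 1) = (n powr \<beta>) powr (2 * real l - 1)"
        unfolding r[symmetric] using n1 by (intro powr_realpow[symmetric]) simp
      also have "\<dots> = n powr ((real l - 1) / l)"
        unfolding powr_powr \<beta>_def loss_exp_def using l1 by simp
      finally have "card V * s ^ (2 * l - 1) \<le> n powr 1 * (\<kappa> ^ (2 * l - 1) * n powr ((real l - 1) / l))"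
        using V n1 by (simp add: mult_left_mono)
      also have "\<dots> = \<kappa> ^ (2 * l - 1) * n powr (1 + (real l - 1) / l)"
        by (simp only: powr_add) simp
      also have "1 + (real l - 1) / l = (1 / l) * (2 * real l - 1)" using l1 by (simp add: field_simps)
      also have "n powr \<dots> = (n powr (1 / l)) powr real (2 * l - 1)" by (simp only: powr_powr r)
      also have "\<dots> = (n powr (1 / l)) ^ (2 * l - 1)" using n1 by (intro powr_realpow) simp
      also have "\<kappa> ^ (2 * l - 1) * \<dots> = d ^ (2 * l - 1)" by (simp add: d_def power_mult_distrib)
      finally show ?thesis .
    qed
    have "s0 \<le> s" using \<kappa>' s_ge by linarith
    from step[rule_format, OF V(1,2) _ cE' this A B d1] E
    obtain \<C> where C: "covers l E \<C>" "\<forall>C\<in>\<C>. card C \<le> (1 - \<delta>0) * card E"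
      "card \<C> \<le> exp (2 * l * (card E / s * (1 + 2 * ln s)))" by auto
    have ln\<kappa>: "ln \<kappa> \<ge> 1"
      using \<kappa>' exp_le by (subst ln_ge_iff) auto
    \<comment> \<open>Since \<open>l / (l - 1) \<le> 2\<close>, the logarithm of \<open>s\<close> is
      at most twice that of \<open>\<kappa>\<close>; the additive 1 is absorbed because
      \<open>\<kappa> \<ge> 3\<close>.\<close>
    have "ln s \<le> ln s1" using s_le s_ge \<kappa>' by (subst ln_le_cancel_iff) auto
    also have "\<dots> = l / (real l - 1) * ln \<kappa>" using \<kappa>' by (simp add: s1_def ln_powr)
    also have "\<dots> \<le> 2 * ln \<kappa>" using ln\<kappa> l1 by (intro mult_right_mono) (auto simp: field_simps)
    finally have lns: "1 + 2 * ln s \<le> 5 * ln \<kappa>" using ln\<kappa> by linarith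
    have sc: "cycle_scale l n \<ge> 0" by (simp add: cycle_scale_def)
    have "card E / s \<le> cycle_scale l n * (\<kappa> powr (- 1 / (real l - 1)) + n powr (- \<beta>))"
    proof -
      have e1: "\<kappa> / s1 = \<kappa> powr (- 1 / (real l - 1))"
      proof -
        have "\<kappa> / s1 = \<kappa> powr (1 - l / (real l - 1))" using \<kappa>' by (simp add: s1_def powr_diff)
        also have "1 - l / (real l - 1) = - 1 / (real l - 1)" using l1 by (simp add: field_simps)
        finally show ?thesis .
      qed
      have e2: "\<kappa> / s2 = n powr (- \<beta>)" using \<kappa>' by (simp add: s2_def powr_minus field_simps)
      \<comment> \<open>The minimum defining \<open>s\<close> becomes a sum of two cost terms, which
        can be summed separately over the iteration.\<close>
      have "\<kappa> / s \<le> \<kappa> / s1 + \<kappa> / s2"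
        using \<kappa>' s1_ge s2_ge by (auto simp: s_def min_def)
      then have "\<kappa> / s \<le> \<kappa> powr (- 1 / (real l - 1)) + n powr (- \<beta>)" unfolding e1 e2 .
      then have "cycle_scale l n * (\<kappa> / s) \<le> cycle_scale l n * (\<kappa> powr (- 1 / (real l - 1)) + n powr (- \<beta>))"
        using sc by (rule mult_left_mono)
      then show ?thesis by (simp add: cE mult.commute)
    qed
    then have "card E / s * (1 + 2 * ln s) \<le>
        cycle_scale l n * (\<kappa> powr (- 1 / (real l - 1)) + n powr (- \<beta>)) * (5 * ln \<kappa>)"
      using lns s_ge \<kappa>' sc by (intro mult_mono) (auto intro!: mult_nonneg_nonneg add_nonneg_nonneg)
    then have "2 * l * (card E / s * (1 + 2 * ln s)) \<le>
        2 * l * (cycle_scale l n * (\<kappa> powr (- 1 / (real l - 1)) + n powr (- \<beta>)) * (5 * ln \<kappa>))"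
      by (rule mult_left_mono) simp
    also have "\<dots> = 10 * l * cycle_scale l n * (\<kappa> powr (- 1 / (real l - 1)) + n powr (- \<beta>)) * ln \<kappa>" by simp
    finally have "exp (2 * l * (card E / s * (1 + 2 * ln s))) \<le>
      exp (10 * l * cycle_scale l n * (\<kappa> powr (- 1 / (real l - 1)) + n powr (- \<beta>)) * ln \<kappa>)"
      by (subst exp_le_cancel_iff)
    with C(3) have "card \<C> \<le> exp (10 * l * cycle_scale l n * (\<kappa> powr (- 1 / (real l - 1)) + n powr (- \<beta>)) * ln \<kappa>)"
      by linarith
    moreover have "(1 - \<delta>0) * card E \<le> (1 - \<delta>) * card E" by (intro mult_right_mono) (auto simp: \<delta>_def)
    with C(2) have "\<forall>C\<in>\<C>. card C \<le> (1 - \<delta>) * card E" by (meson order_trans)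
    ultimately show "\<exists>\<C>. covers l E \<C> \<and> (\<forall>C\<in>\<C>. card C \<le> (1 - \<delta>) * card E) \<and>
      card \<C> \<le> exp (10 * l * cycle_scale l n * (\<kappa> powr (- 1 / (real l - 1)) + n powr (- loss_exp l)) * ln \<kappa>)"
      using C(1) unfolding \<beta>_def by blast
  qed
qed

text \<open>Bounds the cost at any density between \<open>k * \<rho> ^ i\<close> and
  \<open>k * \<rho> ^ Suc i\<close>: the decreasing power is taken at the lower end, the increasing
  logarithm at the upper end.\<close>

definition step_cost :: "nat \<Rightarrow> nat \<Rightarrow> real \<Rightarrow> real \<Rightarrow> nat \<Rightarrow> real" where
  "step_cost l n k \<rho> i = 10 * l * cycle_scale l n *
    ((k * \<rho> ^ i) powr (- 1 / (real l - 1)) + n powr (- loss_exp l)) * ln (k * \<rho> ^ Suc i)"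

text \<open>\<open>j\<close> is the number of factors \<open>\<rho>\<close> by which the graph may
  exceed the target. A shrinking step removes one of them, and a graph already below the next level
  passes for free. Uniting the containers of all containers multiplies their numbers, so costs add
  up in the exponent.\<close>

lemma iterated_containers:
  fixes l :: nat
  assumes l: "l \<ge> 2"
  shows "\<exists>(\<rho>::real) (k0::real). \<rho> > 1 \<and> k0 \<ge> 3 \<and> (\<forall>(V :: 'a set) E (n::nat) (k::real) (j::nat). finite V \<longrightarrow> V \<noteq> {} \<longrightarrow> card V = n \<longrightarrow>
    (\<forall>e\<in>E. e \<subseteq> V \<and> card e = 2) \<longrightarrow> k0 \<le> k \<longrightarrow> card E \<le> k * \<rho> ^ j * cycle_scale l n \<longrightarrow>
    (\<exists>\<C>. covers l E \<C> \<and> (\<forall>C\<in>\<C>. card C \<le> k * cycle_scale l n) \<and>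
      card \<C> \<le> exp (\<Sum>i<j. step_cost l n k \<rho> i)))"
proof -
  from container_step_density[OF l] obtain \<delta> k0 :: real where \<delta>: "0 < \<delta>" "\<delta> < 1" and k0: "k0 \<ge> 3" and
   step: "\<forall>(V :: 'a set) E (n::nat) (\<kappa>::real). finite V \<longrightarrow> V \<noteq> {} \<longrightarrow> card V = n \<longrightarrow>
    (\<forall>e\<in>E. e \<subseteq> V \<and> card e = 2) \<longrightarrow> card E = \<kappa> * cycle_scale l n \<longrightarrow> k0 \<le> \<kappa> \<longrightarrow>
    (\<exists>\<C>. covers l E \<C> \<and> (\<forall>C\<in>\<C>. card C \<le> (1 - \<delta>) * card E) \<and>
      card \<C> \<le> exp (10 * l * cycle_scale l n * (\<kappa> powr (- 1 / (real l - 1)) + n powr (- loss_exp l)) * ln \<kappa>))"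
    by (elim exE conjE)
  define \<rho> where "\<rho> = 1 / (1 - \<delta>)"
  have \<rho>: "\<rho> > 1" using \<delta> by (simp add: \<rho>_def field_simps)
  have \<rho>\<delta>: "(1 - \<delta>) * \<rho> = 1" using \<delta> by (simp add: \<rho>_def)
  show ?thesis
  proof (rule exI[of _ \<rho>], rule exI[of _ k0], intro conjI allI impI)
    show "\<rho> > 1" "k0 \<ge> 3" by (fact \<rho> k0)+
  next
    fix V :: "'a set" and E n and k :: real and j
    assume V: "finite V" "V \<noteq> {}" "card V = n" and E: "\<forall>e\<in>E. e \<subseteq> V \<and> card e = 2" and k: "k0 \<le> k"
      and cE: "card E \<le> k * \<rho> ^ j * cycle_scale l n"
    have "card V > 0" using V(1,2) by (simp add: card_gt_0_iff)
    then have n1: "real n \<ge> 1" using V(3) by linarith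
    have sc: "cycle_scale l n > 0" using n1 by (simp add: cycle_scale_def)
    have kp: "k \<ge> 3" using k k0 by linarith
    have kr: "k * \<rho> ^ i \<ge> k" for i using kp \<rho> by (simp add: mult_le_cancel_left1)
    have cost_nn: "step_cost l n k \<rho> i \<ge> 0" for i
    proof -
      have "1 \<le> k * \<rho> ^ Suc i" using kr[of "Suc i"] kp by linarith
      then have "ln (k * \<rho> ^ Suc i) \<ge> 0" by (rule ln_ge_zero)
      then show ?thesis unfolding step_cost_def using sc
        by (intro mult_nonneg_nonneg add_nonneg_nonneg) auto
    qed
    show "\<exists>\<C>. covers l E \<C> \<and> (\<forall>C\<in>\<C>. card C \<le> k * cycle_scale l n) \<and>
      card \<C> \<le> exp (\<Sum>i<j. step_cost l n k \<rho> i)"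
      using E cE
    proof (induction j arbitrary: E)
      case 0
      then show ?case by (intro exI[of _ "{E}"]) (auto simp: covers_def)
    next
      case (Suc j)
      show ?case
      proof (cases "card E \<le> k * \<rho> ^ j * cycle_scale l n")
        case True
        from Suc.IH[OF Suc.prems(1) True] obtain \<C> where C: "covers l E \<C>"
          "\<forall>C\<in>\<C>. card C \<le> k * cycle_scale l n" "card \<C> \<le> exp (\<Sum>i<j. step_cost l n k \<rho> i)" by blast
        have "exp (\<Sum>i<j. step_cost l n k \<rho> i) \<le> exp (\<Sum>i<Suc j. step_cost l n k \<rho> i)"
          using cost_nn[of j] by simp
        with C(3) have "card \<C> \<le> exp (\<Sum>i<Suc j. step_cost l n k \<rho> i)" by linarith
        then show ?thesis using C(1,2) by blast
      next
        case False
        define \<kappa> where "\<kappa> = card E / cycle_scale l n"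
        have \<kappa>E: "card E = \<kappa> * cycle_scale l n" using sc by (simp add: \<kappa>_def)
        have lo: "k * \<rho> ^ j \<le> \<kappa>" using False sc unfolding \<kappa>E by simp
        have hi: "\<kappa> \<le> k * \<rho> ^ Suc j" using Suc.prems(2) sc unfolding \<kappa>E by simp
        have \<kappa>k: "k \<le> \<kappa>" using lo kr[of j] by linarith
        then have "k0 \<le> \<kappa>" using k by linarith
        from step[rule_format, OF V _ \<kappa>E this] Suc.prems(1)
        obtain \<C> where C: "covers l E \<C>" "\<forall>C\<in>\<C>. card C \<le> (1 - \<delta>) * card E"
          "card \<C> \<le> exp (10 * l * cycle_scale l n * (\<kappa> powr (- 1 / (real l - 1)) + n powr (- loss_exp l)) * ln \<kappa>)" by auto
        have "10 * l * cycle_scale l n * (\<kappa> powr (- 1 / (real l - 1)) + n powr (- loss_exp l)) * ln \<kappa> \<le> step_cost l n k \<rho> j"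
          unfolding step_cost_def
        proof (intro mult_mono add_mono order_refl)
          show "\<kappa> powr (- 1 / (real l - 1)) \<le> (k * \<rho> ^ j) powr (- 1 / (real l - 1))"
            using lo kr[of j] kp l by (intro powr_mono2') auto
          show "ln \<kappa> \<le> ln (k * \<rho> ^ Suc j)" using hi \<kappa>k kp by (subst ln_le_cancel_iff) auto
        qed (use sc \<kappa>k kp in auto)
        then have C3: "card \<C> \<le> exp (step_cost l n k \<rho> j)" using C(3) by (meson exp_le_cancel_iff order_trans)
        have "\<exists>\<D>. covers l C \<D> \<and> (\<forall>D\<in>\<D>. card D \<le> k * cycle_scale l n) \<and>
            card \<D> \<le> exp (\<Sum>i<j. step_cost l n k \<rho> i)" if CC: "C \<in> \<C>" for C
        proof (rule Suc.IH)
          show "\<forall>e\<in>C. e \<subseteq> V \<and> card e = 2" using CC C(1) Suc.prems(1) by (auto simp: covers_def)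
          have "card C \<le> (1 - \<delta>) * card E" using C(2) CC by blast
          also have "\<dots> \<le> (1 - \<delta>) * (k * \<rho> ^ Suc j * cycle_scale l n)"
            using Suc.prems(2) \<delta> by (intro mult_left_mono) auto
          also have "\<dots> = ((1 - \<delta>) * \<rho>) * (k * \<rho> ^ j * cycle_scale l n)" by simp
          finally show "card C \<le> k * \<rho> ^ j * cycle_scale l n" unfolding \<rho>\<delta> by simp
        qed
        then obtain f where f: "\<And>C. C \<in> \<C> \<Longrightarrow> covers l C (f C) \<and> (\<forall>D\<in>f C. card D \<le> k * cycle_scale l n) \<and>
            card (f C) \<le> exp (\<Sum>i<j. step_cost l n k \<rho> i)" by metis
        have fin\<C>: "finite \<C>" using C(1) by (simp add: covers_def)
        have "real (card (\<Union>C\<in>\<C>. f C)) \<le> real (\<Sum>C\<in>\<C>. card (f C))"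
          by (rule of_nat_mono[OF card_UN_le[OF fin\<C>]])
        also have "\<dots> = (\<Sum>C\<in>\<C>. real (card (f C)))" by simp
        also have "\<dots> \<le> (\<Sum>C\<in>\<C>. exp (\<Sum>i<j. step_cost l n k \<rho> i))" by (rule sum_mono) (use f in blast)
        also have "\<dots> = card \<C> * exp (\<Sum>i<j. step_cost l n k \<rho> i)" by simp
        also have "\<dots> \<le> exp (step_cost l n k \<rho> j) * exp (\<Sum>i<j. step_cost l n k \<rho> i)"
          using C3 by (intro mult_right_mono) auto
        also have "\<dots> = exp (\<Sum>i<Suc j. step_cost l n k \<rho> i)" by (simp add: exp_add[symmetric] add.commute)
        finally have cU: "real (card (\<Union>C\<in>\<C>. f C)) \<le> exp (\<Sum>i<Suc j. step_cost l n k \<rho> i)" .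
        have cov: "covers l E (\<Union>C\<in>\<C>. f C)"
          unfolding covers_def
        proof (intro conjI allI impI)
          show "finite (\<Union>C\<in>\<C>. f C)" using fin\<C> f by (auto simp: covers_def)
          show "\<forall>D\<in>\<Union>C\<in>\<C>. f C. D \<subseteq> E" using f C(1) unfolding covers_def by (meson UN_E order_trans)
          fix F assume F: "F \<subseteq> E" "cycle_free (2 * l) F"
          then obtain C where "C \<in> \<C>" "F \<subseteq> C" using C(1) by (auto simp: covers_def)
          moreover then obtain D where "D \<in> f C" "F \<subseteq> D" using f[of C] F by (auto simp: covers_def)
          ultimately show "\<exists>D\<in>\<Union>C\<in>\<C>. f C. F \<subseteq> D" by blast
        qed
        have "\<forall>D\<in>\<Union>C\<in>\<C>. f C. card D \<le> k * cycle_scale l n" using f by blast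
        then show ?thesis using cov cU by blast
      qed
    qed
  qed
qed

text \<open>The density term decays geometrically while the logarithm grows linearly in
  \<open>i\<close>, hence the convergent sum of \<open>(i + 1) * \<theta> ^ i\<close>. The term
  \<open>n powr (- \<beta>)\<close> is paid in full in each of the logarithmically many steps, which
  produces the second factor \<open>ln n\<close>.\<close>

lemma container_total_cost:
  fixes l :: nat and \<rho> :: real
  assumes l: "l \<ge> 2" and \<rho>: "\<rho> > 1"
  shows "\<exists>C>0. \<forall>(n::nat) (k::real). 3 \<le> n \<longrightarrow> 3 \<le> k \<longrightarrow>
    k \<le> n powr ((real l - 1)\<^sup>2 / (real l * (2 * real l - 1))) / ln n ^ (l - 1) \<longrightarrow>
    (\<Sum>i<nat \<lceil>2 * ln n / ln \<rho>\<rceil>. step_cost l n k \<rho> i) \<le> C * k powr (- 1 / (real l - 1)) * cycle_scale l n * ln k"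
proof -
  have l1: "real l \<ge> 2" using l by simp
  define \<alpha> where "\<alpha> = - 1 / (real l - 1)"
  have \<alpha>: "\<alpha> < 0" "\<alpha> \<ge> -1" using l1 by (auto simp: \<alpha>_def field_simps)
  define \<beta> where "\<beta> = loss_exp l"
  have \<beta>: "\<beta> > 0" using l1 by (simp add: \<beta>_def loss_exp_def)
  define \<theta> where "\<theta> = \<rho> powr \<alpha>"
  have \<theta>: "0 < \<theta>" "\<theta> < 1" using \<rho> \<alpha> by (auto simp: \<theta>_def powr_less_one)
  have ln\<rho>: "ln \<rho> > 0" using \<rho> by simp
  define S1 where "S1 = (1 + ln \<rho>) * (1 / (1 - \<theta>)\<^sup>2)"
  define S2 where "S2 = (2 / ln \<rho> + 1) * (3 + ln \<rho>) * (2 / \<beta> + 16 / \<beta>\<^sup>2)"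
  define C where "C = 10 * l * (S1 + S2)"
  have S: "S1 > 0" "S2 > 0" using ln\<rho> \<theta> \<beta> by (auto simp: S1_def S2_def intro!: mult_pos_pos add_pos_pos divide_pos_pos)
  then have C: "C > 0" using l by (simp add: C_def)
  show ?thesis
  proof (rule exI[of _ C], intro conjI allI impI)
    show "C > 0" by (rule C)
  next
    fix n :: nat and k :: real
    assume n: "3 \<le> n" and k: "3 \<le> k"
      and kn: "k \<le> n powr ((real l - 1)\<^sup>2 / (real l * (2 * real l - 1))) / ln n ^ (l - 1)"
    have ge1: "ln x \<ge> 1" if "x \<ge> 3" for x :: real
      using that exp_le by (subst ln_ge_iff) auto
    have lnk: "ln k \<ge> 1" and lnn: "ln n \<ge> 1" using ge1[OF k] ge1[of "real n"] n by auto
    have n1: "real n > 1" "real n > 0" using n by auto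
    have exp_eq: "(real l - 1)\<^sup>2 / (real l * (2 * real l - 1)) = \<beta> * (real l - 1)"
      by (simp add: \<beta>_def loss_exp_def power2_eq_square)
    have kn': "k \<le> n powr (\<beta> * (real l - 1)) / ln n ^ (l - 1)" using kn unfolding exp_eq .
    have \<beta>l: "\<beta> * (real l - 1) \<le> 1"
    proof -
      have "(real l - 1) * (real l - 1) \<le> real l * (2 * real l - 1)" using l1 by (intro mult_mono) auto
      then show ?thesis using l1 by (simp add: \<beta>_def loss_exp_def field_simps)
    qed
    have kn_le: "k \<le> n"
    proof -
      have "k * 1 \<le> k * ln n ^ (l - 1)" using k lnn by (intro mult_left_mono one_le_power) auto
      also have "\<dots> \<le> n powr (\<beta> * (real l - 1))" using kn' lnn by (simp add: pos_le_divide_eq)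
      also have "\<dots> \<le> n powr 1" using n1 \<beta>l by (intro powr_mono) auto
      finally show ?thesis using n1 by simp
    qed
    then have lnkn: "ln k \<le> ln n" using k by simp
    \<comment> \<open>The assumed bound says
      \<open>k \<le> (n powr \<beta> / ln n) ^ (l - 1)\<close>; raising it to the negative power
      \<open>\<alpha>\<close> reverses it into this form.\<close>
    have main: "n powr (- \<beta>) * ln n \<le> k powr \<alpha>"
    proof -
      have r: "real (l - 1) = real l - 1" using l by (simp add: of_nat_diff)
      have pos: "n powr \<beta> / ln n > 0" using n1 lnn by simp
      have "k \<le> (n powr \<beta> / ln n) ^ (l - 1)"
      proof -
        have "n powr (\<beta> * (real l - 1)) = (n powr \<beta>) ^ (l - 1)"
          using n1 by (subst powr_realpow[symmetric]) (simp_all only: powr_powr r, simp)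
        then show ?thesis using kn' by (simp only: power_divide)
      qed
      also have "\<dots> = (n powr \<beta> / ln n) powr (real l - 1)" by (simp only: r[symmetric] powr_realpow[OF pos])
      finally have "((n powr \<beta> / ln n) powr (real l - 1)) powr \<alpha> \<le> k powr \<alpha>"
        using \<alpha> k by (intro powr_mono2') auto
      also have "((n powr \<beta> / ln n) powr (real l - 1)) powr \<alpha> = (n powr \<beta> / ln n) powr (- 1)"
        using l1 by (simp add: powr_powr \<alpha>_def)
      also have "\<dots> = n powr (- \<beta>) * ln n" using pos n1 by (simp add: powr_minus_divide powr_minus field_simps)
      finally show ?thesis .
    qed
    \<comment> \<open>for large \<open>k\<close> use the assumed upper bound on \<open>k\<close>; for small \<open>k\<close> there is polynomial room\<close>
    have key: "n powr (- \<beta>) * (ln n)\<^sup>2 \<le> (2 / \<beta> + 16 / \<beta>\<^sup>2) * (k powr \<alpha> * ln k)"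
    proof (cases "ln k \<ge> \<beta> / 2 * ln n")
      case True
      have "n powr (- \<beta>) * (ln n)\<^sup>2 = (n powr (- \<beta>) * ln n) * ln n" by (simp add: power2_eq_square)
      also have "\<dots> \<le> k powr \<alpha> * (2 / \<beta> * ln k)"
        using main True \<beta> lnn by (intro mult_mono) (auto simp: field_simps)
      also have "\<dots> = 2 / \<beta> * (k powr \<alpha> * ln k)" by simp
      also have "\<dots> \<le> (2 / \<beta> + 16 / \<beta>\<^sup>2) * (k powr \<alpha> * ln k)"
        using lnk \<beta> by (intro mult_right_mono) auto
      finally show ?thesis .
    next
      case False
      have "k = exp (ln k)" using k by simp
      also have "\<dots> \<le> exp (\<beta> / 2 * ln n)" using False by simp
      also have "\<dots> = n powr (\<beta> / 2)" using n1 by (simp add: powr_def)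
      finally have "(n powr (\<beta> / 2)) powr \<alpha> \<le> k powr \<alpha>" using \<alpha> k by (intro powr_mono2') auto
      moreover have "n powr (- \<beta> / 2) \<le> (n powr (\<beta> / 2)) powr \<alpha>"
        unfolding powr_powr using n1 \<alpha> \<beta> mult_left_mono[OF \<alpha>(2), of "\<beta> / 2"] by (intro powr_mono) auto
      ultimately have k\<alpha>: "n powr (- \<beta> / 2) \<le> k powr \<alpha>" by linarith
      \<comment> \<open>Half of the exponent \<open>\<beta>\<close> is spent on the two logarithms;
        the other half still suffices, as \<open>k powr \<alpha>\<close> is at least
        \<open>n powr (- \<beta> / 2)\<close> in this case.\<close>
      have "ln n \<le> n powr (\<beta> / 4) / (\<beta> / 4)" by (rule ln_powr_bound) (use n1 \<beta> in auto)
      then have "(ln n)\<^sup>2 \<le> (n powr (\<beta> / 4) / (\<beta> / 4))\<^sup>2" using lnn by (intro power_mono) auto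
      also have "\<dots> = 16 / \<beta>\<^sup>2 * n powr (\<beta> / 2)"
        by (simp add: power2_eq_square powr_add[symmetric])
      finally have "n powr (- \<beta>) * (ln n)\<^sup>2 \<le> n powr (- \<beta>) * (16 / \<beta>\<^sup>2 * n powr (\<beta> / 2))"
        by (intro mult_left_mono) auto
      also have "\<dots> = 16 / \<beta>\<^sup>2 * n powr (- \<beta> / 2)" by (simp add: powr_add[symmetric])
      also have "\<dots> \<le> 16 / \<beta>\<^sup>2 * (k powr \<alpha> * ln k)"
      proof (rule mult_left_mono)
        have "k powr \<alpha> * 1 \<le> k powr \<alpha> * ln k" using lnk by (intro mult_left_mono) auto
        then show "n powr (- \<beta> / 2) \<le> k powr \<alpha> * ln k" using k\<alpha> by linarith
      qed simp
      also have "\<dots> \<le> (2 / \<beta> + 16 / \<beta>\<^sup>2) * (k powr \<alpha> * ln k)"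
        using lnk \<beta> by (intro mult_right_mono) auto
      finally show ?thesis .
    qed
    \<comment> \<open>So many steps that \<open>\<rho> ^ J \<ge> n ^ 2\<close>, which covers the
      descent from the complete graph.\<close>
    define J where "J = nat \<lceil>2 * ln n / ln \<rho>\<rceil>"
    have J: "real J \<le> 2 * ln n / ln \<rho> + 1" using lnn ln\<rho> by (simp add: J_def)
    then have J': "real J \<le> (2 / ln \<rho> + 1) * ln n" using lnn by (simp add: distrib_right)
    have ln_step: "ln (k * \<rho> ^ i) = ln k + i * ln \<rho>" for i
      using k \<rho> by (simp add: ln_mult ln_realpow)
    define sc where "sc = cycle_scale l n"
    have sc: "sc \<ge> 0" by (simp add: sc_def cycle_scale_def)
    have "(\<Sum>i<J. step_cost l n k \<rho> i) \<le> (\<Sum>i<J. 10 * l * sc *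
      (k powr \<alpha> * ln k * (1 + ln \<rho>) * (Suc i * \<theta> ^ i) + n powr (- \<beta>) * ((3 + ln \<rho>) * ln n)))"
    proof (rule sum_mono)
      fix i assume "i \<in> {..<J}"
      then have i: "Suc i \<le> J" by simp
      have p: "(k * \<rho> ^ i) powr \<alpha> = k powr \<alpha> * \<theta> ^ i"
        using k \<rho> by (simp add: powr_mult \<theta>_def powr_realpow[symmetric] powr_powr mult.commute)
      have "real (Suc i) * ln \<rho> \<le> real (Suc i) * ln \<rho> * ln k" "ln k \<le> real (Suc i) * ln k"
        using lnk ln\<rho> by auto
      then have a: "ln (k * \<rho> ^ Suc i) \<le> (1 + ln \<rho>) * Suc i * ln k"
        unfolding ln_step by (simp add: algebra_simps)
      have "real (Suc i) * ln \<rho> \<le> J * ln \<rho>" using i ln\<rho> by (intro mult_right_mono) auto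
      also have "\<dots> \<le> (2 * ln n / ln \<rho> + 1) * ln \<rho>" using J ln\<rho> by (intro mult_right_mono) auto
      also have "\<dots> = 2 * ln n + ln \<rho>" using ln\<rho> by (simp add: field_simps)
      also have "\<dots> \<le> 2 * ln n + ln \<rho> * ln n" using ln\<rho> lnn by simp
      finally have b: "ln (k * \<rho> ^ Suc i) \<le> (3 + ln \<rho>) * ln n"
        unfolding ln_step using lnkn by (simp add: algebra_simps)
      have "((k * \<rho> ^ i) powr \<alpha> + n powr (- \<beta>)) * ln (k * \<rho> ^ Suc i)
        = k powr \<alpha> * \<theta> ^ i * ln (k * \<rho> ^ Suc i) + n powr (- \<beta>) * ln (k * \<rho> ^ Suc i)"
        by (simp only: p distrib_right)
      also have "\<dots> \<le> k powr \<alpha> * \<theta> ^ i * ((1 + ln \<rho>) * Suc i * ln k) + n powr (- \<beta>) * ((3 + ln \<rho>) * ln n)"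
        by (intro add_mono mult_left_mono a b) (use \<theta> in auto)
      finally have "10 * l * sc * (((k * \<rho> ^ i) powr \<alpha> + n powr (- \<beta>)) * ln (k * \<rho> ^ Suc i))
        \<le> 10 * l * sc * (k powr \<alpha> * \<theta> ^ i * ((1 + ln \<rho>) * Suc i * ln k) + n powr (- \<beta>) * ((3 + ln \<rho>) * ln n))"
        using sc by (intro mult_left_mono) auto
      then show "step_cost l n k \<rho> i \<le> 10 * l * sc *
        (k powr \<alpha> * ln k * (1 + ln \<rho>) * (Suc i * \<theta> ^ i) + n powr (- \<beta>) * ((3 + ln \<rho>) * ln n))"
        unfolding step_cost_def \<alpha>_def[symmetric] \<beta>_def[symmetric] sc_def[symmetric]
        by (simp only: of_nat_mult of_nat_numeral ac_simps)
    qed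
    also have "\<dots> = 10 * l * sc * (k powr \<alpha> * ln k * (1 + ln \<rho>) * (\<Sum>i<J. Suc i * \<theta> ^ i)
        + J * (n powr (- \<beta>) * ((3 + ln \<rho>) * ln n)))"
      by (simp only: sum_distrib_left[symmetric] sum.distrib sum_constant card_lessThan) (simp only: ac_simps)
    also have "\<dots> \<le> 10 * l * sc * (k powr \<alpha> * ln k * S1 + S2 * (k powr \<alpha> * ln k))"
    proof (intro mult_left_mono add_mono)
      have sums: "(\<lambda>i. real (Suc i) * \<theta> ^ i) sums (1 / (1 - \<theta>)\<^sup>2)"
        using geometric_deriv_sums[of \<theta>] \<theta> by simp
      have "(\<Sum>i<J. real (Suc i) * \<theta> ^ i) \<le> 1 / (1 - \<theta>)\<^sup>2"
        using sum_le_suminf[OF sums_summable[OF sums], of "{..<J}"] \<theta> sums_unique[OF sums] by simp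
      then have "k powr \<alpha> * ln k * (1 + ln \<rho>) * (\<Sum>i<J. real (Suc i) * \<theta> ^ i)
          \<le> k powr \<alpha> * ln k * (1 + ln \<rho>) * (1 / (1 - \<theta>)\<^sup>2)"
        using lnk ln\<rho> by (intro mult_left_mono) auto
      then show "k powr \<alpha> * ln k * (1 + ln \<rho>) * (\<Sum>i<J. real (Suc i) * \<theta> ^ i) \<le> k powr \<alpha> * ln k * S1"
        by (simp add: S1_def)
      have "J * (n powr (- \<beta>) * ((3 + ln \<rho>) * ln n))
          \<le> ((2 / ln \<rho> + 1) * ln n) * (n powr (- \<beta>) * ((3 + ln \<rho>) * ln n))"
        using J' ln\<rho> lnn by (intro mult_right_mono) auto
      also have "\<dots> = (2 / ln \<rho> + 1) * (3 + ln \<rho>) * (n powr (- \<beta>) * (ln n)\<^sup>2)"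
        by (simp only: power2_eq_square ac_simps)
      also have "\<dots> \<le> (2 / ln \<rho> + 1) * (3 + ln \<rho>) * ((2 / \<beta> + 16 / \<beta>\<^sup>2) * (k powr \<alpha> * ln k))"
        using key ln\<rho> by (intro mult_left_mono) auto
      finally show "J * (n powr (- \<beta>) * ((3 + ln \<rho>) * ln n)) \<le> S2 * (k powr \<alpha> * ln k)"
        by (simp only: S2_def mult.assoc)
    qed (use sc in auto)
    also have "\<dots> = C * k powr \<alpha> * sc * ln k" by (simp add: C_def algebra_simps)
    finally show "(\<Sum>i<nat \<lceil>2 * ln n / ln \<rho>\<rceil>. step_cost l n k \<rho> i)
        \<le> C * k powr (- 1 / (real l - 1)) * cycle_scale l n * ln k"
      unfolding J_def sc_def \<alpha>_def .
  qed
qed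

text \<open>The edges of a cycle together with its vertices form a subgraph, and the function
  listing the vertices is an isomorphism from the cycle graph.\<close>

lemma cycle_free_of_free_of:
  assumes F: "F \<in> graphs_on V" and free: "free_of (cycle_graph m) F"
  shows "cycle_free m (edges F)"
  unfolding cycle_free_def
proof (intro allI impI notI)
  fix C assume C: "C \<subseteq> edges F" "cycle_edges m C"
  then obtain f where inj: "inj_on f {..<m}" and C_eq: "C = (\<lambda>i. {f i, f (Suc i mod m)}) ` {..<m}"
    by (auto simp: cycle_edges_def)
  define S where "S = (f ` {0..<m}, C)"
  have simp: "simple_graph F" using F by (simp add: graphs_on_def)
  have lt: "Suc i mod m < m" if "i < m" for i using that by simp
  have edge: "e \<subseteq> f ` {0..<m}" if "e \<in> C" for e using that lt by (auto simp: C_eq)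
  have vert: "f i \<in> verts F" if "i < m" for i
  proof -
    have "{f i, f (Suc i mod m)} \<in> edges F" using C(1) that by (auto simp: C_eq)
    then show ?thesis using simp by (auto simp: simple_graph_def)
  qed
  have "simple_graph S" using simp C(1) edge by (auto simp: S_def simple_graph_def)
  then have "subgraph S F" using simp C(1) vert by (auto simp: S_def subgraph_def)
  moreover have "isomorphic (cycle_graph m) S"
    unfolding isomorphic_def
  proof (intro exI[of _ f] conjI)
    show "bij_betw f (verts (cycle_graph m)) (verts S)"
      using inj by (simp add: cycle_graph_def S_def bij_betw_def lessThan_atLeast0)
    have "edges (cycle_graph m) = (\<lambda>i. {i, Suc i mod m}) ` {..<m}"
      by (auto simp: cycle_graph_def)
    then show "edges S = (\<lambda>e. f ` e) ` edges (cycle_graph m)"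
      by (simp add: S_def C_eq image_image)
  qed
  ultimately show False using free unfolding free_of_def by blast
qed

theorem theorem5p1:
  fixes l :: nat
  assumes "l \<ge> 2"
  shows "\<exists>C::real. C > 0 \<and> (\<exists>N::nat. \<forall>n::nat. \<forall>k::nat. n \<ge> N \<longrightarrow> k \<ge> N \<longrightarrow>
    real k \<le> real n powr ((real l - 1)\<^sup>2 / (real l * (2 * real l - 1))) / (ln (real n)) ^ (l - 1) \<longrightarrow>
    (\<exists>\<G> :: nat graph set.
       \<G> \<subseteq> graphs_on {1..n} \<and> finite \<G> \<and>
       real (card \<G>) \<le>
         exp (C * real k powr (- 1 / (real l - 1)) * real n powr (1 + 1 / real l) * ln (real k)) \<and>
       (\<forall>G\<in>\<G>. real (card (edges G)) \<le> real k * real n powr (1 + 1 / real l)) \<and>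
       (\<forall>F\<in>graphs_on {1..n}. free_of (cycle_graph (2 * l)) F \<longrightarrow> (\<exists>G\<in>\<G>. subgraph F G))))"
proof -
  from iterated_containers[OF assms, where 'a = nat] obtain \<rho> k0 :: real where \<rho>: "\<rho> > 1" and k0: "k0 \<ge> 3" and
    iter: "\<forall>(V :: nat set) E (n::nat) (k::real) (j::nat). finite V \<longrightarrow> V \<noteq> {} \<longrightarrow> card V = n \<longrightarrow>
    (\<forall>e\<in>E. e \<subseteq> V \<and> card e = 2) \<longrightarrow> k0 \<le> k \<longrightarrow> card E \<le> k * \<rho> ^ j * cycle_scale l n \<longrightarrow>
    (\<exists>\<C>. covers l E \<C> \<and> (\<forall>C\<in>\<C>. card C \<le> k * cycle_scale l n) \<and>
      card \<C> \<le> exp (\<Sum>i<j. step_cost l n k \<rho> i))" by (elim exE conjE)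
  from container_total_cost[OF assms \<rho>] obtain C where C: "C > 0" and
    cost: "\<forall>(n::nat) (k::real). 3 \<le> n \<longrightarrow> 3 \<le> k \<longrightarrow>
    k \<le> n powr ((real l - 1)\<^sup>2 / (real l * (2 * real l - 1))) / ln n ^ (l - 1) \<longrightarrow>
    (\<Sum>i<nat \<lceil>2 * ln n / ln \<rho>\<rceil>. step_cost l n k \<rho> i) \<le> C * k powr (- 1 / (real l - 1)) * cycle_scale l n * ln k"
    by (elim exE conjE)
  \<comment> \<open>One threshold serves both variables: \<open>k\<close> has to reach
    \<open>k0\<close>, and \<open>k0 \<ge> 3\<close> gives the condition on \<open>n\<close> in the
    cost bound.\<close>
  define N where "N = nat \<lceil>k0\<rceil>"
  show ?thesis
  proof (rule exI[of _ C], intro conjI exI[of _ N] allI impI)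
    show "C > 0" by (rule C)
  next
    fix n k :: nat
    assume nN: "N \<le> n" and kN: "N \<le> k" and kn: "real k \<le>
      real n powr ((real l - 1)\<^sup>2 / (real l * (2 * real l - 1))) / (ln (real n)) ^ (l - 1)"
    have n: "real n \<ge> 3" and k: "real k \<ge> k0" "real k \<ge> 3"
      using nN kN k0 unfolding N_def by linarith+
    define J where "J = nat \<lceil>2 * ln n / ln \<rho>\<rceil>"
    \<comment> \<open>The iteration starts from the complete graph, which contains every graph to be
      covered.\<close>
    define E where "E = {e. e \<subseteq> {1..n} \<and> card e = 2}"
    have "card E = n choose 2" unfolding E_def by (subst n_subsets) auto
    also have "\<dots> \<le> n ^ 2" using n by (intro binomial_le_pow) simp
    finally have cE: "real (card E) \<le> real n ^ 2" by (metis of_nat_mono of_nat_power)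
    have "real n ^ 2 \<le> \<rho> ^ J"
    proof -
      have "2 * ln n \<le> J * ln \<rho>"
        using \<rho> n by (simp add: J_def pos_divide_le_eq[symmetric])
      then have "exp (2 * ln n) \<le> exp (J * ln \<rho>)" by simp
      then show ?thesis using n \<rho> by (simp add: exp_of_nat_mult exp_double)
    qed
    also have "\<dots> \<le> k * \<rho> ^ J * cycle_scale l n"
    proof -
      have "1 * \<rho> ^ J * 1 \<le> k * \<rho> ^ J * cycle_scale l n"
        using k n \<rho> by (intro mult_mono) (auto simp: cycle_scale_def intro!: ge_one_powr_ge_zero)
      then show ?thesis by simp
    qed
    finally have cE': "real (card E) \<le> k * \<rho> ^ J * cycle_scale l n" using cE by linarith
    have "{1..n} \<noteq> {}" "card {1..n} = n" "\<forall>e\<in>E. e \<subseteq> {1..n} \<and> card e = 2"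
      using n by (auto simp: E_def)
    from iter[rule_format, OF finite_atLeastAtMost this(1,2) _ k(1) cE'] this(3)
    obtain \<C> where cov: "covers l E \<C>" and size: "\<forall>C\<in>\<C>. card C \<le> k * cycle_scale l n"
      and card\<C>: "card \<C> \<le> exp (\<Sum>i<J. step_cost l n k \<rho> i)" by auto
    have "(\<Sum>i<J. step_cost l n k \<rho> i) \<le> C * k powr (- 1 / (real l - 1)) * cycle_scale l n * ln k"
      unfolding J_def by (rule cost[rule_format]) (use n k kn in auto)
    then have "exp (\<Sum>i<J. step_cost l n k \<rho> i) \<le> exp (C * k powr (- 1 / (real l - 1)) * cycle_scale l n * ln k)"
      by simp
    with card\<C> have card\<C>': "card \<C> \<le> exp (C * k powr (- 1 / (real l - 1)) * cycle_scale l n * ln k)" by linarith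
    define \<G> where "\<G> = (\<lambda>D. ({1..n}, D)) ` \<C>"
    have G: "({1..n}, D) \<in> graphs_on {1..n}" if "D \<in> \<C>" for D
      using cov that by (auto simp: covers_def E_def graphs_on_def simple_graph_def)
    have card\<G>: "card \<G> = card \<C>" unfolding \<G>_def by (rule card_image) (auto simp: inj_on_def)
    show "\<exists>\<G> :: nat graph set.
       \<G> \<subseteq> graphs_on {1..n} \<and> finite \<G> \<and>
       real (card \<G>) \<le>
         exp (C * real k powr (- 1 / (real l - 1)) * real n powr (1 + 1 / real l) * ln (real k)) \<and>
       (\<forall>G\<in>\<G>. real (card (edges G)) \<le> real k * real n powr (1 + 1 / real l)) \<and>
       (\<forall>F\<in>graphs_on {1..n}. free_of (cycle_graph (2 * l)) F \<longrightarrow> (\<exists>G\<in>\<G>. subgraph F G))"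
    proof (intro exI[of _ \<G>] conjI ballI impI)
      show "\<G> \<subseteq> graphs_on {1..n}" using G by (auto simp: \<G>_def)
      show "finite \<G>" using cov by (simp add: \<G>_def covers_def)
      show "real (card \<G>) \<le>
         exp (C * real k powr (- 1 / (real l - 1)) * real n powr (1 + 1 / real l) * ln (real k))"
        using card\<C>' by (simp only: card\<G> cycle_scale_def)
      show "real (card (edges G)) \<le> real k * real n powr (1 + 1 / real l)" if "G \<in> \<G>" for G
        using that size by (auto simp: \<G>_def cycle_scale_def)
      fix F :: "nat graph" assume F: "F \<in> graphs_on {1..n}" and free: "free_of (cycle_graph (2 * l)) F"
      have "edges F \<subseteq> E" using F by (auto simp: graphs_on_def simple_graph_def E_def)
      moreover have "cycle_free (2 * l) (edges F)" by (rule cycle_free_of_free_of[OF F free])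
      ultimately obtain D where D: "D \<in> \<C>" "edges F \<subseteq> D" using cov by (auto simp: covers_def)
      then have "subgraph F ({1..n}, D)" using F G[OF D(1)] by (auto simp: subgraph_def graphs_on_def)
      then show "\<exists>G\<in>\<G>. subgraph F G" using D(1) by (auto simp: \<G>_def)
    qed
  qed
qed

end
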